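(* If $H$ is a separable infinite-dimensional Hilbert space over $\mathbb{K}\in\{\mathbb{R},\mathbb{C}\}$, and $A:\operatorname{dom}(A)\rightarrow H$ is a densely-defined self-adjoint operator on $H$, then there exist a probability space $(\Omega,\mathcal{A},\mu)$, a unitary operator $U:H\rightarrow L_2(\Omega,\mathcal{A},\mu)$ and a real multiplication operator $T$ on $L_2(\Omega,\mathcal{A},\mu)$ such that $U\circ A=T\circ U$.
   Context: $L_2(\Omega,\mathcal A,\mu)$ consists of $\mathbb{K}$-valued functions. A real multiplication operator $T$ is the operator $Tg=mg$ with domain $\{g\in L_2(\Omega,\mathcal A,\mu): mg\in L_2(\Omega,\mathcal A,\mu)\}$ for some measurable $m:\Omega\to\mathbb{R}$. The equality $U\circ A=T\circ U$ is an equality of (possibly unbounded) operators, including domains: $x\in\operatorname{dom}(A)$ if and only if $Ux\in\operatorname{dom}(T)$. *)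

theory Defs
  imports "HOL-Probability.Probability"
begin

(* The scalar field K in {R, C}.  The lemma K_real_or_complex below shows that these axioms
   admit nothing else; the banach and second-countability superclasses are there because
   Bochner integration of K-valued functions asks for them. *)
class real_or_complex = real_normed_field + banach + second_countable_topology +
  fixes kconj :: "'a \<Rightarrow> 'a"
  assumes kconj_add: "kconj (x + y) = kconj x + kconj y"
    and mult_kconj_scaleR: "x * kconj x = (norm x)\<^sup>2 *\<^sub>R 1"

instantiation real :: real_or_complex
begin
definition kconj_real :: "real \<Rightarrow> real" where "kconj_real x = x"
instance by standard (auto simp: kconj_real_def power2_eq_square)
end

instantiation complex :: real_or_complex
begin
definition kconj_complex :: "complex \<Rightarrow> complex" where "kconj_complex = cnj"
instance by standard (auto simp: kconj_complex_def complex_norm_square[symmetric] scaleR_conv_of_real)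
end

lemma mult_kconj: "x * kconj x = of_real ((norm (x::'k::real_or_complex))\<^sup>2)"
  by (simp add: mult_kconj_scaleR of_real_def)

lemma kconj_zero [simp]: "kconj (0::'k::real_or_complex) = 0"
  using kconj_add[of "0::'k" 0] by simp

lemma kconj_minus: "kconj (- x) = - kconj (x::'k::real_or_complex)"
  using kconj_add[of x "- x"] by (simp add: eq_neg_iff_add_eq_0 add.commute)

lemma kconj_diff: "kconj (x - y) = kconj x - kconj (y::'k::real_or_complex)"
  using kconj_add[of x "- y"] by (simp add: kconj_minus)

lemma kconj_mult: "kconj (x * y) = kconj x * kconj (y::'k::real_or_complex)"
proof (cases "x * y = 0")
  case False
  have "(x * y) * kconj (x * y) = (x * y) * (kconj x * kconj y)"
    using mult_kconj[of "x * y"] mult_kconj[of x] mult_kconj[of y]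
    by (simp add: norm_mult power_mult_distrib ac_simps)
  with False show ?thesis by simp
qed auto

lemma norm_kconj [simp]: "norm (kconj x) = norm (x::'k::real_or_complex)"
proof (cases "x = 0")
  case False
  have "norm x * norm (kconj x) = norm x * norm x"
    using arg_cong[OF mult_kconj[of x], of norm] by (simp add: norm_mult power2_eq_square)
  with False show ?thesis by simp
qed simp

lemma kconj_kconj [simp]: "kconj (kconj x) = (x::'k::real_or_complex)"
proof (cases "x = 0")
  case False
  then have "kconj x \<noteq> 0" by (metis norm_kconj norm_eq_zero)
  moreover have "kconj x * kconj (kconj x) = kconj x * x"
    using mult_kconj[of x] mult_kconj[of "kconj x"] by (simp add: mult.commute)
  ultimately show ?thesis by simp
qed simp

lemma kconj_of_real [simp]: "kconj (of_real r) = (of_real r :: 'k::real_or_complex)"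
proof (cases "r = 0")
  case False
  have "of_real r * kconj (of_real r) = of_real r * (of_real r :: 'k)"
    using mult_kconj[of "of_real r :: 'k"] by (simp add: power2_eq_square)
  with False show ?thesis by simp
qed simp

lemma add_kconj_real: "(x::'k::real_or_complex) + kconj x \<in> \<real>"
proof -
  have 1: "kconj (1::'k) = 1" using kconj_of_real[of 1] by simp
  have "x + kconj x = (x + 1) * kconj (x + 1) - x * kconj x - 1"
    unfolding kconj_add 1 by (simp add: algebra_simps)
  also have "\<dots> \<in> \<real>" unfolding mult_kconj by (intro Reals_diff Reals_of_real Reals_1)
  finally show ?thesis .
qed

lemma kconj_fixed_real: "kconj x = x \<Longrightarrow> (x::'k::real_or_complex) \<in> \<real>"
  using add_kconj_real[of x] Reals_mult[of "of_real (1/2) :: 'k" "x + x"] by simp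

lemma K_real_or_complex:
  "(\<forall>z::'k::real_or_complex. \<exists>a. z = of_real a) \<or>
   (\<exists>i::'k. i * i = - 1 \<and> kconj i = - i \<and> (\<forall>z. \<exists>a b. z = of_real a + of_real b * i))"
proof (cases "\<forall>z::'k. z \<in> \<real>")
  case True
  then show ?thesis by (meson Reals_cases)
next
  case False
  then obtain w :: 'k where w: "w \<notin> \<real>" by blast
  define v where "v = w - kconj w"
  have v0: "v \<noteq> 0" using w kconj_fixed_real[of w] by (auto simp: v_def)
  have vc: "kconj v = - v" by (simp add: v_def kconj_diff)
  have vv: "v * v = - of_real ((norm v)\<^sup>2)" using mult_kconj[of v] by (metis vc mult_minus_right minus_minus)
  define i where "i = of_real (1 / norm v) * v"
  have "i * i = of_real (1 / norm v) * of_real (1 / norm v) * (v * v)"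
    unfolding i_def by (simp only: ac_simps)
  also have "\<dots> = - 1"
    using v0 unfolding vv by (simp add: power2_eq_square)
  finally have ii: "i * i = - 1" .
  have ic: "kconj i = - i" unfolding i_def kconj_mult kconj_of_real vc by simp
  have "\<exists>a b. z = of_real a + of_real b * i" for z :: 'k
  proof -
    obtain a where a: "z + kconj z = of_real a" using add_kconj_real[of z] by (auto elim: Reals_cases)
    have "kconj ((z - kconj z) * i) = (z - kconj z) * i"
      by (simp add: kconj_mult kconj_diff ic algebra_simps)
    then obtain b where b: "(z - kconj z) * i = of_real b"
      using kconj_fixed_real by (auto elim: Reals_cases)
    have "z - kconj z = - ((z - kconj z) * (i * i))" by (simp add: ii)
    also have "\<dots> = - of_real b * i" by (simp add: b[symmetric] mult.assoc)
    finally have "(z + kconj z) + (z - kconj z) = of_real a + - of_real b * i" using a by simp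
    then have "2 * z = of_real a + - of_real b * i" by simp
    then have "z = of_real (a / 2) + of_real (- b / 2) * i" by (simp add: field_simps)
    then show ?thesis by blast
  qed
  with ii ic show ?thesis by blast
qed


(* A Hilbert space over K: the type carries the norm, topology and completeness, the locale the
   K-scalar multiplication extending the real one and the inner product inducing the norm.
   Inner products are linear in the first argument. *)
locale hilbert_space = vector_space smul
  for smul :: "'k::real_or_complex \<Rightarrow> 'h::banach \<Rightarrow> 'h" +
  fixes ip :: "'h \<Rightarrow> 'h \<Rightarrow> 'k"
  assumes smul_of_real: "smul (of_real r) x = r *\<^sub>R x"
    and ip_add_left: "ip (x + y) z = ip x z + ip y z"
    and ip_smul_left: "ip (smul c x) y = c * ip x y"
    and ip_commute: "ip y x = kconj (ip x y)"
    and ip_self: "ip x x = of_real ((norm x)\<^sup>2)"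

definition infinite_dimensional :: "('k::field \<Rightarrow> 'h::ab_group_add \<Rightarrow> 'h) \<Rightarrow> bool" where
  "infinite_dimensional smul \<longleftrightarrow> \<not> (\<exists>B. finite B \<and> module.span smul B = UNIV)"


(* An unbounded operator is given by its domain D and a function A that is relevant on D only. *)
definition linear_operator ::
    "('k::field \<Rightarrow> 'h::ab_group_add \<Rightarrow> 'h) \<Rightarrow> 'h set \<Rightarrow> ('h \<Rightarrow> 'h) \<Rightarrow> bool" where
  "linear_operator smul D A \<longleftrightarrow> module.subspace smul D \<and>
     (\<forall>x\<in>D. \<forall>y\<in>D. A (x + y) = A x + A y) \<and> (\<forall>c. \<forall>x\<in>D. A (smul c x) = smul c (A x))"

definition densely_defined :: "'h::topological_space set \<Rightarrow> bool" where
  "densely_defined D \<longleftrightarrow> closure D = UNIV"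

definition adjoint_dom :: "('h \<Rightarrow> 'h \<Rightarrow> 'k) \<Rightarrow> 'h set \<Rightarrow> ('h \<Rightarrow> 'h) \<Rightarrow> 'h set" where
  "adjoint_dom ip D A = {y. \<exists>z. \<forall>x\<in>D. ip (A x) y = ip x z}"

(* The described element is unique when D is dense. *)
definition adjoint_op :: "('h \<Rightarrow> 'h \<Rightarrow> 'k) \<Rightarrow> 'h set \<Rightarrow> ('h \<Rightarrow> 'h) \<Rightarrow> 'h \<Rightarrow> 'h" where
  "adjoint_op ip D A y = (THE z. \<forall>x\<in>D. ip (A x) y = ip x z)"

definition self_adjoint :: "('h \<Rightarrow> 'h \<Rightarrow> 'k) \<Rightarrow> 'h set \<Rightarrow> ('h \<Rightarrow> 'h) \<Rightarrow> bool" where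
  "self_adjoint ip D A \<longleftrightarrow> adjoint_dom ip D A = D \<and> (\<forall>y\<in>D. adjoint_op ip D A y = A y)"


definition square_integrable :: "'w measure \<Rightarrow> ('w \<Rightarrow> 'k::real_or_complex) set" where
  "square_integrable M = {f \<in> borel_measurable M. integrable M (\<lambda>w. (norm (f w))\<^sup>2)}"

definition L2_class ::
    "'w measure \<Rightarrow> ('w \<Rightarrow> 'k::real_or_complex) \<Rightarrow> ('w \<Rightarrow> 'k) set" where
  "L2_class M f = {g \<in> square_integrable M. AE w in M. g w = f w}"

definition L2 :: "'w measure \<Rightarrow> ('w \<Rightarrow> 'k::real_or_complex) set set" where
  "L2 M = L2_class M ` square_integrable M"

definition L2_rep :: "('w \<Rightarrow> 'k::real_or_complex) set \<Rightarrow> 'w \<Rightarrow> 'k" where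
  "L2_rep \<phi> = (SOME f. f \<in> \<phi>)"

(* The lemmas named _class below show independence of the chosen representatives. *)
definition L2_add :: "'w measure \<Rightarrow> ('w \<Rightarrow> 'k::real_or_complex) set \<Rightarrow> ('w \<Rightarrow> 'k) set \<Rightarrow> ('w \<Rightarrow> 'k) set" where
  "L2_add M \<phi> \<psi> = L2_class M (\<lambda>w. L2_rep \<phi> w + L2_rep \<psi> w)"

definition L2_scale :: "'w measure \<Rightarrow> 'k::real_or_complex \<Rightarrow> ('w \<Rightarrow> 'k) set \<Rightarrow> ('w \<Rightarrow> 'k) set" where
  "L2_scale M c \<phi> = L2_class M (\<lambda>w. c * L2_rep \<phi> w)"

definition L2_inner :: "'w measure \<Rightarrow> ('w \<Rightarrow> 'k::real_or_complex) set \<Rightarrow> ('w \<Rightarrow> 'k) set \<Rightarrow> 'k" where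
  "L2_inner M \<phi> \<psi> = (\<integral>w. L2_rep \<phi> w * kconj (L2_rep \<psi> w) \<partial>M)"

definition mult_dom :: "'w measure \<Rightarrow> ('w \<Rightarrow> real) \<Rightarrow> ('w \<Rightarrow> 'k::real_or_complex) set set" where
  "mult_dom M m = {\<phi> \<in> L2 M. (\<lambda>w. of_real (m w) * L2_rep \<phi> w) \<in> square_integrable M}"

definition mult_op ::
    "'w measure \<Rightarrow> ('w \<Rightarrow> real) \<Rightarrow> ('w \<Rightarrow> 'k::real_or_complex) set \<Rightarrow> ('w \<Rightarrow> 'k) set" where
  "mult_op M m \<phi> = L2_class M (\<lambda>w. of_real (m w) * L2_rep \<phi> w)"

definition real_multiplication_operator ::
    "'w measure \<Rightarrow> ('w \<Rightarrow> 'k::real_or_complex) set set \<Rightarrow>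
     (('w \<Rightarrow> 'k) set \<Rightarrow> ('w \<Rightarrow> 'k) set) \<Rightarrow> bool" where
  "real_multiplication_operator M DT T \<longleftrightarrow>
     (\<exists>m \<in> borel_measurable M. DT = mult_dom M m \<and> (\<forall>\<phi>\<in>DT. T \<phi> = mult_op M m \<phi>))"

definition unitary_to_L2 ::
    "('k::real_or_complex \<Rightarrow> 'h::ab_group_add \<Rightarrow> 'h) \<Rightarrow> ('h \<Rightarrow> 'h \<Rightarrow> 'k) \<Rightarrow>
     'w measure \<Rightarrow> ('h \<Rightarrow> ('w \<Rightarrow> 'k) set) \<Rightarrow> bool" where
  "unitary_to_L2 smul ip M U \<longleftrightarrow> bij_betw U UNIV (L2 M) \<and>
     (\<forall>x y. U (x + y) = L2_add M (U x) (U y)) \<and> (\<forall>c x. U (smul c x) = L2_scale M c (U x)) \<and>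
     (\<forall>x y. L2_inner M (U x) (U y) = ip x y)"

lemma borel_measurable_kconj [measurable]:
  "(kconj :: 'k::real_or_complex \<Rightarrow> 'k) \<in> borel_measurable borel"
proof (rule borel_measurable_continuous_onI)
  have "dist (kconj x) (kconj y) = dist x (y::'k)" for x y
    by (simp add: dist_norm kconj_diff[symmetric])
  then show "continuous_on UNIV (kconj :: 'k \<Rightarrow> 'k)"
    unfolding continuous_on_iff by metis
qed

lemma L2_class_cong: "(AE w in M. f w = g w) \<Longrightarrow> L2_class M f = L2_class M g"
  unfolding L2_class_def by (auto elim!: eventually_elim2)

lemma L2_rep_class:
  assumes "f \<in> square_integrable M"
  shows "L2_rep (L2_class M f) \<in> square_integrable M" "AE w in M. L2_rep (L2_class M f) w = f w"
proof -
  have "f \<in> L2_class M f" using assms by (simp add: L2_class_def)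
  then have "L2_rep (L2_class M f) \<in> L2_class M f" unfolding L2_rep_def by (metis someI_ex)
  then show "L2_rep (L2_class M f) \<in> square_integrable M" "AE w in M. L2_rep (L2_class M f) w = f w"
    by (auto simp: L2_class_def)
qed

lemma L2_add_class:
  "f \<in> square_integrable M \<Longrightarrow> g \<in> square_integrable M \<Longrightarrow>
   L2_add M (L2_class M f) (L2_class M g) = L2_class M (\<lambda>w. f w + g w)"
  unfolding L2_add_def using L2_rep_class(2)[of f M] L2_rep_class(2)[of g M]
  by (intro L2_class_cong) (auto elim: eventually_elim2)

lemma L2_scale_class:
  "f \<in> square_integrable M \<Longrightarrow> L2_scale M c (L2_class M f) = L2_class M (\<lambda>w. c * f w)"
  unfolding L2_scale_def using L2_rep_class(2)[of f M]
  by (intro L2_class_cong) (auto elim: eventually_mono)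

lemma L2_inner_class:
  assumes f: "f \<in> square_integrable M" and g: "g \<in> square_integrable M"
  shows "L2_inner M (L2_class M f) (L2_class M g) = (\<integral>w. f w * kconj (g w) \<partial>M)"
proof -
  have [measurable]: "f \<in> borel_measurable M" "g \<in> borel_measurable M"
    "L2_rep (L2_class M f) \<in> borel_measurable M" "L2_rep (L2_class M g) \<in> borel_measurable M"
    using f g L2_rep_class(1)[OF f] L2_rep_class(1)[OF g] by (auto simp: square_integrable_def)
  show ?thesis unfolding L2_inner_def
    using L2_rep_class(2)[OF f] L2_rep_class(2)[OF g]
    by (intro integral_cong_AE) (auto elim: eventually_elim2)
qed

lemma mult_op_class:
  "f \<in> square_integrable M \<Longrightarrow> mult_op M m (L2_class M f) = L2_class M (\<lambda>w. of_real (m w) * f w)"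
  unfolding mult_op_def using L2_rep_class(2)[of f M]
  by (intro L2_class_cong) (auto elim: eventually_mono)

lemma mult_dom_class:
  fixes f :: "'w \<Rightarrow> 'k::real_or_complex"
  assumes f: "f \<in> square_integrable M" and [measurable]: "m \<in> borel_measurable M"
  shows "L2_class M f \<in> mult_dom M m \<longleftrightarrow> (\<lambda>w. of_real (m w) * f w) \<in> square_integrable M"
proof -
  have [measurable]: "f \<in> borel_measurable M" "L2_rep (L2_class M f) \<in> borel_measurable M"
    using f L2_rep_class(1)[OF f] by (auto simp: square_integrable_def)
  have "integrable M (\<lambda>w. (norm (of_real (m w) * L2_rep (L2_class M f) w))\<^sup>2) \<longleftrightarrow>
        integrable M (\<lambda>w. (norm (of_real (m w) * f w))\<^sup>2)"
    using L2_rep_class(2)[OF f] by (intro integrable_cong_AE) (auto elim: eventually_mono)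
  then show ?thesis
    using f by (auto simp: mult_dom_def L2_def square_integrable_def)
qed

end

theory Submission
  imports Defs
begin

text \<open>
  Projecting \<open>(u, 0)\<close> onto the graph of \<open>A\<close> in \<open>H \<times> H\<close> produces the bounded commuting symmetric operators
  \<open>B = (1 + A\<^sup>2)\<^sup>-\<^sup>1\<close> and \<open>C = A B\<close>, which satisfy \<open>C\<^sup>2 = B - B\<^sup>2\<close> and determine \<open>A\<close>:
  \<open>A x = y\<close> holds iff \<open>B y = C x\<close>. The operators \<open>P = 1 - 2 B\<close> and \<open>Q = 2 C\<close> play the role of cosine and sine,
  that is, \<open>P + i Q\<close> is a unitary Cayley transform of \<open>A\<close>; working with the pair \<open>(P, Q)\<close> instead of
  \<open>P + i Q\<close> treats real and complex scalars alike.

  For a unit vector \<open>x\<close> the Fejer means of the trigonometric series with coefficients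
  \<open>\<langle>(P + i Q)\<^sup>k x, x\<rangle>\<close> are nonnegative, and Helly's theorem yields a measure with these moments. It has no mass
  where \<open>cos \<theta> = 1\<close> since \<open>B\<close> is injective, so it can be transported to the real line by
  \<open>a = sin \<theta> / (1 - cos \<theta>)\<close>, where \<open>B\<close> and \<open>C\<close> become \<open>1 / (1 + a\<^sup>2)\<close> and \<open>a / (1 + a\<^sup>2)\<close>.
  Splitting \<open>H\<close> into countably many orthogonal cyclic subspaces with generators \<open>x k\<close>, scaled so that
  \<open>norm (x k)\<^sup>2\<close> sums to 1, and placing the measure of \<open>x k\<close> on the fibre \<open>{k} \<times> \<real>\<close> gives the probability
  space; \<open>A\<close> becomes multiplication by the second coordinate.
\<close>

section \<open>Hilbert space geometry\<close>

text \<open>The unbounded \<open>A\<close> enters only through the equivalence of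
  \<open>A x = y\<close> with \<open>B y = C x\<close>, which carries the domain along: once
  \<open>B\<close> and \<open>C\<close> are multiplications by \<open>res_b\<close> and
  \<open>res_c\<close>, positivity of \<open>res_b\<close> turns \<open>B y = C x\<close> into
  pointwise multiplication by \<open>a\<close>, and membership in the domain becomes square
  integrability of the product. Bounded functions of \<open>a\<close> have a second merit. A
  spectral measure need not have finite moments in \<open>a\<close>, whereas polynomials in
  \<open>res_b\<close> and \<open>res_c\<close> are square integrable for every finite measure. They
  are also rich enough: the span of 1, \<open>res_b\<close> and \<open>res_c\<close> contains
  \<open>(a - s) * (a - t) / (1 + a^2)\<close>, whose sign separates the interval from
  \<open>s\<close> to \<open>t\<close> from its complement. Positivity of the Fejer means is
  positivity of the Gram matrix of the powers of a unitary, so no norm estimate for functions of an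
  operator is involved. The excluded points with \<open>cos \<theta> = 1\<close> correspond to
  \<open>a\<close> at infinity.\<close>

lemma tendsto_kconj: "(f \<longlongrightarrow> l) F \<Longrightarrow> ((\<lambda>n. kconj (f n :: 'k::real_or_complex)) \<longlongrightarrow> kconj l) F"
  by (simp add: tendsto_iff dist_norm kconj_diff[symmetric])

context hilbert_space begin

lemma ip_zero_left [simp]: "ip 0 x = 0"
  using ip_add_left[of 0 0 x] by simp

lemma ip_zero_right [simp]: "ip x 0 = 0"
  by (metis ip_zero_left ip_commute kconj_zero)

lemma ip_add_right: "ip z (x + y) = ip z x + ip z y"
  by (metis ip_add_left ip_commute kconj_add)

lemma ip_smul_right: "ip x (smul c y) = kconj c * ip x y"
  by (metis ip_smul_left ip_commute kconj_mult)

lemma ip_minus_left: "ip (- x) y = - ip x y"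
  using ip_add_left[of x "- x" y] by (simp add: eq_neg_iff_add_eq_0 add.commute)

lemma ip_minus_right: "ip y (- x) = - ip y x"
  using ip_add_right[of y x "- x"] by (simp add: eq_neg_iff_add_eq_0 add.commute)

lemma ip_diff_left: "ip (x - y) z = ip x z - ip y z"
  using ip_add_left[of x "- y" z] by (simp add: ip_minus_left)

lemma ip_diff_right: "ip z (x - y) = ip z x - ip z y"
  using ip_add_right[of z x "- y"] by (simp add: ip_minus_right)

lemma ip_scaleR_left: "ip (r *\<^sub>R x) y = of_real r * ip x y"
  by (simp add: smul_of_real[symmetric] ip_smul_left)

lemma ip_scaleR_right: "ip x (r *\<^sub>R y) = of_real r * ip x y"
  by (simp add: smul_of_real[symmetric] ip_smul_right)

lemma ip_eq_zero_iff: "ip x x = 0 \<longleftrightarrow> x = 0"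
  by (simp add: ip_self)

lemma ip_ext: "(\<And>z. ip x z = ip y z) \<Longrightarrow> x = y"
  by (metis ip_diff_left ip_eq_zero_iff eq_iff_diff_eq_0)

lemma norm_smul: "norm (smul c x) = norm c * norm x"
proof -
  have "(of_real ((norm (smul c x))\<^sup>2) :: 'k) = c * kconj c * ip x x"
    by (simp add: ip_self[symmetric] ip_smul_left ip_smul_right del: of_real_power)
  also have "\<dots> = of_real ((norm c)\<^sup>2 * (norm x)\<^sup>2)"
    by (simp add: mult_kconj ip_self)
  finally have "(norm (smul c x))\<^sup>2 = (norm c * norm x)\<^sup>2"
    by (simp only: of_real_eq_iff power_mult_distrib)
  then show ?thesis by (simp add: power2_eq_iff_nonneg)
qed

lemma smul_minus_one: "smul (-1) x = - x"
  using smul_of_real[of "-1" x] by simp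

lemma norm_add_sq: "of_real ((norm (x + y))\<^sup>2) = (of_real ((norm x)\<^sup>2 + (norm y)\<^sup>2) :: 'k) + (ip x y + ip y x)"
  by (simp only: ip_self[symmetric] ip_add_left ip_add_right of_real_add ac_simps)

lemma parallelogram: "(norm (x + y :: 'h))\<^sup>2 + (norm (x - y))\<^sup>2 = 2 * (norm x)\<^sup>2 + 2 * (norm y)\<^sup>2"
proof -
  have "ip (x + y) (x + y) + ip (x - y) (x - y) = 2 * ip x x + 2 * ip y y"
    by (simp add: ip_add_left ip_add_right ip_diff_left ip_diff_right)
  then have "(of_real ((norm (x + y))\<^sup>2 + (norm (x - y))\<^sup>2) :: 'k) = of_real (2 * (norm x)\<^sup>2 + 2 * (norm y)\<^sup>2)"
    by (simp add: ip_self)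
  then show ?thesis by (simp only: of_real_eq_iff)
qed

lemma pythagoras:
  assumes "ip x y = 0"
  shows "(norm (x + y))\<^sup>2 = (norm x)\<^sup>2 + (norm y)\<^sup>2"
proof -
  have "ip y x = 0" using assms ip_commute[of y x] by simp
  then have "(of_real ((norm (x + y))\<^sup>2) :: 'k) = of_real ((norm x)\<^sup>2 + (norm y)\<^sup>2)"
    using assms norm_add_sq[of x y] by simp
  then show ?thesis by (simp only: of_real_eq_iff)
qed

lemma cauchy_schwarz: "norm (ip x y) \<le> norm x * norm y"
proof (cases "y = 0")
  case False
  define c where "c = ip x y / of_real ((norm y)\<^sup>2)"
  have ny: "(norm y)\<^sup>2 \<noteq> 0" using False by simp
  have "ip (x - smul c y) (smul c y) = 0"
    using ny by (simp add: ip_smul_right ip_diff_left ip_smul_left ip_self c_def)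
  from pythagoras[OF this] have "(norm (smul c y))\<^sup>2 \<le> (norm x)\<^sup>2" by simp
  then have "norm c * norm y \<le> norm x" by (simp add: norm_smul power2_le_iff_abs_le)
  then have "norm c * norm y * norm y \<le> norm x * norm y" by (simp add: mult_right_mono)
  moreover have "norm c * norm y * norm y = norm (ip x y)"
    using ny unfolding c_def norm_divide norm_of_real by (simp add: power2_eq_square)
  ultimately show ?thesis by simp
qed simp

lemma tendsto_ip_left: "(f \<longlongrightarrow> l) F \<Longrightarrow> ((\<lambda>n. ip (f n) y) \<longlongrightarrow> ip l y) F"
proof (rule Lim_transform2[OF tendsto_const])
  assume "(f \<longlongrightarrow> l) F"
  then have "((\<lambda>n. norm (f n - l) * norm y) \<longlongrightarrow> 0) F"
    by (auto intro!: tendsto_eq_intros simp: LIM_zero)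
  then show "((\<lambda>n. ip l y - ip (f n) y) \<longlongrightarrow> 0) F"
    by (rule Lim_null_comparison[rotated])
       (auto simp: ip_diff_left[symmetric] intro!: always_eventually order_trans[OF cauchy_schwarz] mult_right_mono norm_minus_commute[THEN eq_refl])
qed

lemma tendsto_ip_right: "(f \<longlongrightarrow> l) F \<Longrightarrow> ((\<lambda>n. ip y (f n)) \<longlongrightarrow> ip y l) F"
  by (subst (1 2) ip_commute) (intro tendsto_kconj tendsto_ip_left)

lemma closed_subspace_orth: "closed {x. ip x y = 0}" "subspace {x. ip x y = 0}"
proof -
  show "closed {x. ip x y = 0}"
    unfolding closed_sequential_limits
  proof (intro allI impI, elim conjE)
    fix f l assume "\<forall>n. f n \<in> {x. ip x y = 0}" "f \<longlonglongrightarrow> l"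
    then show "l \<in> {x. ip x y = 0}"
      using tendsto_ip_left[of f l sequentially y] by (simp add: LIMSEQ_const_iff)
  qed
  show "subspace {x. ip x y = 0}"
    by (auto simp: subspace_def ip_add_left ip_smul_left)
qed

lemma subspace_scaleR: "subspace S \<Longrightarrow> x \<in> S \<Longrightarrow> r *\<^sub>R x \<in> S"
  using subspace_scale[of S x "of_real r"] by (simp add: smul_of_real)

lemma subspace_closure:
  assumes "subspace S"
  shows "subspace (closure S)"
proof (rule subspaceI)
  show "0 \<in> closure S" using assms closure_subset subspace_0 by blast
next
  fix x y assume "x \<in> closure S" "y \<in> closure S"
  then obtain f g where "\<And>n. f n \<in> S" "f \<longlonglongrightarrow> x" "\<And>n. g n \<in> S" "g \<longlonglongrightarrow> y"
    unfolding closure_sequential by blast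
  then show "x + y \<in> closure S"
    unfolding closure_sequential using assms
    by (intro exI[of _ "\<lambda>n. f n + g n"]) (auto intro: tendsto_add subspace_add)
next
  fix c x assume "x \<in> closure S"
  then obtain f where f: "\<And>n. f n \<in> S" "f \<longlonglongrightarrow> x"
    unfolding closure_sequential by blast
  have "(\<lambda>n. smul c (f n)) \<longlonglongrightarrow> smul c x"
  proof (rule Lim_transform2[OF tendsto_const])
    have "(\<lambda>n. norm c * norm (x - f n)) \<longlonglongrightarrow> 0"
      using f(2) by (auto intro!: tendsto_eq_intros)
    then show "(\<lambda>n. smul c x - smul c (f n)) \<longlonglongrightarrow> 0"
      by (rule Lim_null_comparison[rotated]) (simp add: norm_smul scale_right_diff_distrib[symmetric])
  qed
  then show "smul c x \<in> closure S"
    unfolding closure_sequential using assms f(1) by (meson subspace_scale)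
qed

text \<open>A minimising sequence for the distance to \<open>S\<close> is Cauchy by the
  parallelogram law, because midpoints stay in \<open>S\<close>; the error at the nearest point is
  orthogonal to \<open>S\<close>.\<close>

theorem projection_exists:
  assumes S: "subspace S" "closed S"
  shows "\<exists>y\<in>S. \<forall>z\<in>S. ip (x - y) z = 0"
proof -
  have ne: "S \<noteq> {}" using subspace_0[OF S(1)] by blast
  define d where "d = infdist x S"
  have d0: "0 \<le> d" by (simp add: d_def infdist_nonneg)
  have dle: "d \<le> norm (x - y)" if "y \<in> S" for y
    using infdist_le[OF that, of x] by (simp add: d_def dist_norm)
  have "\<exists>y\<in>S. norm (x - y) < d + inverse (real (Suc n))" for n
  proof (rule ccontr)
    assume "\<not> ?thesis"
    then have "d + inverse (real (Suc n)) \<le> infdist x S"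
      unfolding infdist_notempty[OF ne] by (intro cINF_greatest[OF ne]) (auto simp: dist_norm not_less)
    then show False by (simp add: d_def)
  qed
  then obtain f where f: "\<And>n. f n \<in> S" "\<And>n. norm (x - f n) < d + inverse (real (Suc n))" by metis
  have lim: "(\<lambda>n. norm (x - f n)) \<longlonglongrightarrow> d"
  proof (rule tendsto_sandwich[OF _ _ tendsto_const])
    show "(\<lambda>n. d + inverse (real (Suc n))) \<longlonglongrightarrow> d"
      using tendsto_add[OF tendsto_const LIMSEQ_inverse_real_of_nat] by simp
  qed (use dle f in \<open>auto intro!: always_eventually less_imp_le\<close>)
  have key: "(norm (f m - f n))\<^sup>2 \<le> 2 * (norm (x - f m))\<^sup>2 + 2 * (norm (x - f n))\<^sup>2 - 4 * d\<^sup>2" for m n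
  proof -
    have "(1/2) *\<^sub>R (f m + f n) \<in> S"
      by (intro subspace_scaleR subspace_add S f)
    then have "d \<le> norm (x - (1/2) *\<^sub>R (f m + f n))" by (rule dle)
    also have "x - (1/2) *\<^sub>R (f m + f n) = (1/2) *\<^sub>R ((x - f m) + (x - f n))"
      by (simp add: algebra_simps scaleR_2[symmetric])
    finally have "2 * d \<le> norm ((x - f m) + (x - f n))" by simp
    then have "(2 * d)\<^sup>2 \<le> (norm ((x - f m) + (x - f n)))\<^sup>2" using d0 by (intro power_mono) auto
    moreover have "norm ((x - f m) - (x - f n)) = norm (f m - f n)" by (simp add: norm_minus_commute)
    ultimately show ?thesis using parallelogram[of "x - f m" "x - f n"]
      by (simp add: power_mult_distrib)
  qed
  have "Cauchy f"
  proof (rule CauchyI)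
    fix e :: real assume e: "e > 0"
    have "(\<lambda>n. (norm (x - f n))\<^sup>2) \<longlonglongrightarrow> d\<^sup>2" by (intro tendsto_power lim)
    then have "\<forall>\<^sub>F n in sequentially. (norm (x - f n))\<^sup>2 < d\<^sup>2 + e\<^sup>2 / 4"
      using e by (intro order_tendstoD) auto
    then obtain N where N: "\<And>n. n \<ge> N \<Longrightarrow> (norm (x - f n))\<^sup>2 < d\<^sup>2 + e\<^sup>2 / 4"
      unfolding eventually_sequentially by blast
    have "norm (f m - f n) < e" if "m \<ge> N" "n \<ge> N" for m n
    proof -
      have "(norm (f m - f n))\<^sup>2 < e\<^sup>2" using key[of m n] N[OF that(1)] N[OF that(2)] by linarith
      then show ?thesis using e by (simp add: power2_less_imp_less)
    qed
    then show "\<exists>M. \<forall>m\<ge>M. \<forall>n\<ge>M. norm (f m - f n) < e" by blast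
  qed
  then obtain y where y: "f \<longlonglongrightarrow> y" using Cauchy_convergent convergent_def by blast
  have yS: "y \<in> S" using S(2) f(1) y closed_sequentially by blast
  have yd: "norm (x - y) = d"
    using LIMSEQ_unique[OF lim tendsto_norm[OF tendsto_diff[OF tendsto_const y]]] by simp
  have "ip (x - y) z = 0" if z: "z \<in> S" for z
  proof (cases "z = 0")
    case False
    \<comment> \<open>If \<open>c\<close> were nonzero, moving \<open>y\<close> by
      \<open>smul c z\<close> inside \<open>S\<close> would shorten the error by Pythagoras, against
      minimality of \<open>d\<close>.\<close>
    define c where "c = ip (x - y) z / of_real ((norm z)\<^sup>2)"
    have nz: "(norm z)\<^sup>2 \<noteq> 0" using False by simp
    have o: "ip (x - y - smul c z) (smul c z) = 0"
      using nz by (simp add: ip_smul_right ip_diff_left ip_smul_left ip_self c_def)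
    have "y + smul c z \<in> S" by (intro subspace_add subspace_scale S yS z)
    then have "d \<le> norm (x - (y + smul c z))" by (rule dle)
    then have "d\<^sup>2 \<le> (norm (x - y - smul c z))\<^sup>2" using d0 by (intro power_mono) (auto simp: diff_diff_eq)
    with pythagoras[OF o] yd have "(norm (smul c z))\<^sup>2 \<le> 0" by simp
    then have "c = 0" using False by (simp add: norm_smul)
    then show ?thesis using nz by (simp add: c_def)
  qed simp
  with yS show ?thesis by blast
qed

end

text \<open>The norm of a product type is the Euclidean one, so the sum of the two inner products
  induces it. The graph of an operator thereby lies in a Hilbert space where
  \<open>projection_exists\<close> applies.\<close>

lemma hilbert_space_prod:
  assumes "hilbert_space smul ip"
  shows "hilbert_space (\<lambda>c (x, y). (smul c x, smul c y)) (\<lambda>(x, y) (x', y'). ip x x' + ip y y')"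
proof -
  interpret hilbert_space smul ip by fact
  show ?thesis
  proof (standard, goal_cases)
    case (8 x y)
    show ?case by (simp add: split_beta kconj_add ip_commute[of "fst y"] ip_commute[of "snd y"])
  next
    case (9 x)
    show ?case by (simp add: split_beta ip_self norm_prod_def del: of_real_power flip: of_real_add)
  qed (auto simp: scale_right_distrib scale_left_distrib smul_of_real ip_add_left ip_smul_left algebra_simps)
qed

section \<open>The resolvent pair of a self-adjoint operator\<close>

text \<open>The value of \<open>adjoint_op\<close> is a definite description; density of
  \<open>D\<close> leaves a single candidate, so the adjoint relation holds with \<open>A y\<close>
  itself.\<close>

lemma self_adjoint_symmetric:
  assumes "hilbert_space smul ip" "densely_defined D" "self_adjoint ip D A" "x \<in> D" "y \<in> D"
  shows "ip (A x) y = ip x (A y)"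
proof -
  interpret hilbert_space smul ip by fact
  have "y \<in> adjoint_dom ip D A" using assms by (simp add: self_adjoint_def)
  then obtain z where z: "\<forall>x\<in>D. ip (A x) y = ip x z" by (auto simp: adjoint_dom_def)
  have "adjoint_op ip D A y = z" unfolding adjoint_op_def
  proof (rule the_equality)
    show "\<forall>x\<in>D. ip (A x) y = ip x z" by (rule z)
  next
    fix z' assume z': "\<forall>x\<in>D. ip (A x) y = ip x z'"
    have "D \<subseteq> {x. ip x (z' - z) = 0}" using z z' by (auto simp: ip_diff_right)
    then have "closure D \<subseteq> {x. ip x (z' - z) = 0}"
      by (rule closure_minimal[OF _ closed_subspace_orth(1)])
    then show "z' = z" using assms(2) ip_eq_zero_iff[of "z' - z"] by (auto simp: densely_defined_def)
  qed
  with assms z show ?thesis by (simp add: self_adjoint_def)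
qed

text \<open>Testing against \<open>D\<close> suffices to put \<open>y\<close> into the domain.
  Closedness of the graph and membership of \<open>A x\<close> in \<open>D\<close> are both obtained
  this way.\<close>

lemma self_adjoint_maximal:
  assumes "hilbert_space smul ip" "densely_defined D" "self_adjoint ip D A" "\<And>x. x \<in> D \<Longrightarrow> ip (A x) y = ip x z"
  shows "y \<in> D \<and> A y = z"
proof -
  interpret hilbert_space smul ip by fact
  have "y \<in> adjoint_dom ip D A" using assms(4) by (auto simp: adjoint_dom_def)
  then have y: "y \<in> D" using assms(3) by (simp add: self_adjoint_def)
  have "D \<subseteq> {x. ip x (A y - z) = 0}"
    using assms(4) self_adjoint_symmetric[OF assms(1-3) _ y] by (auto simp: ip_diff_right)
  then have "closure D \<subseteq> {x. ip x (A y - z) = 0}"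
    by (rule closure_minimal[OF _ closed_subspace_orth(1)])
  then show ?thesis using assms(2) y ip_eq_zero_iff[of "A y - z"] by (auto simp: densely_defined_def)
qed

text \<open>Von Neumann: the graph of \<open>A\<close> in \<open>H \<times> H\<close> is closed and its orthogonal complement consists of
  the pairs \<open>(A y, - y)\<close>; projecting \<open>(u, 0)\<close> to the graph solves \<open>x + A\<^sup>2 x = u\<close>.\<close>
lemma self_adjoint_square_plus_one_surj:
  assumes H: "hilbert_space smul ip" and lin: "linear_operator smul D A"
    and D: "densely_defined D" and sa: "self_adjoint ip D A"
  shows "\<exists>x\<in>D. A x \<in> D \<and> x + A (A x) = u"
proof -
  interpret hilbert_space smul ip by fact
  interpret HH: hilbert_space "\<lambda>c (x, y). (smul c x, smul c y)" "\<lambda>(x, y) (x', y'). ip x x' + ip y y'"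
    by (rule hilbert_space_prod[OF H])
  note sym = self_adjoint_symmetric[OF H D sa]
  note max = self_adjoint_maximal[OF H D sa]
  have subD: "subspace D" using lin by (simp add: linear_operator_def)
  have A_add: "A (x + y) = A x + A y" and A_smul: "A (smul c x) = smul c (A x)"
    if "x \<in> D" "y \<in> D" for x y c
    using lin that by (auto simp: linear_operator_def)
  define G where "G = (\<lambda>x. (x, A x)) ` D"
  have "HH.subspace G"
  proof (rule HH.subspaceI)
    have "A 0 = 0" using A_smul[of 0 0 0] subspace_0[OF subD] by simp
    then show "0 \<in> G" using subspace_0[OF subD] by (force simp: G_def zero_prod_def)
  next
    fix p q assume "p \<in> G" "q \<in> G"
    then obtain x y where "x \<in> D" "y \<in> D" "p = (x, A x)" "q = (y, A y)" by (auto simp: G_def)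
    then have "x + y \<in> D" "p + q = (x + y, A (x + y))" by (simp_all add: A_add subspace_add[OF subD])
    then show "p + q \<in> G" by (auto simp: G_def)
  next
    fix c p assume "p \<in> G"
    then show "(case p of (x, y) \<Rightarrow> (smul c x, smul c y)) \<in> G"
      by (auto simp: G_def A_smul[symmetric] intro!: imageI subspace_scale[OF subD])
  qed
  moreover have "closed G"
    unfolding closed_sequential_limits
  proof (intro allI impI, elim conjE)
    fix g l assume g: "\<forall>n. g n \<in> G" "g \<longlonglongrightarrow> l"
    define f where "f n = fst (g n)" for n
    have f: "f n \<in> D" "snd (g n) = A (f n)" for n
      using spec[OF g(1), of n] by (auto simp: G_def f_def)
    have l: "f \<longlonglongrightarrow> fst l" "(\<lambda>n. A (f n)) \<longlonglongrightarrow> snd l"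
      using tendsto_fst[OF g(2)] tendsto_snd[OF g(2)] unfolding f_def[symmetric] f(2) by auto
    have "fst l \<in> D \<and> A (fst l) = snd l"
    proof (rule max)
      fix x assume x: "x \<in> D"
      have "(\<lambda>n. ip (A x) (f n)) \<longlonglongrightarrow> ip (A x) (fst l)" by (intro tendsto_ip_right l)
      moreover have "(\<lambda>n. ip x (A (f n))) \<longlonglongrightarrow> ip x (snd l)" by (intro tendsto_ip_right l)
      ultimately show "ip (A x) (fst l) = ip x (snd l)"
        using sym[OF x f(1)] LIMSEQ_unique by simp
    qed
    then show "l \<in> G" by (force simp: G_def)
  qed
  ultimately obtain p where p: "p \<in> G" "\<And>q. q \<in> G \<Longrightarrow> (case (u, 0) - p of (x, y) \<Rightarrow> \<lambda>(x', y'). ip x x' + ip y y') q = 0"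
    using HH.projection_exists[of G "(u, 0)"] by blast
  then obtain x where x: "x \<in> D" "p = (x, A x)" by (auto simp: G_def)
  \<comment> \<open>Orthogonality of \<open>(u - x, - A x)\<close> to the graph is the adjoint
    relation for \<open>A x\<close>, with value \<open>u - x\<close>.\<close>
  have "ip (A z) (A x) = ip z (u - x)" if z: "z \<in> D" for z
  proof -
    have "ip (u - x) z + ip (- A x) (A z) = 0" using p(2)[of "(z, A z)"] z x by (auto simp: G_def)
    then have "ip (u - x) z = ip (A x) (A z)" by (simp add: ip_minus_left)
    then show ?thesis by (metis ip_commute)
  qed
  then have "A x \<in> D \<and> A (A x) = u - x" by (rule max)
  with x show ?thesis by auto
qed

text \<open>The bounded operators \<open>B = (1 + A\<^sup>2)\<^sup>-\<^sup>1\<close> and \<open>C = A (1 + A\<^sup>2)\<^sup>-\<^sup>1\<close> of a self-adjoint \<open>A\<close>, axiomatised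
  without mentioning \<open>A\<close>.\<close>
locale resolvent_pair = hilbert_space smul ip
  for smul :: "'k::real_or_complex \<Rightarrow> 'h::banach \<Rightarrow> 'h" and ip :: "'h \<Rightarrow> 'h \<Rightarrow> 'k" +
  fixes B C :: "'h \<Rightarrow> 'h"
  assumes B_sym: "ip (B x) y = ip x (B y)" and C_sym: "ip (C x) y = ip x (C y)"
    and BC_commute: "C (B x) = B (C x)"
    and C_square: "C (C x) = B x - B (B x)"
    and B_eq_zero: "B x = 0 \<Longrightarrow> x = 0"
begin

text \<open>Both sides have the same inner product with every vector, once \<open>F\<close> is moved
  to the other argument. This supplies the linearity of \<open>B\<close> and
  \<open>C\<close>.\<close>

lemma symmetric_imp_linear:
  assumes "\<And>x y. ip (F x) y = ip x (F y)"
  shows "F (x + y) = F x + F y" "F (smul c x) = smul c (F x)"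
  by (rule ip_ext, simp add: assms ip_add_left ip_smul_left)+

lemmas B_add = symmetric_imp_linear(1)[OF B_sym] and C_add = symmetric_imp_linear(1)[OF C_sym]
lemmas B_smul = symmetric_imp_linear(2)[OF B_sym] and C_smul = symmetric_imp_linear(2)[OF C_sym]

text \<open>Contractivity comes from \<open>(norm (B x))^2 + (norm (C x))^2 = ip (B x) x\<close>,
  which is \<open>C_square\<close> paired with \<open>x\<close>.\<close>

lemma norm_BC_le: "norm (B x) \<le> norm x" "norm (C x) \<le> norm x"
proof -
  have "ip (B x) (B x) + ip (C x) (C x) = ip (B x) x"
    by (simp add: B_sym C_sym C_square ip_diff_right)
  then have "(of_real ((norm (B x))\<^sup>2 + (norm (C x))\<^sup>2) :: 'k) = ip (B x) x" by (simp add: ip_self)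
  from arg_cong[OF this, of norm] have le: "(norm (B x))\<^sup>2 + (norm (C x))\<^sup>2 \<le> norm (B x) * norm x"
    using cauchy_schwarz[of "B x" x] unfolding norm_of_real by simp
  then have "norm (B x) * norm (B x) \<le> norm (B x) * norm x"
    by (metis add.commute add_le_cancel_left le_add_same_cancel2 order_trans power2_eq_square zero_le_power2)
  then show B: "norm (B x) \<le> norm x" by (cases "norm (B x) = 0") auto
  have "(norm (C x))\<^sup>2 \<le> norm (B x) * norm x" using le by (smt (verit) zero_le_power2)
  also have "\<dots> \<le> (norm x)\<^sup>2" using B by (simp add: power2_eq_square mult_right_mono)
  finally show "norm (C x) \<le> norm x" by (simp add: power2_le_iff_abs_le)
qed

lemma bounded_linear_B: "bounded_linear B"
  by (rule bounded_linear_intro[where K = 1])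
     (use norm_BC_le in \<open>auto simp: B_add simp flip: smul_of_real B_smul\<close>)

lemma bounded_linear_C: "bounded_linear C"
  by (rule bounded_linear_intro[where K = 1])
     (use norm_BC_le in \<open>auto simp: C_add simp flip: smul_of_real C_smul\<close>)

end

theorem self_adjoint_resolvent_pair:
  fixes smul :: "'k::real_or_complex \<Rightarrow> 'h::banach \<Rightarrow> 'h"
  assumes H: "hilbert_space smul ip" and lin: "linear_operator smul D A"
    and D: "densely_defined D" and sa: "self_adjoint ip D A"
  shows "\<exists>B C. resolvent_pair smul ip B C \<and> (\<forall>x y. x \<in> D \<and> A x = y \<longleftrightarrow> B y = C x)"
proof -
  interpret hilbert_space smul ip by fact
  note sym = self_adjoint_symmetric[OF H D sa]
  have subD: "subspace D" using lin by (simp add: linear_operator_def)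
  have A_add: "A (x + y) = A x + A y" and A_smul: "A (smul c x) = smul c (A x)"
    if "x \<in> D" "y \<in> D" for x y c
    using lin that by (auto simp: linear_operator_def)
  have A_diff: "x - y \<in> D" "A (x - y) = A x - A y" if "x \<in> D" "y \<in> D" for x y
  proof -
    show xy: "x - y \<in> D" using that by (rule subspace_diff[OF subD])
    show "A (x - y) = A x - A y" using A_add[OF xy that(2)] by simp
  qed
  obtain B where B: "\<And>u. B u \<in> D" "\<And>u. A (B u) \<in> D" "\<And>u. B u + A (A (B u)) = u"
    using self_adjoint_square_plus_one_surj[OF assms] by metis
  define C where "C u = A (B u)" for u
  have uniq: "B u = x" if x: "x \<in> D" "A x \<in> D" "x + A (A x) = u" for x u
  proof -
    define z where "z = B u - x"
    have "A (A z) = A (A (B u)) - A (A x)" by (simp add: z_def A_diff x B)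
    then have "z + A (A z) = (B u + A (A (B u))) - (x + A (A x))" by (simp add: z_def)
    then have z: "z \<in> D" "A z \<in> D" "z + A (A z) = 0"
      by (simp_all add: z_def A_diff x B)
    \<comment> \<open>Pairing the homogeneous equation with \<open>z\<close> makes both squared
      norms vanish.\<close>
    have "ip z z + ip (A z) (A z) = ip (z + A (A z)) z"
      using sym[of "A z" z] z(1,2) by (simp add: ip_add_left)
    also have "\<dots> = 0" by (simp add: z(3))
    finally have "(of_real ((norm z)\<^sup>2 + (norm (A z))\<^sup>2) :: 'k) = 0"
      by (simp add: ip_self)
    then have "z = 0" by (simp only: of_real_eq_0_iff sum_power2_eq_zero_iff norm_eq_zero)
    then show ?thesis by (simp add: z_def)
  qed
  have AA: "A (A (B u)) = u - B u" for u using B(3)[of u] by (simp add: algebra_simps)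
  \<comment> \<open>\<open>A (B x)\<close> solves the equation with right-hand side
    \<open>A x\<close>, so uniqueness yields commutation of \<open>A\<close> and \<open>B\<close> on
    the domain.\<close>
  have BA: "B (A x) = A (B x)" if x: "x \<in> D" for x
  proof (rule uniq)
    show "A (A (B x)) \<in> D" by (simp add: AA A_diff x B)
    have "A (A (A (B x))) = A x - A (B x)" by (simp add: AA A_diff x B)
    then show "A (B x) + A (A (A (B x))) = A x" by simp
  qed (rule B)
  have CB: "C (B u) = B (C u)" for u by (simp add: C_def BA B)
  have "resolvent_pair smul ip B C"
  proof
    fix u v
    \<comment> \<open>Both \<open>u\<close> and \<open>v\<close> are written as
      \<open>B + A A B\<close> of themselves; after moving one \<open>A\<close> across, the two
      sides are the same sum.\<close>
    have "ip (B u) (B v + A (A (B v))) = ip (B u + A (A (B u))) (B v)"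
      by (simp add: ip_add_left ip_add_right sym B(1,2))
    then show "ip (B u) v = ip u (B v)" unfolding B(3) .
    have "ip (C u) (B v + A (A (B v))) = ip (B u + A (A (B u))) (C v)"
      by (simp add: ip_add_left ip_add_right sym B(1,2) C_def)
    then show "ip (C u) v = ip u (C v)" unfolding B(3) .
    show "C (B u) = B (C u)" by (rule CB)
    have "C (C u) = A (A (B (B u)))" by (simp add: C_def BA B)
    also have "\<dots> = B u - B (B u)" by (rule AA)
    finally show "C (C u) = B u - B (B u)" .
    show "u = 0" if "B u = 0"
    proof -
      have "A 0 = 0" using A_smul[of 0 0 0] subspace_0[OF subD] by simp
      then show ?thesis using B(3)[of u] that by simp
    qed
  qed
  moreover have "x \<in> D \<and> A x = y \<longleftrightarrow> B y = C x" for x y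
  proof
    \<comment> \<open>From \<open>C y = A (B y) = A (C x) = x - B x\<close> one reads off
      \<open>x = B x + C y\<close>, a sum of two elements of the domain on which \<open>A\<close> is
      known.\<close>
    assume "B y = C x"
    then have "C y = x - B x" by (metis AA C_def)
    then have x: "x = B x + C y" by simp
    have 1: "C y \<in> D" "A (C y) = y - B y" by (simp_all add: C_def B AA)
    then have "x \<in> D" by (subst x, intro subspace_add subD B)
    moreover have "A (B x + C y) = C x + (y - B y)"
      using 1 B(1)[of x] by (simp add: A_add C_def[symmetric])
    ultimately show "x \<in> D \<and> A x = y" using \<open>B y = C x\<close> x[symmetric] by simp
  qed (auto simp: BA C_def)
  ultimately show ?thesis by blast
qed

section \<open>Fejer means\<close>

text \<open>The real part, expressed through the norm so that one definition serves both scalar fields.\<close>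
definition kre :: "'k::real_or_complex \<Rightarrow> real" where
  "kre z = ((norm (z + 1))\<^sup>2 - (norm z)\<^sup>2 - 1) / 2"

lemma kconj_one [simp]: "kconj (1 :: 'k::real_or_complex) = 1"
  using kconj_of_real[of 1] by simp

lemma of_real_kre: "of_real (kre z) = (z + kconj z) / (2 :: 'k::real_or_complex)"
proof -
  have "of_real (2 * kre z) = (z + 1) * kconj (z + 1) - z * kconj z - (1 :: 'k)"
    unfolding mult_kconj kre_def by simp
  also have "\<dots> = z + kconj z" unfolding kconj_add by (simp add: algebra_simps)
  finally show ?thesis by (simp add: field_simps)
qed

lemma of_real_eqI: "of_real x = (of_real y :: 'k::real_or_complex) \<Longrightarrow> x = y"
  by simp

lemma kre_add: "kre (x + y :: 'k::real_or_complex) = kre x + kre y"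
  by (rule of_real_eqI[where 'k = 'k]) (simp add: of_real_kre kconj_add add_divide_distrib algebra_simps)

lemma kre_of_real [simp]: "kre (of_real r :: 'k::real_or_complex) = r"
  by (rule of_real_eqI[where 'k = 'k]) (simp add: of_real_kre)

lemma kre_of_real_mult: "kre (of_real r * z :: 'k::real_or_complex) = r * kre z"
  by (rule of_real_eqI[where 'k = 'k]) (simp add: of_real_kre kconj_mult algebra_simps)

lemma kre_kconj [simp]: "kre (kconj z :: 'k::real_or_complex) = kre z"
  by (rule of_real_eqI[where 'k = 'k]) (simp add: of_real_kre add.commute)

lemma of_real_kre_self_conj: "kconj z = z \<Longrightarrow> of_real (kre z) = (z :: 'k::real_or_complex)"
  by (simp add: of_real_kre)

context hilbert_space begin

text \<open>The real inner product underlying \<open>ip\<close>. The Fejer argument has real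
  coefficients only, so it runs here for both scalar fields.\<close>

definition rip :: "'h \<Rightarrow> 'h \<Rightarrow> real" where "rip x y = kre (ip x y)"

lemma rip_add: "rip (x + y) z = rip x z + rip y z" "rip z (x + y) = rip z x + rip z y"
  by (simp_all add: rip_def ip_add_left ip_add_right kre_add)

lemma rip_scaleR: "rip (r *\<^sub>R x) y = r * rip x y" "rip x (r *\<^sub>R y) = r * rip x y"
  by (simp_all add: rip_def ip_scaleR_left ip_scaleR_right kre_of_real_mult)

lemma rip_diff: "rip (x - y) z = rip x z - rip y z" "rip z (x - y) = rip z x - rip z y"
  using rip_add(1)[of "x - y" y z] rip_add(2)[of z "x - y" y] by simp_all

lemma rip_commute: "rip x y = rip y x"
  unfolding rip_def by (metis ip_commute kre_kconj)

lemma rip_self: "rip x x = (norm x)\<^sup>2"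
  by (simp add: rip_def ip_self del: of_real_power)

lemma rip_zero [simp]: "rip 0 x = 0" "rip x 0 = 0"
  using rip_diff[of x x x] by simp_all

lemma rip_sum: "rip (\<Sum>i\<in>I. f i) y = (\<Sum>i\<in>I. rip (f i) y)" "rip y (\<Sum>i\<in>I. f i) = (\<Sum>i\<in>I. rip y (f i))"
  by (induction I rule: infinite_finite_induct) (simp_all add: rip_add)

end

section \<open>The unitary \<open>P + iQ\<close>, its powers and their Gram matrix\<close>

context resolvent_pair begin

definition P :: "'h \<Rightarrow> 'h" where "P x = x - 2 *\<^sub>R B x"
definition Q :: "'h \<Rightarrow> 'h" where "Q x = 2 *\<^sub>R C x"

lemma BC_scaleR: "B (r *\<^sub>R x) = r *\<^sub>R B x" "C (r *\<^sub>R x) = r *\<^sub>R C x"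
  by (simp_all add: smul_of_real[symmetric] B_smul C_smul)

lemma BC_diff: "B (x - y) = B x - B y" "C (x - y) = C x - C y"
  using B_add[of "x - y" y] C_add[of "x - y" y] by simp_all

lemma PQ_add: "P (x + y) = P x + P y" "Q (x + y) = Q x + Q y"
  by (simp_all add: P_def Q_def B_add C_add algebra_simps)

lemma PQ_diff: "P (x - y) = P x - P y" "Q (x - y) = Q x - Q y"
  by (simp_all add: P_def Q_def BC_diff algebra_simps)

lemma PQ_commute: "Q (P x) = P (Q x)"
  by (simp add: P_def Q_def BC_diff BC_scaleR BC_commute algebra_simps)

text \<open>This is \<open>P^2 + Q^2 = 1\<close>, the operator form of
  \<open>cos^2 + sin^2 = 1\<close>; it unwinds to \<open>C^2 = B - B^2\<close>.\<close>

lemma PP: "P (P x) = x - Q (Q x)"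
  by (simp add: P_def Q_def BC_diff BC_scaleR C_square algebra_simps) (simp flip: scaleR_left_distrib)

lemma PQ_sym: "ip (P x) y = ip x (P y)" "ip (Q x) y = ip x (Q y)"
  by (simp_all add: P_def Q_def ip_diff_left ip_diff_right ip_scaleR_left ip_scaleR_right B_sym C_sym)

lemma PQ_rip: "rip (P x) y = rip x (P y)" "rip (Q x) y = rip x (Q y)"
  by (simp_all add: rip_def PQ_sym)

text \<open>\<open>P + iQ\<close> is unitary on the complexification of \<open>H\<close>, and \<open>T k + i S k\<close> is its \<open>k\<close>-th power.\<close>
fun T S :: "nat \<Rightarrow> 'h \<Rightarrow> 'h" where
  "T 0 x = x"
| "S 0 x = 0"
| "T (Suc k) x = P (T k x) - Q (S k x)"
| "S (Suc k) x = Q (T k x) + P (S k x)"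

lemma TS_commute_PQ:
  "T k (P x) = P (T k x) \<and> T k (Q x) = Q (T k x) \<and> S k (P x) = P (S k x) \<and> S k (Q x) = Q (S k x)"
proof (induction k)
  case 0
  have "P 0 = 0" "Q 0 = 0" using PQ_diff[of 0 0] by simp_all
  then show ?case by simp
qed (simp add: PQ_diff PQ_add PQ_commute)

lemma TS_sym: "ip (T k x) y = ip x (T k y) \<and> ip (S k x) y = ip x (S k y)"
  by (induction k arbitrary: x y)
     (simp_all add: ip_diff_left ip_diff_right ip_add_left ip_add_right PQ_sym TS_commute_PQ)

definition \<tau> :: "'h \<Rightarrow> nat \<Rightarrow> real" where "\<tau> x k = rip (T k x) x"
definition \<sigma> :: "'h \<Rightarrow> nat \<Rightarrow> real" where "\<sigma> x k = rip (S k x) x"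

lemma of_real_\<tau>: "of_real (\<tau> x k) = ip (T k x) x"
  unfolding \<tau>_def rip_def by (rule of_real_kre_self_conj) (metis ip_commute TS_sym)

lemma of_real_\<sigma>: "of_real (\<sigma> x k) = ip (S k x) x"
  unfolding \<sigma>_def rip_def by (rule of_real_kre_self_conj) (metis ip_commute TS_sym)

text \<open>The pair \<open>(P u - Q v, Q u + P v)\<close> is \<open>P + iQ\<close> applied to
  \<open>u + iv\<close>; the two equations are real and imaginary part of the invariance of the
  complexified inner product.\<close>

lemma rotation_isometry:
  "rip (P u - Q v) (P u' - Q v') + rip (Q u + P v) (Q u' + P v') = rip u u' + rip v v'"
  "rip (Q u + P v) (P u' - Q v') - rip (P u - Q v) (Q u' + P v') = rip v u' - rip u v'"
  by (simp_all add: rip_add rip_diff PQ_rip PQ_diff PQ_add PP PQ_commute)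

text \<open>Cancelling \<open>l\<close> common factors of the unitary leaves only the difference of
  the exponents: the Gram matrix of the powers is Toeplitz.\<close>

lemma gram_TS:
  "rip (T (l + m) x) (T l x) + rip (S (l + m) x) (S l x) = \<tau> x m"
  "rip (S (l + m) x) (T l x) - rip (T (l + m) x) (S l x) = \<sigma> x m"
  by (induction l) (simp_all add: rotation_isometry \<tau>_def \<sigma>_def)

text \<open>The real part, with \<open>gram_sin\<close> as imaginary part, of the inner product of
  the \<open>k\<close>-th and \<open>l\<close>-th power of \<open>P + iQ\<close> at
  \<open>x\<close>, taken in the complexification of \<open>H\<close>.\<close>

definition gram_cos :: "'h \<Rightarrow> nat \<Rightarrow> nat \<Rightarrow> real" where
  "gram_cos x k l = rip (T k x) (T l x) + rip (S k x) (S l x)"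

definition gram_sin :: "'h \<Rightarrow> nat \<Rightarrow> nat \<Rightarrow> real" where
  "gram_sin x k l = rip (S k x) (T l x) - rip (T k x) (S l x)"

lemma gram_cos_eq: "gram_cos x k l = \<tau> x (nat \<bar>int k - int l\<bar>)"
proof (cases "l \<le> k")
  case True
  then show ?thesis using gram_TS(1)[of l "k - l" x] by (simp add: gram_cos_def nat_diff_distrib')
next
  case False
  then have "nat \<bar>int k - int l\<bar> = l - k" by linarith
  then show ?thesis using False gram_TS(1)[of k "l - k" x] by (simp add: gram_cos_def rip_commute)
qed

lemma gram_sin_eq: "gram_sin x k l = (if l \<le> k then \<sigma> x (nat \<bar>int k - int l\<bar>) else - \<sigma> x (nat \<bar>int k - int l\<bar>))"
proof (cases "l \<le> k")
  case True
  then show ?thesis using gram_TS(2)[of l "k - l" x] by (simp add: gram_sin_def nat_diff_distrib')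
next
  case False
  then have "nat \<bar>int k - int l\<bar> = l - k" by linarith
  then show ?thesis using False gram_TS(2)[of k "l - k" x] by (simp add: gram_sin_def rip_commute)
qed

definition fejer :: "'h \<Rightarrow> nat \<Rightarrow> real \<Rightarrow> real" where
  "fejer x n \<theta> = (\<Sum>k<n. \<Sum>l<n. cos (of_int (int k - int l) * \<theta>) * gram_cos x k l
                              + sin (of_int (int k - int l) * \<theta>) * gram_sin x k l)"

text \<open>Over the complex numbers this is \<open>fejer x n \<theta> = norm (\<Sum>k<n. e\<^sup>-\<^sup>i\<^sup>k\<^sup>\<theta> U\<^sup>k x)\<^sup>2\<close>.\<close>
lemma fejer_nonneg: "0 \<le> fejer x n \<theta>"
proof -
  \<comment> \<open>\<open>v k + i w k\<close> is \<open>exp (- i k \<theta>)\<close> times the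
    \<open>k\<close>-th power of \<open>P + iQ\<close> at \<open>x\<close>.\<close>
  define v where "v k = cos (real k * \<theta>) *\<^sub>R T k x + sin (real k * \<theta>) *\<^sub>R S k x" for k
  define w where "w k = cos (real k * \<theta>) *\<^sub>R S k x - sin (real k * \<theta>) *\<^sub>R T k x" for k
  have "fejer x n \<theta> = (\<Sum>k<n. \<Sum>l<n. rip (v k) (v l) + rip (w k) (w l))"
    unfolding fejer_def
  proof (intro sum.cong refl)
    fix k l
    have "of_int (int k - int l) * \<theta> = real k * \<theta> - real l * \<theta>" by (simp add: algebra_simps)
    then show "cos (of_int (int k - int l) * \<theta>) * gram_cos x k l + sin (of_int (int k - int l) * \<theta>) * gram_sin x k l
        = rip (v k) (v l) + rip (w k) (w l)"
      by (simp only: cos_diff sin_diff) (simp add: gram_cos_def gram_sin_def v_def w_def rip_add rip_diff rip_scaleR algebra_simps)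
  qed
  also have "\<dots> = rip (\<Sum>k<n. v k) (\<Sum>k<n. v k) + rip (\<Sum>k<n. w k) (\<Sum>k<n. w k)"
    by (simp add: rip_sum sum.distrib sum.swap[of "\<lambda>k l. rip (v k) (v l)"] sum.swap[of "\<lambda>k l. rip (w k) (w l)"])
  finally show ?thesis by (simp add: rip_self)
qed

end

text \<open>Normalised Lebesgue measure of the circle, kept on the real line so that Helly selection
  for real distributions applies to its densities.\<close>

definition circle_measure :: "real measure" where
  "circle_measure = density lborel (\<lambda>x. indicator {0..2 * pi} x / (2 * pi))"

lemma sets_circle_measure [simp, measurable_cong]: "sets circle_measure = sets borel"
  by (simp add: circle_measure_def)

lemma space_circle_measure [simp]: "space circle_measure = UNIV"
  by (simp add: circle_measure_def)

lemma integral_circle_measure: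
  fixes f F :: "real \<Rightarrow> real"
  assumes "\<And>x. (F has_real_derivative f x) (at x)" "continuous_on UNIV f"
  shows "integral\<^sup>L circle_measure f = (F (2 * pi) - F 0) / (2 * pi)"
proof -
  have [measurable]: "f \<in> borel_measurable borel" using assms(2) by (rule borel_measurable_continuous_onI)
  have "integral\<^sup>L circle_measure f = (\<integral>x. (indicator {0..2 * pi} x *\<^sub>R f x) / (2 * pi) \<partial>lborel)"
    unfolding circle_measure_def by (subst integral_density) auto
  also have "\<dots> = (\<integral>x. indicator {0..2 * pi} x *\<^sub>R f x \<partial>lborel) / (2 * pi)" by simp
  also have "(\<integral>x. indicator {0..2 * pi} x *\<^sub>R f x \<partial>lborel) = F (2 * pi) - F 0"
    using assms by (intro integral_FTC_atLeastAtMost)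
      (auto intro: has_field_derivative_at_within continuous_on_subset simp flip: has_real_derivative_iff_has_vector_derivative)
  finally show ?thesis .
qed

lemma prob_space_circle_measure: "prob_space circle_measure"
proof
  have "emeasure circle_measure (space circle_measure) = (\<integral>\<^sup>+x. ennreal (1 / (2 * pi)) * indicator {0..2 * pi} x \<partial>lborel)"
    unfolding circle_measure_def by (subst emeasure_density) (auto intro!: nn_integral_cong split: split_indicator)
  also have "\<dots> = 1" by (simp add: nn_integral_cmult_indicator ennreal_mult[symmetric])
  finally show "emeasure circle_measure (space circle_measure) = 1" .
qed

lemma circle_cos: "(\<integral>x. cos (of_int m * x) \<partial>circle_measure) = of_bool (m = 0)"
proof (cases "m = 0")
  case True
  interpret prob_space circle_measure by (rule prob_space_circle_measure)
  show ?thesis using True prob_space by simp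
next
  case False
  have "(\<integral>x. cos (of_int m * x) \<partial>circle_measure) = (sin (of_int m * (2 * pi)) / of_int m - sin (of_int m * 0) / of_int m) / (2 * pi)"
    by (rule integral_circle_measure) (auto intro!: derivative_eq_intros continuous_intros simp: False)
  then show ?thesis using False sin_int_2pin[of m] by (simp add: mult.commute)
qed

lemma circle_sin: "(\<integral>x. sin (of_int m * x) \<partial>circle_measure) = 0"
proof (cases "m = 0")
  case False
  have "(\<integral>x. sin (of_int m * x) \<partial>circle_measure) = ((- cos (of_int m * (2 * pi)) / of_int m) - (- cos (of_int m * 0) / of_int m)) / (2 * pi)"
    by (rule integral_circle_measure) (auto intro!: derivative_eq_intros continuous_intros simp: False)
  then show ?thesis using False cos_int_2pin[of m] by (simp add: mult.commute)
qed simp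

lemma integrable_circle_measure:
  fixes f :: "real \<Rightarrow> real"
  assumes "f \<in> borel_measurable borel" "\<And>x. \<bar>f x\<bar> \<le> K"
  shows "integrable circle_measure f"
proof -
  interpret prob_space circle_measure by (rule prob_space_circle_measure)
  show ?thesis using assms by (intro integrable_const_bound[of _ K]) auto
qed

lemma integrable_circle_trig:
  "integrable circle_measure (\<lambda>x. cos (a * x))" "integrable circle_measure (\<lambda>x. sin (a * x))"
  by (rule integrable_circle_measure[where K = 1]; simp)+

text \<open>Product-to-sum formulas reduce everything to \<open>circle_cos\<close> and
  \<open>circle_sin\<close>. For \<open>m = j = 0\<close> both indicators count, giving 1 for the
  cosines and 0 for the sines.\<close>

lemma circle_orthogonality:
  "(\<integral>x. cos (of_int m * x) * cos (of_int j * x) \<partial>circle_measure) = (of_bool (m = j) + of_bool (m = - j)) / 2"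
  "(\<integral>x. sin (of_int m * x) * cos (of_int j * x) \<partial>circle_measure) = 0"
  "(\<integral>x. cos (of_int m * x) * sin (of_int j * x) \<partial>circle_measure) = 0"
  "(\<integral>x. sin (of_int m * x) * sin (of_int j * x) \<partial>circle_measure) = (of_bool (m = j) - of_bool (m = - j)) / 2"
proof -
  have "cos (of_int m * x) * cos (of_int j * x) = (cos (of_int (m - j) * x) + cos (of_int (m + j) * x)) / 2"
       "sin (of_int m * x) * cos (of_int j * x) = (sin (of_int (m + j) * x) + sin (of_int (m - j) * x)) / 2"
       "cos (of_int m * x) * sin (of_int j * x) = (sin (of_int (m + j) * x) - sin (of_int (m - j) * x)) / 2"
       "sin (of_int m * x) * sin (of_int j * x) = (cos (of_int (m - j) * x) - cos (of_int (m + j) * x)) / 2" for x :: real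
    by (simp_all add: cos_add cos_diff sin_add sin_diff distrib_right left_diff_distrib)
  note eq = this
  show "(\<integral>x. cos (of_int m * x) * cos (of_int j * x) \<partial>circle_measure) = (of_bool (m = j) + of_bool (m = - j)) / 2"
    "(\<integral>x. sin (of_int m * x) * cos (of_int j * x) \<partial>circle_measure) = 0"
    "(\<integral>x. cos (of_int m * x) * sin (of_int j * x) \<partial>circle_measure) = 0"
    "(\<integral>x. sin (of_int m * x) * sin (of_int j * x) \<partial>circle_measure) = (of_bool (m = j) - of_bool (m = - j)) / 2"
    unfolding eq by (simp_all add: integrable_circle_trig circle_cos circle_sin eq_neg_iff_add_eq_0 del: of_int_add of_int_diff)
qed

text \<open>An \<open>n\<close> by \<open>n\<close> matrix has \<open>n - j\<close> entries on each
  diagonal at distance \<open>j\<close> from the main one; these are the triangular weights of the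
  Fejer means.\<close>

lemma sum_of_bool_diff_eq:
  assumes "j \<le> n"
  shows "(\<Sum>k<n. \<Sum>l<n. of_bool (int k - int l = int j)) = (of_nat (n - j) :: real)"
    "(\<Sum>k<n. \<Sum>l<n. of_bool (int k - int l = - int j)) = (of_nat (n - j) :: real)"
proof -
  have inner: "(\<Sum>k<n. of_bool (int k - int l = int j)) = (of_bool (l < n - j) :: real)" for l
  proof -
    have "(\<Sum>k<n. of_bool (int k - int l = int j)) = (\<Sum>k<n. if k = l + j then 1 else 0 :: real)"
      by (intro sum.cong) auto
    then show ?thesis by (auto simp: sum.delta)
  qed
  have "(\<Sum>l<n. of_bool (l < n - j) :: real) = of_nat (card ({..<n} \<inter> {l. l < n - j}))"
    by (simp add: sum.If_cases of_bool_def)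
  also have "{..<n} \<inter> {l. l < n - j} = {..<n - j}" by auto
  finally have count: "(\<Sum>l<n. of_bool (l < n - j) :: real) = of_nat (n - j)" by simp
  show 1: "(\<Sum>k<n. \<Sum>l<n. of_bool (int k - int l = int j)) = (of_nat (n - j) :: real)"
    by (subst sum.swap) (simp only: inner count)
  show "(\<Sum>k<n. \<Sum>l<n. of_bool (int k - int l = - int j)) = (of_nat (n - j) :: real)"
    unfolding 1[symmetric] by (subst sum.swap, intro sum.cong refl arg_cong[where f = of_bool]) auto
qed

context resolvent_pair begin

text \<open>Only the diagonals \<open>k - l = j\<close> and \<open>k - l = - j\<close> survive
  orthogonality, and each of them contributes half of the result; for \<open>j = 0\<close> they
  coincide.\<close>

lemma fejer_moments:
  assumes "j \<le> n"
  shows "(\<integral>\<theta>. fejer x n \<theta> * cos (real j * \<theta>) \<partial>circle_measure) = real (n - j) * \<tau> x j"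
    "(\<integral>\<theta>. fejer x n \<theta> * sin (real j * \<theta>) \<partial>circle_measure) = real (n - j) * \<sigma> x j"
proof -
  have bound: "\<bar>a * g * c\<bar> \<le> \<bar>g\<bar>" if "\<bar>a\<bar> \<le> 1" "\<bar>c\<bar> \<le> 1" for a g c :: real
  proof -
    have "\<bar>a\<bar> * \<bar>g\<bar> * \<bar>c\<bar> \<le> 1 * \<bar>g\<bar> * 1" using that by (intro mult_mono) auto
    then show ?thesis by (simp add: abs_mult)
  qed
  have int: "integrable circle_measure (\<lambda>\<theta>. cos (of_int m * \<theta>) * g * cos (real j * \<theta>))"
    "integrable circle_measure (\<lambda>\<theta>. sin (of_int m * \<theta>) * g * cos (real j * \<theta>))"
    "integrable circle_measure (\<lambda>\<theta>. cos (of_int m * \<theta>) * g * sin (real j * \<theta>))"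
    "integrable circle_measure (\<lambda>\<theta>. sin (of_int m * \<theta>) * g * sin (real j * \<theta>))" for m g
    by (rule integrable_circle_measure[where K = "\<bar>g\<bar>"]; simp add: bound)+
  have term_cos: "integrable circle_measure (\<lambda>\<theta>. (cos (of_int (int k - int l) * \<theta>) * gram_cos x k l + sin (of_int (int k - int l) * \<theta>) * gram_sin x k l) * cos (real j * \<theta>))"
    "(\<integral>\<theta>. (cos (of_int (int k - int l) * \<theta>) * gram_cos x k l + sin (of_int (int k - int l) * \<theta>) * gram_sin x k l) * cos (real j * \<theta>) \<partial>circle_measure)
      = (of_bool (int k - int l = int j) + of_bool (int k - int l = - int j)) / 2 * \<tau> x j" for k l
  proof -
    define m where "m = int k - int l"
    have m: "int k - int l = m" "l \<le> k \<longleftrightarrow> 0 \<le> m" by (auto simp: m_def)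
    show "integrable circle_measure (\<lambda>\<theta>. (cos (of_int (int k - int l) * \<theta>) * gram_cos x k l + sin (of_int (int k - int l) * \<theta>) * gram_sin x k l) * cos (real j * \<theta>))"
      unfolding distrib_right by (intro Bochner_Integration.integrable_add int)
    have "(\<integral>\<theta>. (cos (of_int m * \<theta>) * gram_cos x k l + sin (of_int m * \<theta>) * gram_sin x k l) * cos (real j * \<theta>) \<partial>circle_measure)
      = (\<integral>\<theta>. gram_cos x k l * (cos (of_int m * \<theta>) * cos (of_int (int j) * \<theta>)) \<partial>circle_measure)
       + (\<integral>\<theta>. gram_sin x k l * (sin (of_int m * \<theta>) * cos (of_int (int j) * \<theta>)) \<partial>circle_measure)"
      unfolding distrib_right Bochner_Integration.integral_add[OF int(1) int(2)]
      by (intro arg_cong2[where f = "(+)"] Bochner_Integration.integral_cong) (simp_all add: ac_simps)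
    also have "\<dots> = (of_bool (m = int j) + of_bool (m = - int j)) / 2 * \<tau> x j"
      unfolding integral_mult_right_zero circle_orthogonality
      by (auto simp: gram_cos_eq gram_sin_eq m \<sigma>_def)
    finally show "(\<integral>\<theta>. (cos (of_int (int k - int l) * \<theta>) * gram_cos x k l + sin (of_int (int k - int l) * \<theta>) * gram_sin x k l) * cos (real j * \<theta>) \<partial>circle_measure)
      = (of_bool (int k - int l = int j) + of_bool (int k - int l = - int j)) / 2 * \<tau> x j"
      unfolding m_def .
  qed
  have term_sin: "integrable circle_measure (\<lambda>\<theta>. (cos (of_int (int k - int l) * \<theta>) * gram_cos x k l + sin (of_int (int k - int l) * \<theta>) * gram_sin x k l) * sin (real j * \<theta>))"
    "(\<integral>\<theta>. (cos (of_int (int k - int l) * \<theta>) * gram_cos x k l + sin (of_int (int k - int l) * \<theta>) * gram_sin x k l) * sin (real j * \<theta>) \<partial>circle_measure)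
      = (of_bool (int k - int l = int j) + of_bool (int k - int l = - int j)) / 2 * \<sigma> x j" for k l
  proof -
    define m where "m = int k - int l"
    have m: "int k - int l = m" "l \<le> k \<longleftrightarrow> 0 \<le> m" by (auto simp: m_def)
    show "integrable circle_measure (\<lambda>\<theta>. (cos (of_int (int k - int l) * \<theta>) * gram_cos x k l + sin (of_int (int k - int l) * \<theta>) * gram_sin x k l) * sin (real j * \<theta>))"
      unfolding distrib_right by (intro Bochner_Integration.integrable_add int)
    have "(\<integral>\<theta>. (cos (of_int m * \<theta>) * gram_cos x k l + sin (of_int m * \<theta>) * gram_sin x k l) * sin (real j * \<theta>) \<partial>circle_measure)
      = (\<integral>\<theta>. gram_cos x k l * (cos (of_int m * \<theta>) * sin (of_int (int j) * \<theta>)) \<partial>circle_measure)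
       + (\<integral>\<theta>. gram_sin x k l * (sin (of_int m * \<theta>) * sin (of_int (int j) * \<theta>)) \<partial>circle_measure)"
      unfolding distrib_right Bochner_Integration.integral_add[OF int(3) int(4)]
      by (intro arg_cong2[where f = "(+)"] Bochner_Integration.integral_cong) (simp_all add: ac_simps)
    \<comment> \<open>For \<open>m = - int j\<close> the minus sign in \<open>gram_sin_eq\<close>
      cancels the one in the sine orthogonality; for \<open>j = 0\<close> both sides vanish, since
      \<open>\<sigma> x 0 = 0\<close>.\<close>
    also have "\<dots> = (of_bool (m = int j) + of_bool (m = - int j)) / 2 * \<sigma> x j"
      unfolding integral_mult_right_zero circle_orthogonality
      by (auto simp: gram_cos_eq gram_sin_eq m \<sigma>_def)
    finally show "(\<integral>\<theta>. (cos (of_int (int k - int l) * \<theta>) * gram_cos x k l + sin (of_int (int k - int l) * \<theta>) * gram_sin x k l) * sin (real j * \<theta>) \<partial>circle_measure)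
      = (of_bool (int k - int l = int j) + of_bool (int k - int l = - int j)) / 2 * \<sigma> x j"
      unfolding m_def .
  qed
  have "(\<integral>\<theta>. fejer x n \<theta> * cos (real j * \<theta>) \<partial>circle_measure)
     = (\<Sum>k<n. \<Sum>l<n. (of_bool (int k - int l = int j) + of_bool (int k - int l = - int j)) / 2 * \<tau> x j)"
    unfolding fejer_def sum_distrib_right
    by (simp only: Bochner_Integration.integral_sum Bochner_Integration.integrable_sum term_cos)
  also have "\<dots> = real (n - j) * \<tau> x j"
    unfolding sum_distrib_right[symmetric] sum_divide_distrib[symmetric] sum.distrib sum_of_bool_diff_eq[OF assms] by simp
  finally show "(\<integral>\<theta>. fejer x n \<theta> * cos (real j * \<theta>) \<partial>circle_measure) = real (n - j) * \<tau> x j" .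
  have "(\<integral>\<theta>. fejer x n \<theta> * sin (real j * \<theta>) \<partial>circle_measure)
     = (\<Sum>k<n. \<Sum>l<n. (of_bool (int k - int l = int j) + of_bool (int k - int l = - int j)) / 2 * \<sigma> x j)"
    unfolding fejer_def sum_distrib_right
    by (simp only: Bochner_Integration.integral_sum Bochner_Integration.integrable_sum term_sin)
  also have "\<dots> = real (n - j) * \<sigma> x j"
    unfolding sum_distrib_right[symmetric] sum_divide_distrib[symmetric] sum.distrib sum_of_bool_diff_eq[OF assms] by simp
  finally show "(\<integral>\<theta>. fejer x n \<theta> * sin (real j * \<theta>) \<partial>circle_measure) = real (n - j) * \<sigma> x j" .
qed

end

section \<open>Trigonometric moments and polynomial calculus\<close>

context resolvent_pair begin

lemma fejer_measurable [measurable]: "fejer x n \<in> borel_measurable borel"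
  unfolding fejer_def by measurable

lemma continuous_trig: "isCont (\<lambda>\<theta>. cos (real j * \<theta>)) \<theta>" "isCont (\<lambda>\<theta>. sin (real j * \<theta>)) \<theta>"
  by (intro continuous_intros)+

text \<open>The Fejer density of order \<open>n\<close> has the wanted \<open>j\<close>-th moments
  up to the factor \<open>1 - j/n\<close>, and all these measures live on one bounded interval. A
  weak limit of a subsequence therefore has the exact moments.\<close>

theorem trigonometric_moments:
  assumes x: "norm x = 1"
  shows "\<exists>\<nu>. real_distribution \<nu> \<and>
    (\<forall>j. (\<integral>\<theta>. cos (real j * \<theta>) \<partial>\<nu>) = \<tau> x j \<and> (\<integral>\<theta>. sin (real j * \<theta>) \<partial>\<nu>) = \<sigma> x j)"
proof -
  define \<mu> where "\<mu> n = density circle_measure (\<lambda>\<theta>. ennreal (fejer x (Suc n) \<theta> / real (Suc n)))" for n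
  have int: "(\<integral>\<theta>. f \<theta> \<partial>\<mu> n) = (\<integral>\<theta>. fejer x (Suc n) \<theta> * f \<theta> \<partial>circle_measure) / real (Suc n)"
    if [measurable]: "f \<in> borel_measurable borel" for f n
  proof -
    have "(\<integral>\<theta>. f \<theta> \<partial>\<mu> n) = (\<integral>\<theta>. (fejer x (Suc n) \<theta> / real (Suc n)) *\<^sub>R f \<theta> \<partial>circle_measure)"
      unfolding \<mu>_def using fejer_nonneg by (intro integral_density) auto
    then show ?thesis by (simp del: of_nat_Suc)
  qed
  have sets [simp, measurable_cong]: "sets (\<mu> n) = sets borel" and space [simp]: "space (\<mu> n) = UNIV" for n
    by (simp_all add: \<mu>_def)
  have total: "prob_space (\<mu> n)" for n
  proof
    \<comment> \<open>A non-integrable function would have Bochner integral 0, but the zeroth moment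
      is \<open>Suc n\<close>.\<close>
    have fin: "integrable circle_measure (fejer x (Suc n))"
    proof (rule ccontr)
      assume "\<not> ?thesis"
      then show False
        using fejer_moments(1)[of 0 "Suc n" x] x by (simp add: not_integrable_integral_eq \<tau>_def rip_self)
    qed
    have "emeasure (\<mu> n) (space (\<mu> n)) = (\<integral>\<^sup>+\<theta>. ennreal (fejer x (Suc n) \<theta> / real (Suc n)) \<partial>circle_measure)"
      unfolding \<mu>_def by (subst emeasure_density) auto
    also have "\<dots> = ennreal (\<integral>\<theta>. fejer x (Suc n) \<theta> / real (Suc n) \<partial>circle_measure)"
      using fin fejer_nonneg by (intro nn_integral_eq_integral) (auto simp del: of_nat_Suc)
    also have "(\<integral>\<theta>. fejer x (Suc n) \<theta> / real (Suc n) \<partial>circle_measure) = 1"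
      using fejer_moments(1)[of 0 "Suc n" x] x by (simp add: \<tau>_def rip_self del: of_nat_Suc)
    finally show "emeasure (\<mu> n) (space (\<mu> n)) = 1" by simp
  qed
  then have rd: "real_distribution (\<mu> n)" for n
    by (simp add: real_distribution_def real_distribution_axioms_def)
  \<comment> \<open>Tightness is stated with half-open intervals; the left end -1 keeps all of
    \<open>{0..2 * pi}\<close> inside.\<close>
  have "measure (\<mu> n) {- 1<..2 * pi} = 1" for n
  proof -
    interpret prob_space "\<mu> n" by (rule total)
    have "AE \<theta> in circle_measure. \<theta> \<in> {- 1<..2 * pi}"
      unfolding circle_measure_def by (subst AE_density) (auto split: split_indicator)
    then have "AE \<theta> in \<mu> n. \<theta> \<in> {- 1<..2 * pi}"
      unfolding \<mu>_def by (subst AE_density) (auto elim: eventually_mono)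
    then show ?thesis by (subst (asm) prob_eq_1[symmetric]) auto
  qed
  then have "tight \<mu>"
    unfolding tight_def using rd by (intro conjI allI impI exI[of _ "-1"] exI[of _ "2 * pi"]) (auto intro: less_trans[of _ 0])
  from tight_imp_convergent_subsubsequence[OF this strict_mono_id]
  obtain r \<nu> where r: "strict_mono r" and \<nu>: "real_distribution \<nu>" and conv: "weak_conv_m (\<mu> \<circ> r) \<nu>"
    by (auto simp: o_def)
  have weak: "(\<lambda>n. integral\<^sup>L (\<mu> (r n)) f) \<longlonglongrightarrow> integral\<^sup>L \<nu> f"
    if "\<And>x. isCont f x" "\<And>x. norm (f x) \<le> 1" for f :: "real \<Rightarrow> real"
    using weak_conv_imp_integral_bdd_continuous_conv[of "\<mu> \<circ> r" \<nu> f 1] rd \<nu> conv that by (simp add: o_def)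
  have lim: "(\<lambda>n. real (Suc (r n) - j) * c / real (Suc (r n))) \<longlonglongrightarrow> c" for j c
  proof -
    have "(\<lambda>n. c - real j * c * inverse (real (Suc n))) \<longlonglongrightarrow> c - real j * c * 0"
      by (intro tendsto_intros LIMSEQ_inverse_real_of_nat)
    then have "(\<lambda>n. c - real j * c * inverse (real (Suc (r n)))) \<longlonglongrightarrow> c"
      using LIMSEQ_subseq_LIMSEQ[OF _ r] by (simp add: o_def)
    then show ?thesis
    proof (rule Lim_transform_eventually)
      have "\<forall>\<^sub>F n in sequentially. j \<le> r n"
        using filterlim_subseq[OF r] by (simp add: filterlim_at_top)
      then show "\<forall>\<^sub>F n in sequentially. c - real j * c * inverse (real (Suc (r n))) = real (Suc (r n) - j) * c / real (Suc (r n))"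
        by eventually_elim (simp add: of_nat_diff field_simps)
    qed
  qed
  have "(\<integral>\<theta>. cos (real j * \<theta>) \<partial>\<nu>) = \<tau> x j \<and> (\<integral>\<theta>. sin (real j * \<theta>) \<partial>\<nu>) = \<sigma> x j" for j
  proof
    have ev: "\<forall>\<^sub>F n in sequentially. j \<le> Suc (r n)"
      using filterlim_compose[OF filterlim_Suc filterlim_subseq[OF r]] by (simp add: filterlim_at_top)
    have "(\<lambda>n. \<integral>\<theta>. cos (real j * \<theta>) \<partial>\<mu> (r n)) \<longlonglongrightarrow> \<tau> x j"
      by (rule Lim_transform_eventually[OF lim[of j]]) (use ev in eventually_elim, simp add: int fejer_moments del: of_nat_Suc)
    then show "(\<integral>\<theta>. cos (real j * \<theta>) \<partial>\<nu>) = \<tau> x j"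
      by (rule LIMSEQ_unique[OF weak[OF continuous_trig(1)], rotated]) simp
    have "(\<lambda>n. \<integral>\<theta>. sin (real j * \<theta>) \<partial>\<mu> (r n)) \<longlonglongrightarrow> \<sigma> x j"
      by (rule Lim_transform_eventually[OF lim[of j]]) (use ev in eventually_elim, simp add: int fejer_moments del: of_nat_Suc)
    then show "(\<integral>\<theta>. sin (real j * \<theta>) \<partial>\<nu>) = \<sigma> x j"
      by (rule LIMSEQ_unique[OF weak[OF continuous_trig(2)], rotated]) simp
  qed
  with \<nu> show ?thesis by blast
qed

text \<open>\<open>calc b c f F\<close>: the operator \<open>F\<close> arises from \<open>B\<close> and \<open>C\<close> by the polynomial expression by which
  \<open>f\<close> arises from the functions \<open>b\<close> and \<open>c\<close>.\<close>
inductive calc :: "('w \<Rightarrow> real) \<Rightarrow> ('w \<Rightarrow> real) \<Rightarrow> ('w \<Rightarrow> 'k) \<Rightarrow> ('h \<Rightarrow> 'h) \<Rightarrow> bool"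
  for b c where
  id: "calc b c (\<lambda>_. 1) (\<lambda>x. x)"
| mult_B: "calc b c f F \<Longrightarrow> calc b c (\<lambda>w. of_real (b w) * f w) (\<lambda>x. B (F x))"
| mult_C: "calc b c f F \<Longrightarrow> calc b c (\<lambda>w. of_real (c w) * f w) (\<lambda>x. C (F x))"
| add: "calc b c f F \<Longrightarrow> calc b c g G \<Longrightarrow> calc b c (\<lambda>w. f w + g w) (\<lambda>x. F x + G x)"
| smul: "calc b c f F \<Longrightarrow> calc b c (\<lambda>w. k * f w) (\<lambda>x. smul k (F x))"

lemma calc_bounded_linear: "calc b c f F \<Longrightarrow> bounded_linear F"
proof (induction rule: calc.induct)
  case (smul f F k)
  have "bounded_linear (smul k)"
    by (rule bounded_linear_intro[where K = "norm k"])
       (simp_all add: scale_right_distrib norm_smul scale_left_commute flip: smul_of_real)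
  then show ?case by (rule bounded_linear_compose[OF _ smul.IH])
qed (auto intro: bounded_linear_ident bounded_linear_add bounded_linear_compose[OF bounded_linear_B] bounded_linear_compose[OF bounded_linear_C])

lemma calc_commute: "calc b c f F \<Longrightarrow> F (B x) = B (F x) \<and> F (C x) = C (F x) \<and> F (smul k x) = smul k (F x)"
  by (induction rule: calc.induct)
     (simp_all add: B_add C_add B_smul C_smul BC_commute scale_right_distrib scale_left_commute)

lemma calc_mult: "calc b c f F \<Longrightarrow> calc b c g G \<Longrightarrow> calc b c (\<lambda>w. f w * g w) (\<lambda>x. F (G x))"
proof (induction rule: calc.induct)
  case (add f1 F1 f2 F2)
  then show ?case using calc.add by (simp add: distrib_right)
qed (simp_all add: mult.assoc calc.mult_B calc.mult_C calc.smul)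

text \<open>Symmetry of \<open>B\<close> and \<open>C\<close> leaves only scalars to conjugate.
  Together with \<open>calc_mult\<close> this expresses every \<open>ip (F x) (G x)\<close> as the
  moment of a single function.\<close>

lemma calc_adjoint: 
  "calc b c f F \<Longrightarrow> \<exists>G. calc b c (\<lambda>w. kconj (f w)) G \<and> (\<forall>x y. ip (F x) y = ip x (G y))"
proof (induction rule: calc.induct)
  case id
  then show ?case using calc.id by auto
next
  case (mult_B f F)
  then obtain G where G: "calc b c (\<lambda>w. kconj (f w)) G" "\<forall>x y. ip (F x) y = ip x (G y)" by blast
  with calc.mult_B[OF G(1)] show ?case
    by (intro exI[of _ "\<lambda>x. B (G x)"]) (simp add: kconj_mult B_sym calc_commute[OF G(1)])
next
  case (mult_C f F)
  then obtain G where G: "calc b c (\<lambda>w. kconj (f w)) G" "\<forall>x y. ip (F x) y = ip x (G y)" by blast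
  with calc.mult_C[OF G(1)] show ?case
    by (intro exI[of _ "\<lambda>x. C (G x)"]) (simp add: kconj_mult C_sym calc_commute[OF G(1)])
next
  case (add f F f' F')
  then obtain G G' where G: "calc b c (\<lambda>w. kconj (f w)) G" "\<forall>x y. ip (F x) y = ip x (G y)"
     "calc b c (\<lambda>w. kconj (f' w)) G'" "\<forall>x y. ip (F' x) y = ip x (G' y)" by blast
  with calc.add[OF G(1,3)] show ?case
    by (intro exI[of _ "\<lambda>x. G x + G' x"]) (simp add: kconj_add ip_add_left ip_add_right)
next
  case (smul f F k)
  then obtain G where G: "calc b c (\<lambda>w. kconj (f w)) G" "\<forall>x y. ip (F x) y = ip x (G y)" by blast
  with calc.smul[OF G(1), of "kconj k"] show ?case
    by (intro exI[of _ "\<lambda>x. smul (kconj k) (G x)"]) (simp add: kconj_mult ip_smul_left ip_smul_right)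
qed

lemma calc_measurable:
  assumes "b \<in> borel_measurable M" "c \<in> borel_measurable M"
  shows "calc b c f F \<Longrightarrow> f \<in> borel_measurable M"
proof (induction rule: calc.induct)
  case (mult_B f F)
  note [measurable] = mult_B.IH assms
  show ?case by measurable
next
  case (mult_C f F)
  note [measurable] = mult_C.IH assms
  show ?case by measurable
next
  case (add f F g G)
  note [measurable] = add.IH
  show ?case by measurable
next
  case (smul f F k)
  note [measurable] = smul.IH
  show ?case by measurable
qed simp

lemma calc_bounded:
  assumes "\<And>w. \<bar>b w\<bar> \<le> 1" "\<And>w. \<bar>c w\<bar> \<le> 1"
  shows "calc b c f F \<Longrightarrow> \<exists>K. \<forall>w. norm (f w) \<le> K"
proof (induction rule: calc.induct)
  case (mult_B f F)
  then obtain K where K: "\<And>w. norm (f w) \<le> K" by blast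
  have "\<bar>b w\<bar> * norm (f w) \<le> 1 * K" for w using assms(1) K by (intro mult_mono) auto
  then show ?case by (auto simp: norm_mult)
next
  case (mult_C f F)
  then obtain K where K: "\<And>w. norm (f w) \<le> K" by blast
  have "\<bar>c w\<bar> * norm (f w) \<le> 1 * K" for w using assms(2) K by (intro mult_mono) auto
  then show ?case by (auto simp: norm_mult)
next
  case (add f F g G)
  then obtain K L where "\<And>w. norm (f w) \<le> K" "\<And>w. norm (g w) \<le> L" by blast
  then have "norm (f w + g w) \<le> K + L" for w by (meson add_mono norm_triangle_le)
  then show ?case by blast
next
  case (smul f F k)
  then obtain K where "\<And>w. norm (f w) \<le> K" by blast
  then have "norm (k * f w) \<le> norm k * K" for w by (simp add: norm_mult mult_left_mono)
  then show ?case by blast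
qed auto

text \<open>With \<open>U = P + iQ\<close> these are \<open>B = 1/2 - (U + U^-1)/4\<close> and
  \<open>C = (U - U^-1)/(4i)\<close> applied to the powers of \<open>U\<close>. At
  \<open>k = 0\<close> the power \<open>U^-1\<close> has real part \<open>T 1\<close> and imaginary
  part \<open>- S 1\<close>.\<close>

lemma B_TS:
  "B (T k x) = (1/2) *\<^sub>R T k x - (1/4) *\<^sub>R (T (Suc k) x + (case k of 0 \<Rightarrow> T 1 x | Suc l \<Rightarrow> T l x))"
  "B (S k x) = (1/2) *\<^sub>R S k x - (1/4) *\<^sub>R (S (Suc k) x - (case k of 0 \<Rightarrow> S 1 x | Suc l \<Rightarrow> - S l x))"
  "C (T k x) = (1/4) *\<^sub>R (S (Suc k) x + (case k of 0 \<Rightarrow> S 1 x | Suc l \<Rightarrow> - S l x))"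
  "C (S k x) = (1/4) *\<^sub>R ((case k of 0 \<Rightarrow> T 1 x | Suc l \<Rightarrow> T l x) - T (Suc k) x)"
proof -
  have P0: "P 0 = 0" "Q 0 = 0" using PQ_diff[of 0 0] by simp_all
  have T: "P (T k x) + Q (S k x) = (case k of 0 \<Rightarrow> T 1 x | Suc l \<Rightarrow> T l x)"
    by (cases k) (simp_all add: P0 PQ_diff PQ_add PP PQ_commute)
  have S: "Q (T k x) - P (S k x) = (case k of 0 \<Rightarrow> S 1 x | Suc l \<Rightarrow> - S l x)"
    by (cases k) (simp_all add: P0 PQ_diff PQ_add PP PQ_commute)
  have BC: "B z = (1/2) *\<^sub>R z - (1/2) *\<^sub>R P z" "C z = (1/2) *\<^sub>R Q z" for z
    by (simp_all add: P_def Q_def algebra_simps)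
  have quarter: "(1/4) *\<^sub>R (z + z) = (1/2) *\<^sub>R z" for z :: 'h
    by (simp flip: scaleR_2)
  have q1: "(1/4) *\<^sub>R ((p - q) + (p + q)) = (1/2) *\<^sub>R p" for p q :: 'h
    using quarter[of p] by simp
  have q2: "(1/4) *\<^sub>R ((q + p) - (q - p)) = (1/2) *\<^sub>R p" for p q :: 'h
    using quarter[of p] by simp
  have q3: "(1/4) *\<^sub>R ((q + p) + (q - p)) = (1/2) *\<^sub>R q" for p q :: 'h
    using quarter[of q] by simp
  have q4: "(1/4) *\<^sub>R ((p + q) - (p - q)) = (1/2) *\<^sub>R q" for p q :: 'h
    using quarter[of q] by simp
  show "B (T k x) = (1/2) *\<^sub>R T k x - (1/4) *\<^sub>R (T (Suc k) x + (case k of 0 \<Rightarrow> T 1 x | Suc l \<Rightarrow> T l x))"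
    "B (S k x) = (1/2) *\<^sub>R S k x - (1/4) *\<^sub>R (S (Suc k) x - (case k of 0 \<Rightarrow> S 1 x | Suc l \<Rightarrow> - S l x))"
    "C (T k x) = (1/4) *\<^sub>R (S (Suc k) x + (case k of 0 \<Rightarrow> S 1 x | Suc l \<Rightarrow> - S l x))"
    "C (S k x) = (1/4) *\<^sub>R ((case k of 0 \<Rightarrow> T 1 x | Suc l \<Rightarrow> T l x) - T (Suc k) x)"
    by (simp_all only: T[symmetric] S[symmetric] T.simps S.simps q1 q2 q3 q4 BC(1)[of "T k x"] BC(1)[of "S k x"]
      BC(2)[of "T k x"] BC(2)[of "S k x"])
qed

text \<open>The scalar counterpart of \<open>B_TS\<close>, with cosine and sine for \<open>T\<close>
  and \<open>S\<close>, arranged so that both can be matched term by term.\<close>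

lemma trig_product:
  "(1 - cos \<theta>) / 2 * cos (real k * \<theta>) = cos (real k * \<theta>) / 2 - (cos (real (Suc k) * \<theta>) + (case k of 0 \<Rightarrow> cos (real 1 * \<theta>) | Suc l \<Rightarrow> cos (real l * \<theta>))) / 4"
  "(1 - cos \<theta>) / 2 * sin (real k * \<theta>) = sin (real k * \<theta>) / 2 - (sin (real (Suc k) * \<theta>) - (case k of 0 \<Rightarrow> sin (real 1 * \<theta>) | Suc l \<Rightarrow> - sin (real l * \<theta>))) / 4"
  "sin \<theta> / 2 * cos (real k * \<theta>) = (sin (real (Suc k) * \<theta>) + (case k of 0 \<Rightarrow> sin (real 1 * \<theta>) | Suc l \<Rightarrow> - sin (real l * \<theta>))) / 4"
  "sin \<theta> / 2 * sin (real k * \<theta>) = ((case k of 0 \<Rightarrow> cos (real 1 * \<theta>) | Suc l \<Rightarrow> cos (real l * \<theta>)) - cos (real (Suc k) * \<theta>)) / 4"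
proof -
  have S: "real (Suc k) * \<theta> = real k * \<theta> + \<theta>" by (simp add: algebra_simps)
  have c: "(case k of 0 \<Rightarrow> cos (real 1 * \<theta>) | Suc l \<Rightarrow> cos (real l * \<theta>)) = cos (real k * \<theta> - \<theta>)"
    by (cases k) (simp_all add: algebra_simps)
  have s: "(case k of 0 \<Rightarrow> sin (real 1 * \<theta>) | Suc l \<Rightarrow> - sin (real l * \<theta>)) = - sin (real k * \<theta> - \<theta>)"
    by (cases k) (simp_all add: algebra_simps)
  show "(1 - cos \<theta>) / 2 * cos (real k * \<theta>) = cos (real k * \<theta>) / 2 - (cos (real (Suc k) * \<theta>) + (case k of 0 \<Rightarrow> cos (real 1 * \<theta>) | Suc l \<Rightarrow> cos (real l * \<theta>))) / 4"
  "(1 - cos \<theta>) / 2 * sin (real k * \<theta>) = sin (real k * \<theta>) / 2 - (sin (real (Suc k) * \<theta>) - (case k of 0 \<Rightarrow> sin (real 1 * \<theta>) | Suc l \<Rightarrow> - sin (real l * \<theta>))) / 4"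
  "sin \<theta> / 2 * cos (real k * \<theta>) = (sin (real (Suc k) * \<theta>) + (case k of 0 \<Rightarrow> sin (real 1 * \<theta>) | Suc l \<Rightarrow> - sin (real l * \<theta>))) / 4"
  "sin \<theta> / 2 * sin (real k * \<theta>) = ((case k of 0 \<Rightarrow> cos (real 1 * \<theta>) | Suc l \<Rightarrow> cos (real l * \<theta>)) - cos (real (Suc k) * \<theta>)) / 4"
    unfolding S c s cos_add cos_diff sin_add sin_diff by (simp_all add: field_simps)
qed

end

section \<open>Spectral measures of vectors\<close>

lemma integral_of_real:
  "integrable M f \<Longrightarrow> (\<integral>x. of_real (f x) \<partial>M) = (of_real (\<integral>x. f x \<partial>M) :: 'k::real_or_complex)"
  by (rule integral_bounded_linear[OF bounded_linear_of_real])

context resolvent_pair begin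

text \<open>The substitution \<open>g\<close> serves two uses: the identity, on the circle, while
  the exceptional set is not yet known to be null, and the passage to the real line
  afterwards.\<close>

lemma calc_moments:
  assumes \<nu>: "real_distribution \<nu>"
    and mom: "\<And>j. (\<integral>\<theta>. cos (real j * \<theta>) \<partial>\<nu>) = \<tau> x j" "\<And>j. (\<integral>\<theta>. sin (real j * \<theta>) \<partial>\<nu>) = \<sigma> x j"
    and meas [measurable]: "b \<in> borel_measurable borel" "c \<in> borel_measurable borel" "g \<in> borel_measurable borel"
    and bounded: "\<And>w. \<bar>b w\<bar> \<le> (1::real)" "\<And>w. \<bar>c w\<bar> \<le> (1::real)"
    and AE_b: "AE \<theta> in \<nu>. b (g \<theta>) = (1 - cos \<theta>) / 2" and AE_c: "AE \<theta> in \<nu>. c (g \<theta>) = sin \<theta> / 2"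
    and F: "calc b c f F"
  shows "ip (F x) x = (\<integral>\<theta>. f (g \<theta> :: real) \<partial>\<nu>)"
proof -
  interpret real_distribution \<nu> by fact
  define I where "I f h = (\<integral>\<theta>. f (g \<theta>) * of_real (h \<theta>) \<partial>\<nu>)" for f :: "real \<Rightarrow> 'k" and h :: "real \<Rightarrow> real"
  define cs where "cs k \<theta> = cos (real k * \<theta>)" for k :: nat and \<theta> :: real
  define sn where "sn k \<theta> = sin (real k * \<theta>)" for k :: nat and \<theta> :: real
  have [measurable]: "cs k \<in> borel_measurable borel" "sn k \<in> borel_measurable borel" for k
    unfolding cs_def sn_def by measurable
  have le1: "\<bar>cs k \<theta>\<bar> \<le> 1" "\<bar>sn k \<theta>\<bar> \<le> 1" for k \<theta> by (simp_all add: cs_def sn_def)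
  have int: "integrable \<nu> (\<lambda>\<theta>. f (g \<theta>) * of_real (h \<theta>))"
    if f: "calc b c f F" and [measurable]: "h \<in> borel_measurable borel" and h: "\<And>\<theta>. \<bar>h \<theta>\<bar> \<le> 1" for f F h
  proof -
    have [measurable]: "f \<in> borel_measurable borel" by (rule calc_measurable[OF meas(1,2) f])
    obtain K where K: "\<And>w. norm (f w) \<le> K" using calc_bounded[OF bounded f] by blast
    have "norm (f (g \<theta>)) * \<bar>h \<theta>\<bar> \<le> K * 1" for \<theta>
      using K h by (intro mult_mono) (auto intro: order_trans[OF norm_ge_zero])
    then show ?thesis by (intro integrable_const_bound[of _ K]) (auto simp: norm_mult)
  qed
  note ints = int[OF _ _ le1(1)] int[OF _ _ le1(2)]
  have I_comb: "I f (\<lambda>\<theta>. r * h \<theta> + s * h' \<theta> + t * h'' \<theta>) = of_real r * I f h + of_real s * I f h' + of_real t * I f h''"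
    if "calc b c f F" "h \<in> range cs \<union> range sn" "h' \<in> range cs \<union> range sn" "h'' \<in> range cs \<union> range sn" for f F h h' h'' r s t
  proof -
    have i: "integrable \<nu> (\<lambda>\<theta>. f (g \<theta>) * of_real (k \<theta>))" if "k \<in> range cs \<union> range sn" for k
      using ints[OF \<open>calc b c f F\<close>] that by auto
    have "I f (\<lambda>\<theta>. r * h \<theta> + s * h' \<theta> + t * h'' \<theta>) = (\<integral>\<theta>. of_real r * (f (g \<theta>) * of_real (h \<theta>))
        + of_real s * (f (g \<theta>) * of_real (h' \<theta>)) + of_real t * (f (g \<theta>) * of_real (h'' \<theta>)) \<partial>\<nu>)"
      unfolding I_def by (intro Bochner_Integration.integral_cong refl) (simp add: algebra_simps)
    then show ?thesis using i that(2-4) by (simp add: I_def)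
  qed
  have I_mult: "I (\<lambda>w. of_real (u w) * f w) h = I f h'"
    if f: "calc b c f F" and [measurable]: "u \<in> borel_measurable borel" "h \<in> borel_measurable borel" "h' \<in> borel_measurable borel"
      and eq: "AE \<theta> in \<nu>. u (g \<theta>) * h \<theta> = h' \<theta>" for u f F h h'
  proof -
    have [measurable]: "f \<in> borel_measurable borel" by (rule calc_measurable[OF meas(1,2) f])
    have "AE \<theta> in \<nu>. of_real (u (g \<theta>)) * f (g \<theta>) * of_real (h \<theta>) = f (g \<theta>) * of_real (h' \<theta>)"
      using eq by eventually_elim (simp add: mult_ac flip: of_real_mult)
    then show ?thesis unfolding I_def by (intro integral_cong_AE) auto
  qed
  \<comment> \<open>The claim is strengthened to all \<open>T k x\<close> and \<open>S k x\<close>,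
    with weights \<open>cos (k \<theta>)\<close> and \<open>sin (k \<theta>)\<close>: a factor
    \<open>B\<close> or \<open>C\<close> shifts \<open>k\<close>, by \<open>B_TS\<close> on one side
    and by \<open>trig_product\<close> on the other.\<close>
  have "(\<forall>k. ip (F (T k x)) x = I f (cs k) \<and> ip (F (S k x)) x = I f (sn k))"
    using F
  proof (induction rule: calc.induct)
    case id
    have "integrable \<nu> (cs k)" "integrable \<nu> (sn k)" for k
      by (rule integrable_const_bound[of _ 1]; simp add: le1)+
    from this[THEN integral_of_real[where 'k = 'k]] show ?case unfolding I_def 
      by (simp add: cs_def sn_def mom flip: of_real_\<tau> of_real_\<sigma>)
  next
    case (mult_B f F)
    interpret F: bounded_linear F by (rule calc_bounded_linear[OF mult_B.hyps])
    have FB: "F (B z) = B (F z)" for z using calc_commute[OF mult_B.hyps] by blast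
    show ?case
    proof (intro allI conjI)
      fix k
      have "I (\<lambda>w. of_real (b w) * f w) (cs k) = I f (\<lambda>\<theta>. 1/2 * cs k \<theta> + (-1/4) * cs (Suc k) \<theta> + (-1/4) * (case k of 0 \<Rightarrow> cs 1 | Suc l \<Rightarrow> cs l) \<theta>)"
        by (rule I_mult[OF mult_B.hyps, rotated 3],
            use AE_b in \<open>eventually_elim, simp only: cs_def sn_def trig_product, cases k, (simp_all add: cs_def sn_def field_simps)[2]\<close>,
            auto split: nat.split)
      also have "\<dots> = of_real (1/2) * I f (cs k) + of_real (-1/4) * I f (cs (Suc k)) + of_real (-1/4) * I f (case k of 0 \<Rightarrow> cs 1 | Suc l \<Rightarrow> cs l)"
        by (rule I_comb[OF mult_B.hyps]) (auto split: nat.split)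
      also have "\<dots> = ip (B (F (T k x))) x"
        unfolding FB[symmetric] B_TS F.diff F.add F.scaleR ip_diff_left ip_add_left ip_scaleR_left
        by (cases k) (simp_all add: mult_B.IH[rule_format, THEN conjunct1, symmetric] mult_B.IH[rule_format, THEN conjunct2, symmetric] algebra_simps del: T.simps)
      finally show "ip (B (F (T k x))) x = I (\<lambda>w. of_real (b w) * f w) (cs k)" by simp
      have "I (\<lambda>w. of_real (b w) * f w) (sn k) = I f (\<lambda>\<theta>. 1/2 * sn k \<theta> + (-1/4) * sn (Suc k) \<theta> + (case k of 0 \<Rightarrow> 1/4 | Suc _ \<Rightarrow> - 1/4) * (case k of 0 \<Rightarrow> sn 1 | Suc l \<Rightarrow> sn l) \<theta>)"
        by (rule I_mult[OF mult_B.hyps, rotated 3],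
            use AE_b in \<open>eventually_elim, simp only: cs_def sn_def trig_product, cases k, (simp_all add: cs_def sn_def field_simps)[2]\<close>,
            auto split: nat.split)
      also have "\<dots> = of_real (1/2) * I f (sn k) + of_real (-1/4) * I f (sn (Suc k)) + of_real (case k of 0 \<Rightarrow> 1/4 | Suc _ \<Rightarrow> - 1/4) * I f (case k of 0 \<Rightarrow> sn 1 | Suc l \<Rightarrow> sn l)"
        by (rule I_comb[OF mult_B.hyps]) (auto split: nat.split)
      also have "\<dots> = ip (B (F (S k x))) x"
        unfolding FB[symmetric] B_TS F.diff F.add F.scaleR ip_diff_left ip_add_left ip_scaleR_left
        by (cases k) (simp_all add: mult_B.IH[rule_format, THEN conjunct1, symmetric] mult_B.IH[rule_format, THEN conjunct2, symmetric] algebra_simps F.neg ip_minus_left del: S.simps)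
      finally show "ip (B (F (S k x))) x = I (\<lambda>w. of_real (b w) * f w) (sn k)" by simp
    qed
  next
    case (mult_C f F)
    interpret F: bounded_linear F by (rule calc_bounded_linear[OF mult_C.hyps])
    have FC: "F (C z) = C (F z)" for z using calc_commute[OF mult_C.hyps] by blast
    show ?case
    proof (intro allI conjI)
      fix k
      \<comment> \<open>The term with coefficient 0 pads the combination to the three terms of
        \<open>I_comb\<close>.\<close>
      have "I (\<lambda>w. of_real (c w) * f w) (cs k) = I f (\<lambda>\<theta>. 0 * sn k \<theta> + 1/4 * sn (Suc k) \<theta> + (case k of 0 \<Rightarrow> 1/4 | Suc _ \<Rightarrow> - 1/4) * (case k of 0 \<Rightarrow> sn 1 | Suc l \<Rightarrow> sn l) \<theta>)"
        by (rule I_mult[OF mult_C.hyps, rotated 3],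
            use AE_c in \<open>eventually_elim, simp only: cs_def sn_def trig_product, cases k, (simp_all add: cs_def sn_def field_simps)[2]\<close>,
            auto split: nat.split)
      also have "\<dots> = of_real 0 * I f (sn k) + of_real (1/4) * I f (sn (Suc k)) + of_real (case k of 0 \<Rightarrow> 1/4 | Suc _ \<Rightarrow> - 1/4) * I f (case k of 0 \<Rightarrow> sn 1 | Suc l \<Rightarrow> sn l)"
        by (rule I_comb[OF mult_C.hyps]) (auto split: nat.split)
      also have "\<dots> = ip (C (F (T k x))) x"
        unfolding FC[symmetric] B_TS F.diff F.add F.scaleR ip_diff_left ip_add_left ip_scaleR_left
        by (cases k) (simp_all add: mult_C.IH[rule_format, THEN conjunct1, symmetric] mult_C.IH[rule_format, THEN conjunct2, symmetric] algebra_simps F.neg ip_minus_left del: S.simps)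
      finally show "ip (C (F (T k x))) x = I (\<lambda>w. of_real (c w) * f w) (cs k)" by simp
      have "I (\<lambda>w. of_real (c w) * f w) (sn k) = I f (\<lambda>\<theta>. 0 * cs k \<theta> + (-1/4) * cs (Suc k) \<theta> + 1/4 * (case k of 0 \<Rightarrow> cs 1 | Suc l \<Rightarrow> cs l) \<theta>)"
        by (rule I_mult[OF mult_C.hyps, rotated 3],
            use AE_c in \<open>eventually_elim, simp only: cs_def sn_def trig_product, cases k, (simp_all add: cs_def sn_def field_simps)[2]\<close>,
            auto split: nat.split)
      also have "\<dots> = of_real 0 * I f (cs k) + of_real (-1/4) * I f (cs (Suc k)) + of_real (1/4) * I f (case k of 0 \<Rightarrow> cs 1 | Suc l \<Rightarrow> cs l)"
        by (rule I_comb[OF mult_C.hyps]) (auto split: nat.split)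
      also have "\<dots> = ip (C (F (S k x))) x"
        unfolding FC[symmetric] B_TS F.diff F.add F.scaleR ip_diff_left ip_add_left ip_scaleR_left
        by (cases k) (simp_all add: mult_C.IH[rule_format, THEN conjunct1, symmetric] mult_C.IH[rule_format, THEN conjunct2, symmetric] algebra_simps del: T.simps)
      finally show "ip (C (F (S k x))) x = I (\<lambda>w. of_real (c w) * f w) (sn k)" by simp
    qed
  next
    case (add f F f' F')
    have "I (\<lambda>w. f w + f' w) h = I f h + I f' h" if "h \<in> range cs \<union> range sn" for h
      unfolding I_def distrib_right using that ints[OF add.hyps(1)] ints[OF add.hyps(2)] 
      by (intro Bochner_Integration.integral_add) auto
    with add.IH show ?case by (simp add: ip_add_left)
  next
    case (smul f F k)
    have "I (\<lambda>w. k * f w) h = k * I f h" for h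
      unfolding I_def by (simp add: mult.assoc)
    with smul.IH show ?case by (simp add: ip_smul_left)
  qed
  from spec[OF this, of 0] show ?thesis by (simp add: I_def cs_def)
qed

lemma calc_one_minus_B_power:
  "calc b c (\<lambda>w. of_real ((1 - b w) ^ n)) ((\<lambda>x. x - B x) ^^ n)"
proof (induction n)
  case 0
  then show ?case using calc.id by (simp add: id_def)
next
  case (Suc n)
  from calc.add[OF Suc calc.smul[OF calc.mult_B[OF Suc], of "- 1"]] show ?case
    by (simp add: smul_minus_one algebra_simps funpow_swap1[of "\<lambda>x. x - B x"])
qed

text \<open>The mean ergodic argument: the limit \<open>y\<close> of \<open>(1 - B)\<^sup>n x\<close> satisfies \<open>B y = 0\<close>, so \<open>y = 0\<close>, whereas
  \<open>norm y\<^sup>2\<close> is the mass of the set where \<open>cos \<theta> = 1\<close>.\<close>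
lemma null_cos_eq_one:
  assumes \<nu>: "real_distribution \<nu>"
    and mom: "\<And>j. (\<integral>\<theta>. cos (real j * \<theta>) \<partial>\<nu>) = \<tau> x j" "\<And>j. (\<integral>\<theta>. sin (real j * \<theta>) \<partial>\<nu>) = \<sigma> x j"
  shows "AE \<theta> in \<nu>. cos \<theta> \<noteq> 1"
proof -
  interpret real_distribution \<nu> by fact
  have space: "space \<nu> = UNIV" by (metis events_eq_borel sets_eq_imp_space_eq space_borel)
  define J where "J x = x - B x" for x
  define \<gamma> where "\<gamma> n = (\<integral>\<theta>. ((1 + cos \<theta>) / 2) ^ n \<partial>\<nu>)" for n
  define p where "p = (\<integral>\<theta>. indicat_real {\<theta>. cos \<theta> = 1} \<theta> \<partial>\<nu>)"
  have base: "\<bar>(1 + cos \<theta>) / 2\<bar> \<le> 1" for \<theta> :: real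
    using abs_cos_le_one[of \<theta>] by (simp add: abs_le_iff, linarith)
  have \<gamma>_lim: "\<gamma> \<longlonglongrightarrow> p"
    unfolding \<gamma>_def p_def
  proof (rule integral_dominated_convergence[where w = "\<lambda>_. 1"])
    show "AE \<theta> in \<nu>. (\<lambda>n. ((1 + cos \<theta>) / 2) ^ n) \<longlonglongrightarrow> indicator {\<theta>. cos \<theta> = 1} \<theta>"
    proof (intro AE_I2)
      fix \<theta> :: real
      show "(\<lambda>n. ((1 + cos \<theta>) / 2) ^ n) \<longlonglongrightarrow> indicator {\<theta>. cos \<theta> = 1} \<theta>"
      proof (cases "cos \<theta> = 1")
        case False
        then have "cos \<theta> < 1" "- 3 < cos \<theta>"
          using cos_ge_minus_one[of \<theta>] cos_le_one[of \<theta>] by linarith+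
        then have "\<bar>(1 + cos \<theta>) / 2\<bar> < 1" by (auto simp: abs_less_iff)
        then show ?thesis using False by (simp add: LIMSEQ_power_zero)
      qed simp
    qed
    show "AE \<theta> in \<nu>. norm (((1 + cos \<theta>) / 2) ^ n) \<le> 1" for n
      using base by (simp add: power_abs power_le_one del: abs_divide)
  qed auto
  have "ip ((J ^^ n) x) x = of_real (\<gamma> n)" for n
  proof -
    have eq: "(1 - (1 - cos w) / 2) = (1 + cos w) / 2" for w :: real by (simp add: field_simps)
    have "ip ((J ^^ n) x) x = (\<integral>\<theta>. of_real ((1 - (1 - cos \<theta>) / 2) ^ n) \<partial>\<nu>)"
      unfolding J_def
    proof (rule calc_moments[OF \<nu> mom _ _ _ _ _ _ _ calc_one_minus_B_power, of "\<lambda>\<theta>. (1 - cos \<theta>) / 2" "\<lambda>\<theta>. sin \<theta> / 2" "\<lambda>\<theta>. \<theta>"])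
      have half: "\<bar>(1 - c) / 2\<bar> \<le> 1" "\<bar>c / 2\<bar> \<le> 1" if "- 1 \<le> c" "c \<le> 1" for c :: real
        using that by (auto simp: abs_le_iff)
      show "\<bar>(1 - cos \<theta>) / 2\<bar> \<le> 1" "\<bar>sin \<theta> / 2\<bar> \<le> 1" for \<theta> :: real
        by (intro half; simp)+
    qed auto
    also have "\<dots> = of_real (\<gamma> n)" unfolding \<gamma>_def eq using base
      by (intro integral_of_real integrable_const_bound[of _ 1]) (auto simp: power_abs power_le_one simp del: abs_divide)
    finally show ?thesis .
  qed
  moreover have "ip ((J ^^ n) y) z = ip y ((J ^^ n) z)" for n y z
  proof (induction n arbitrary: y z)
    case (Suc n)
    have J_sym: "ip (J y) z = ip y (J z)" for y z
      by (simp add: J_def ip_diff_left ip_diff_right B_sym)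
    show ?case by (simp add: J_sym Suc) (simp add: funpow_swap1)
  qed simp
  \<comment> \<open>The inner products depend on \<open>m + n\<close> only, so convergence of
    \<open>\<gamma>\<close> by itself makes the sequence of iterates Cauchy.\<close>
  ultimately have gram: "ip ((J ^^ n) x) ((J ^^ m) x) = of_real (\<gamma> (m + n))" for n m
    by (metis add.commute funpow_add o_apply)
  have dist: "(norm ((J ^^ n) x - (J ^^ m) x))\<^sup>2 = \<gamma> (n + n) - 2 * \<gamma> (n + m) + \<gamma> (m + m)" for n m
  proof -
    have "(of_real ((norm ((J ^^ n) x - (J ^^ m) x))\<^sup>2) :: 'k) = of_real (\<gamma> (n + n) - 2 * \<gamma> (n + m) + \<gamma> (m + m))"
      unfolding ip_self[symmetric] ip_diff_left ip_diff_right gram by (simp add: add.commute)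
    then show ?thesis by (simp only: of_real_eq_iff)
  qed
  have "Cauchy (\<lambda>n. (J ^^ n) x)"
  proof (rule CauchyI)
    fix e :: real assume e: "0 < e"
    then obtain N where N: "\<And>n. n \<ge> N \<Longrightarrow> \<bar>\<gamma> n - p\<bar> < e\<^sup>2 / 4"
      using \<gamma>_lim[THEN LIMSEQ_D, of "e\<^sup>2 / 4"] by auto
    have "norm ((J ^^ m) x - (J ^^ n) x) < e" if "m \<ge> N" "n \<ge> N" for m n
    proof -
      have "(norm ((J ^^ m) x - (J ^^ n) x))\<^sup>2 < e\<^sup>2"
        using N[of "m + m"] N[of "m + n"] N[of "n + n"] that unfolding dist by linarith
      then show ?thesis using e by (simp add: power2_less_imp_less)
    qed
    then show "\<exists>M. \<forall>m\<ge>M. \<forall>n\<ge>M. norm ((J ^^ m) x - (J ^^ n) x) < e" by blast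
  qed
  then obtain y where y: "(\<lambda>n. (J ^^ n) x) \<longlonglongrightarrow> y" using Cauchy_convergent convergent_def by blast
  have "(\<lambda>n. B ((J ^^ n) x)) \<longlonglongrightarrow> B y" by (rule bounded_linear.tendsto[OF bounded_linear_B y])
  moreover have "B ((J ^^ n) x) = (J ^^ n) x - (J ^^ Suc n) x" for n by (simp add: J_def)
  moreover have "(\<lambda>n. (J ^^ n) x - (J ^^ Suc n) x) \<longlonglongrightarrow> y - y" by (intro tendsto_diff y LIMSEQ_Suc[OF y])
  ultimately have "B y = 0" using LIMSEQ_unique by fastforce
  then have "y = 0" by (rule B_eq_zero)
  have "(\<lambda>n. (norm ((J ^^ n) x))\<^sup>2) \<longlonglongrightarrow> (norm y)\<^sup>2" by (intro tendsto_intros y)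
  moreover have "(norm ((J ^^ n) x))\<^sup>2 = \<gamma> (n + n)" for n
    using gram[of n n] by (simp only: ip_self of_real_eq_iff)
  moreover have "(\<lambda>n. \<gamma> (n + n)) \<longlonglongrightarrow> p"
    using LIMSEQ_subseq_LIMSEQ[OF \<gamma>_lim, of "\<lambda>n. n + n"] by (simp add: o_def strict_mono_def)
  ultimately have "p = 0" using LIMSEQ_unique \<open>y = 0\<close> by fastforce
  then have "emeasure \<nu> {\<theta>. cos \<theta> = 1} = 0"
    unfolding p_def by (simp add: emeasure_eq_measure space)
  then show ?thesis using space by (subst AE_iff_measurable[of "{\<theta>. cos \<theta> = 1}"]) auto
qed

end

section \<open>Passage from the circle to the real line\<close>

definition res_b :: "real \<Rightarrow> real" where "res_b a = 1 / (1 + a\<^sup>2)"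
definition res_c :: "real \<Rightarrow> real" where "res_c a = a / (1 + a\<^sup>2)"

lemma res_measurable [measurable]: "res_b \<in> borel_measurable borel" "res_c \<in> borel_measurable borel"
  unfolding res_b_def res_c_def by measurable

lemma res_pos: "0 < res_b a"
  by (simp add: res_b_def add_pos_nonneg)

lemma res_le_one: "\<bar>res_b a\<bar> \<le> 1" "\<bar>res_c a\<bar> \<le> 1"
proof -
  have "0 \<le> (\<bar>a\<bar> - 1/2)\<^sup>2" by simp
  then have "\<bar>a\<bar> \<le> 1 + a\<^sup>2" by (simp add: power2_diff power_divide)
  then show "\<bar>res_b a\<bar> \<le> 1" "\<bar>res_c a\<bar> \<le> 1"
    by (simp_all add: res_b_def res_c_def abs_divide add_pos_nonneg)
qed

text \<open>The argument is \<open>cot (\<theta> / 2)\<close>, and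
  \<open>1 + cot^2 = 1 / sin^2\<close> at the half angle becomes
  \<open>2 / (1 - cos \<theta>)\<close>.\<close>

lemma res_cot:
  assumes "cos \<theta> \<noteq> 1"
  shows "res_b (sin \<theta> / (1 - cos \<theta>)) = (1 - cos \<theta>) / 2" "res_c (sin \<theta> / (1 - cos \<theta>)) = sin \<theta> / 2"
proof -
  have n: "1 - cos \<theta> \<noteq> 0" using assms by simp
  have "1 + (sin \<theta> / (1 - cos \<theta>))\<^sup>2 = ((1 - cos \<theta>)\<^sup>2 + (sin \<theta>)\<^sup>2) / (1 - cos \<theta>)\<^sup>2"
    using n by (simp add: power_divide add_divide_distrib)
  also have "(1 - cos \<theta>)\<^sup>2 + (sin \<theta>)\<^sup>2 = 2 * (1 - cos \<theta>)"
    by (simp add: power2_diff sin_squared_eq)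
  also have "2 * (1 - cos \<theta>) / (1 - cos \<theta>)\<^sup>2 = 2 / (1 - cos \<theta>)"
    unfolding power2_eq_square by (rule mult_divide_mult_cancel_right[OF n])
  finally have "1 + (sin \<theta> / (1 - cos \<theta>))\<^sup>2 = 2 / (1 - cos \<theta>)" .
  then show "res_b (sin \<theta> / (1 - cos \<theta>)) = (1 - cos \<theta>) / 2" "res_c (sin \<theta> / (1 - cos \<theta>)) = sin \<theta> / 2"
    using n by (simp_all add: res_b_def res_c_def)
qed

context resolvent_pair begin

text \<open>Moments are available for unit vectors only, so the measure of \<open>x / norm x\<close>
  is pushed to the line and scaled by \<open>(norm x)^2\<close>.\<close>

theorem spectral_measure:
  "\<exists>\<mu>. finite_measure \<mu> \<and> sets \<mu> = sets borel \<and>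
    (\<forall>f F. calc res_b res_c f F \<longrightarrow> ip (F x) x = (\<integral>a. f a \<partial>\<mu>))"
proof (cases "x = 0")
  case True
  have "finite_measure (null_measure borel)" by (rule finite_measureI) simp
  moreover have "F 0 = 0" if "calc res_b res_c f F" for f F
    using linear_0 calc_bounded_linear[OF that] bounded_linear.linear by blast
  ultimately show ?thesis
    using True by (intro exI[of _ "null_measure borel"]) (auto simp: not_integrable_integral_eq)
next
  case False
  define e where "e = (1 / norm x) *\<^sub>R x"
  have "norm e = 1" using False by (simp add: e_def)
  then obtain \<nu> where \<nu>: "real_distribution \<nu>"
    and mom: "\<And>j. (\<integral>\<theta>. cos (real j * \<theta>) \<partial>\<nu>) = \<tau> e j" "\<And>j. (\<integral>\<theta>. sin (real j * \<theta>) \<partial>\<nu>) = \<sigma> e j"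
    using trigonometric_moments by blast
  interpret real_distribution \<nu> by fact
  \<comment> \<open>Where \<open>cos \<theta> = 1\<close> the division yields the value 0; this set
    is \<open>\<nu>\<close>-null by \<open>null_cos_eq_one\<close>.\<close>
  define g where "g \<theta> = sin \<theta> / (1 - cos \<theta>)" for \<theta> :: real
  have g [measurable]: "g \<in> borel_measurable borel" unfolding g_def by measurable
  define \<mu> where "\<mu> = density (distr \<nu> borel g) (\<lambda>_. ennreal ((norm x)\<^sup>2))"
  have sets: "sets \<mu> = sets borel" by (simp add: \<mu>_def)
  interpret D: prob_space "distr \<nu> borel g" by (rule prob_space_distr) simp
  have "emeasure \<mu> (space \<mu>) = ennreal ((norm x)\<^sup>2)"
    using D.emeasure_space_1 by (simp add: \<mu>_def emeasure_density_const)
  then have "finite_measure \<mu>" by (intro finite_measureI) simp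
  moreover have "ip (F x) x = (\<integral>a. f a \<partial>\<mu>)" if F: "calc res_b res_c f F" for f F
  proof -
    have [measurable]: "f \<in> borel_measurable borel" by (rule calc_measurable[OF res_measurable F])
    note ae = null_cos_eq_one[OF \<nu> mom]
    have 1: "ip (F e) e = (\<integral>\<theta>. f (g \<theta>) \<partial>\<nu>)"
      using ae by (intro calc_moments[OF \<nu> mom res_measurable g res_le_one _ _ F])
         (auto elim!: eventually_mono simp: g_def res_cot)
    have "F x = norm x *\<^sub>R F e"
      using False bounded_linear.linear[OF calc_bounded_linear[OF F]] by (simp add: e_def linear_scale)
    then have "ip (F x) x = of_real ((norm x)\<^sup>2) * ip (F e) e"
      using False by (simp add: e_def ip_scaleR_left ip_scaleR_right power2_eq_square)
    also have "\<dots> = (\<integral>a. (norm x)\<^sup>2 *\<^sub>R f a \<partial>distr \<nu> borel g)"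
      unfolding 1 by (simp add: integral_distr scaleR_conv_of_real)
    also have "\<dots> = (\<integral>a. f a \<partial>\<mu>)"
      unfolding \<mu>_def by (subst integral_density) auto
    finally show ?thesis .
  qed
  ultimately show ?thesis using sets by blast
qed

end

section \<open>Square integrable functions\<close>

lemma square_integrable_measurable: "f \<in> square_integrable M \<Longrightarrow> f \<in> borel_measurable M"
  by (simp add: square_integrable_def)

lemma square_integrable_integrable: "f \<in> square_integrable M \<Longrightarrow> integrable M (\<lambda>w. (norm (f w))\<^sup>2)"
  by (simp add: square_integrable_def)

lemma norm_add_square_le: "(norm (x + y))\<^sup>2 \<le> 2 * (norm x)\<^sup>2 + 2 * (norm (y :: 'a :: real_normed_vector))\<^sup>2"
proof -
  have "(norm (x + y))\<^sup>2 \<le> (norm x + norm y)\<^sup>2" by (intro power_mono norm_triangle_ineq) simp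
  also have "\<dots> \<le> 2 * (norm x)\<^sup>2 + 2 * (norm y)\<^sup>2"
    using zero_le_power2[of "norm x - norm y"] unfolding power2_sum power2_diff by linarith
  finally show ?thesis .
qed

lemma square_integrable_bound:
  assumes "integrable M u" "f \<in> borel_measurable M" "AE w in M. (norm (f w))\<^sup>2 \<le> u w"
  shows "f \<in> square_integrable M"
proof -
  have "integrable M (\<lambda>w. (norm (f w))\<^sup>2)"
  proof (rule Bochner_Integration.integrable_bound[OF assms(1)])
    show "AE w in M. norm ((norm (f w))\<^sup>2) \<le> norm (u w)"
      using assms(3) by eventually_elim simp
  qed (use assms(2) in measurable)
  with assms(2) show ?thesis by (simp add: square_integrable_def)
qed

lemma square_integrable_add:
  assumes "f \<in> square_integrable M" "g \<in> square_integrable M"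
  shows "(\<lambda>w. f w + g w) \<in> square_integrable M"
    and "(\<integral>w. (norm (f w + g w))\<^sup>2 \<partial>M) \<le> 2 * (\<integral>w. (norm (f w))\<^sup>2 \<partial>M) + 2 * (\<integral>w. (norm (g w))\<^sup>2 \<partial>M)"
proof -
  note [measurable] = assms[THEN square_integrable_measurable]
  have i: "integrable M (\<lambda>w. 2 * (norm (f w))\<^sup>2 + 2 * (norm (g w))\<^sup>2)"
    using assms[THEN square_integrable_integrable] by simp
  show s: "(\<lambda>w. f w + g w) \<in> square_integrable M"
    by (rule square_integrable_bound[OF i]) (auto simp: norm_add_square_le)
  have "(\<integral>w. (norm (f w + g w))\<^sup>2 \<partial>M) \<le> (\<integral>w. 2 * (norm (f w))\<^sup>2 + 2 * (norm (g w))\<^sup>2 \<partial>M)"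
    by (intro integral_mono i square_integrable_integrable[OF s] norm_add_square_le)
  then show "(\<integral>w. (norm (f w + g w))\<^sup>2 \<partial>M) \<le> 2 * (\<integral>w. (norm (f w))\<^sup>2 \<partial>M) + 2 * (\<integral>w. (norm (g w))\<^sup>2 \<partial>M)"
    using assms[THEN square_integrable_integrable] by simp
qed

lemma square_integrable_mult: "f \<in> square_integrable M \<Longrightarrow> (\<lambda>w. c * f w) \<in> square_integrable M"
  by (auto simp: square_integrable_def norm_mult power_mult_distrib intro: borel_measurable_times)

lemma square_integrable_uminus: "f \<in> square_integrable M \<Longrightarrow> (\<lambda>w. - f w) \<in> square_integrable M"
  by (simp add: square_integrable_def)

lemma square_integrable_diff:
  "f \<in> square_integrable M \<Longrightarrow> g \<in> square_integrable M \<Longrightarrow> (\<lambda>w. f w - g w) \<in> square_integrable M"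
  using square_integrable_add(1)[of f M "\<lambda>w. - g w"] square_integrable_uminus[of g M] by simp

lemma square_integrable_mult_bounded:
  assumes "f \<in> square_integrable M" "u \<in> borel_measurable M" "\<And>w. norm (u w) \<le> 1"
  shows "(\<lambda>w. u w * f w) \<in> square_integrable M"
proof (rule square_integrable_bound[OF square_integrable_integrable[OF assms(1)]])
  show "(\<lambda>w. u w * f w) \<in> borel_measurable M"
    using assms(2) square_integrable_measurable[OF assms(1)] by measurable
  have "(norm (u w))\<^sup>2 * (norm (f w))\<^sup>2 \<le> 1 * (norm (f w))\<^sup>2" for w
    using assms(3) by (intro mult_right_mono power_le_one) auto
  then show "AE w in M. (norm (u w * f w))\<^sup>2 \<le> (norm (f w))\<^sup>2"
    by (simp add: norm_mult power_mult_distrib)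
qed

lemma integrable_square_integrable_mult:
  assumes "f \<in> square_integrable M" "g \<in> square_integrable M"
  shows "integrable M (\<lambda>w. f w * kconj (g w))"
proof (rule Bochner_Integration.integrable_bound)
  note [measurable] = assms[THEN square_integrable_measurable]
  show "integrable M (\<lambda>w. (norm (f w))\<^sup>2 + (norm (g w))\<^sup>2)"
    using assms[THEN square_integrable_integrable] by simp
  show "(\<lambda>w. f w * kconj (g w)) \<in> borel_measurable M" by measurable
  have "norm x * norm y \<le> (norm x)\<^sup>2 + (norm y)\<^sup>2" for x y :: 'b
    using zero_le_power2[of "norm x - norm y"] zero_le_power2[of "norm x"] zero_le_power2[of "norm y"]
    unfolding power2_diff by linarith
  then show "AE w in M. norm (f w * kconj (g w)) \<le> norm ((norm (f w))\<^sup>2 + (norm (g w))\<^sup>2)"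
    by (simp add: norm_mult)
qed

lemma integral_mult_kconj_le:
  assumes f: "f \<in> square_integrable M" and g: "g \<in> square_integrable M"
  shows "(norm (\<integral>w. f w * kconj (g w) \<partial>M))\<^sup>2 \<le> (\<integral>w. (norm (f w))\<^sup>2 \<partial>M) * (\<integral>w. (norm (g w))\<^sup>2 \<partial>M)"
proof -
  note [measurable] = f[THEN square_integrable_measurable] g[THEN square_integrable_measurable]
  define p where "p = (\<integral>w. norm (f w) * norm (g w) \<partial>M)"
  define a where "a = (\<integral>w. (norm (f w))\<^sup>2 \<partial>M)"
  define b where "b = (\<integral>w. (norm (g w))\<^sup>2 \<partial>M)"
  have int: "integrable M (\<lambda>w. norm (f w) * norm (g w))"
    using integrable_norm[OF integrable_square_integrable_mult[OF f g]] by (simp add: norm_mult)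
  have p0: "0 \<le> p" unfolding p_def by simp
  have "norm (\<integral>w. f w * kconj (g w) \<partial>M) \<le> p"
    unfolding p_def using integral_norm_bound[of M "\<lambda>w. f w * kconj (g w)"] by (simp add: norm_mult)
  then have 1: "(norm (\<integral>w. f w * kconj (g w) \<partial>M))\<^sup>2 \<le> p\<^sup>2" by (intro power_mono) auto
  have "p\<^sup>2 \<le> a * b"
  proof (cases "a = 0")
    case True
    have "AE w in M. (norm (f w))\<^sup>2 = 0"
      using True f[THEN square_integrable_integrable] unfolding a_def
      by (subst (asm) integral_nonneg_eq_0_iff_AE) auto
    then have "p = (\<integral>w. 0 \<partial>M)" unfolding p_def by (intro integral_cong_AE) auto
    then show ?thesis using True by simp
  next
    case False
    have a0: "0 < a" using False unfolding a_def by (simp add: less_le)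
    \<comment> \<open>The minimiser of the nonnegative quadratic
      \<open>s^2 * a - 2 * s * p + b\<close>, whose value there is
      \<open>b - p^2 / a\<close>.\<close>
    define s where "s = p / a"
    have "0 \<le> (\<integral>w. (s * norm (f w) - norm (g w))\<^sup>2 \<partial>M)" by simp
    also have "(\<integral>w. (s * norm (f w) - norm (g w))\<^sup>2 \<partial>M)
        = (\<integral>w. s\<^sup>2 * (norm (f w))\<^sup>2 - 2 * s * (norm (f w) * norm (g w)) + (norm (g w))\<^sup>2 \<partial>M)"
      by (intro Bochner_Integration.integral_cong) (auto simp: power2_diff power_mult_distrib)
    also have "\<dots> = s\<^sup>2 * a - 2 * s * p + b"
      using int f[THEN square_integrable_integrable] g[THEN square_integrable_integrable]
      by (simp add: a_def b_def p_def)
    also have "\<dots> = b - p\<^sup>2 / a" using a0 by (simp add: s_def power2_eq_square field_simps)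
    finally have "p\<^sup>2 / a \<le> b" by simp
    then show ?thesis using a0 by (simp add: field_simps)
  qed
  with 1 show ?thesis unfolding a_def b_def by simp
qed

lemma tendsto_integral_mult_kconj:
  assumes f: "\<And>n. f n \<in> square_integrable M" "f' \<in> square_integrable M" and g: "g \<in> square_integrable M"
    and lim: "(\<lambda>n. \<integral>w. (norm (f n w - f' w))\<^sup>2 \<partial>M) \<longlonglongrightarrow> 0"
  shows "(\<lambda>n. \<integral>w. f n w * kconj (g w) \<partial>M) \<longlonglongrightarrow> (\<integral>w. f' w * kconj (g w) \<partial>M)"
    "(\<lambda>n. \<integral>w. g w * kconj (f n w) \<partial>M) \<longlonglongrightarrow> (\<integral>w. g w * kconj (f' w) \<partial>M)"
proof -
  have sq: "z \<longlonglongrightarrow> l" if "(\<lambda>n. (norm (z n - l))\<^sup>2) \<longlonglongrightarrow> 0" for z :: "nat \<Rightarrow> 'b" and l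
  proof -
    have "(\<lambda>n. norm (z n - l)) \<longlonglongrightarrow> 0" using tendsto_real_sqrt[OF that] by simp
    then have "(\<lambda>n. z n - l) \<longlonglongrightarrow> 0" by (rule tendsto_norm_zero_cancel)
    then show ?thesis by (rule LIM_zero_cancel)
  qed
  have d: "(\<lambda>w. f n w - f' w) \<in> square_integrable M" for n by (intro square_integrable_diff f)
  show "(\<lambda>n. \<integral>w. f n w * kconj (g w) \<partial>M) \<longlonglongrightarrow> (\<integral>w. f' w * kconj (g w) \<partial>M)"
  proof (rule sq, rule tendsto_sandwich[OF _ _ tendsto_const])
    show "(\<lambda>n. (\<integral>w. (norm (f n w - f' w))\<^sup>2 \<partial>M) * (\<integral>w. (norm (g w))\<^sup>2 \<partial>M)) \<longlonglongrightarrow> 0"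
      using tendsto_mult_right[OF lim] by simp
    have "(\<integral>w. f n w * kconj (g w) \<partial>M) - (\<integral>w. f' w * kconj (g w) \<partial>M) = (\<integral>w. (f n w - f' w) * kconj (g w) \<partial>M)" for n
      unfolding left_diff_distrib by (intro Bochner_Integration.integral_diff[symmetric] integrable_square_integrable_mult f g)
    then show "\<forall>\<^sub>F n in sequentially. (norm ((\<integral>w. f n w * kconj (g w) \<partial>M) - (\<integral>w. f' w * kconj (g w) \<partial>M)))\<^sup>2
        \<le> (\<integral>w. (norm (f n w - f' w))\<^sup>2 \<partial>M) * (\<integral>w. (norm (g w))\<^sup>2 \<partial>M)"
      using integral_mult_kconj_le[OF d g] by simp
  qed auto
  show "(\<lambda>n. \<integral>w. g w * kconj (f n w) \<partial>M) \<longlonglongrightarrow> (\<integral>w. g w * kconj (f' w) \<partial>M)"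
  proof (rule sq, rule tendsto_sandwich[OF _ _ tendsto_const])
    show "(\<lambda>n. (\<integral>w. (norm (g w))\<^sup>2 \<partial>M) * (\<integral>w. (norm (f n w - f' w))\<^sup>2 \<partial>M)) \<longlonglongrightarrow> 0"
      using tendsto_mult_left[OF lim] by simp
    have "(\<integral>w. g w * kconj (f n w) \<partial>M) - (\<integral>w. g w * kconj (f' w) \<partial>M) = (\<integral>w. g w * kconj (f n w - f' w) \<partial>M)" for n
      unfolding kconj_diff right_diff_distrib by (intro Bochner_Integration.integral_diff[symmetric] integrable_square_integrable_mult f g)
    then show "\<forall>\<^sub>F n in sequentially. (norm ((\<integral>w. g w * kconj (f n w) \<partial>M) - (\<integral>w. g w * kconj (f' w) \<partial>M)))\<^sup>2
        \<le> (\<integral>w. (norm (g w))\<^sup>2 \<partial>M) * (\<integral>w. (norm (f n w - f' w))\<^sup>2 \<partial>M)"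
      using integral_mult_kconj_le[OF g d] by simp
  qed auto
qed

lemma square_integrable_dominated_convergence:
  assumes f: "\<And>n. f n \<in> borel_measurable M" and f': "f' \<in> borel_measurable M" and u: "integrable M (\<lambda>w. (u w)\<^sup>2)"
    and bound: "\<And>n w. w \<in> space M \<Longrightarrow> norm (f n w) \<le> u w" 
    and lim: "\<And>w. w \<in> space M \<Longrightarrow> (\<lambda>n. f n w) \<longlonglongrightarrow> f' w"
  shows "f' \<in> square_integrable M" "(\<lambda>n. \<integral>w. (norm (f' w - f n w))\<^sup>2 \<partial>M) \<longlonglongrightarrow> 0"
proof -
  note [measurable] = f f'
  have b': "norm (f' w) \<le> u w" if "w \<in> space M" for w
    using LIMSEQ_le_const2[OF tendsto_norm[OF lim[OF that]]] bound[OF that] by blast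
  show "f' \<in> square_integrable M"
    by (rule square_integrable_bound[OF u]) (auto intro!: power_mono b')
  have "(\<lambda>n. \<integral>w. (norm (f' w - f n w))\<^sup>2 \<partial>M) \<longlonglongrightarrow> (\<integral>w. 0 \<partial>M)"
  proof (rule integral_dominated_convergence[where w = "\<lambda>w. 4 * (u w)\<^sup>2"])
    show "AE w in M. (\<lambda>n. (norm (f' w - f n w))\<^sup>2) \<longlonglongrightarrow> 0"
    proof (rule AE_I2)
      fix w assume "w \<in> space M"
      then have "(\<lambda>n. (norm (f' w - f n w))\<^sup>2) \<longlonglongrightarrow> (norm (f' w - f' w))\<^sup>2" by (intro tendsto_intros lim)
      then show "(\<lambda>n. (norm (f' w - f n w))\<^sup>2) \<longlonglongrightarrow> 0" by simp
    qed
    have "(norm (f' w - f n w))\<^sup>2 \<le> 4 * (u w)\<^sup>2" if "w \<in> space M" for w n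
    proof -
      have "norm (f' w - f n w) \<le> 2 * u w" using norm_triangle_ineq4[of "f' w" "f n w"] b'[OF that] bound[OF that, of n] by linarith
      then have "(norm (f' w - f n w))\<^sup>2 \<le> (2 * u w)\<^sup>2" by (intro power_mono) auto
      then show ?thesis by (simp add: power_mult_distrib)
    qed
    then show "AE w in M. norm ((norm (f' w - f n w))\<^sup>2) \<le> 4 * (u w)\<^sup>2" for n by auto
  qed (use u in auto)
  then show "(\<lambda>n. \<integral>w. (norm (f' w - f n w))\<^sup>2 \<partial>M) \<longlonglongrightarrow> 0" by simp
qed

text \<open>A rapidly convergent subsequence converges almost everywhere, and Fatou's lemma along it
  bounds the mean square distance of the full sequence to that limit.\<close>

theorem riesz_fischer:
  fixes f :: "nat \<Rightarrow> 'w \<Rightarrow> 'k::real_or_complex"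
  assumes f: "\<And>n. f n \<in> square_integrable M"
    and cauchy: "\<And>e. e > 0 \<Longrightarrow> \<exists>N. \<forall>m\<ge>N. \<forall>n\<ge>N. (\<integral>w. (norm (f m w - f n w))\<^sup>2 \<partial>M) < e"
  shows "\<exists>g\<in>square_integrable M. (\<lambda>n. \<integral>w. (norm (f n w - g w))\<^sup>2 \<partial>M) \<longlonglongrightarrow> 0"
proof -
  have [measurable]: "f n \<in> borel_measurable M" for n using f square_integrable_measurable by blast
  have int: "integrable M (\<lambda>w. (norm (f m w - f n w))\<^sup>2)" for m n
    by (intro square_integrable_integrable square_integrable_diff f)
  have "\<exists>N. \<forall>m\<ge>N. \<forall>n\<ge>N. (\<integral>w. (norm (f m w - f n w))\<^sup>2 \<partial>M) < (1/4) ^ k" for k :: nat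
    by (rule cauchy) simp
  then obtain N where N: "\<And>k m n. m \<ge> N k \<Longrightarrow> n \<ge> N k \<Longrightarrow> (\<integral>w. (norm (f m w - f n w))\<^sup>2 \<partial>M) < (1/4) ^ k" by metis
  \<comment> \<open>Adding partial sums of \<open>N\<close> to \<open>k\<close> makes
    \<open>r\<close> strictly increasing and at least \<open>N k\<close>.\<close>
  define r where "r k = k + (\<Sum>i\<le>k. N i)" for k
  have rN: "N k \<le> r k" for k
    unfolding r_def using member_le_sum[of k "{..k}" N] by simp
  have r_mono: "r k < r (Suc k)" for k by (simp add: r_def)
  then have r: "strict_mono r" by (simp add: strict_mono_Suc_iff)
  define d where "d k w = f (r (Suc k)) w - f (r k) w" for k w
  have [measurable]: "d k \<in> borel_measurable M" for k unfolding d_def by measurable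
  have d_int: "(\<integral>w. (norm (d k w))\<^sup>2 \<partial>M) \<le> (1/4) ^ k" for k
    unfolding d_def using N[of k "r (Suc k)" "r k"] rN[of k] r_mono[of k] by simp
  \<comment> \<open>The weight \<open>2 ^ k\<close> is affordable, as the integrals are at most
    \<open>(1/4) ^ k\<close>, and it turns control of squares into summable norms through
    \<open>x \<le> t * x^2 + 1 / t\<close> with \<open>t = 2 ^ k\<close>.\<close>
  have "(\<integral>\<^sup>+w. (\<Sum>k. ennreal (2 ^ k * (norm (d k w))\<^sup>2)) \<partial>M) = (\<Sum>k. \<integral>\<^sup>+w. ennreal (2 ^ k * (norm (d k w))\<^sup>2) \<partial>M)"
    by (rule nn_integral_suminf) simp
  also have "\<dots> \<le> (\<Sum>k. ennreal ((1/2) ^ k))"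
  proof (rule suminf_le)
    fix k :: nat
    have "(\<integral>\<^sup>+w. ennreal (2 ^ k * (norm (d k w))\<^sup>2) \<partial>M) = ennreal (\<integral>w. 2 ^ k * (norm (d k w))\<^sup>2 \<partial>M)"
      using int by (intro nn_integral_eq_integral) (auto simp: d_def)
    also have "\<dots> \<le> ennreal ((1/2) ^ k)"
    proof (rule ennreal_leI)
      have "2 ^ k * (\<integral>w. (norm (d k w))\<^sup>2 \<partial>M) \<le> 2 ^ k * (1/4) ^ k" by (intro mult_left_mono d_int) simp
      also have "\<dots> = (1/2) ^ k" by (simp flip: power_mult_distrib)
      finally show "(\<integral>w. 2 ^ k * (norm (d k w))\<^sup>2 \<partial>M) \<le> (1/2) ^ k" by simp
    qed
    finally show "(\<integral>\<^sup>+w. ennreal (2 ^ k * (norm (d k w))\<^sup>2) \<partial>M) \<le> ennreal ((1/2) ^ k)" .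
  qed auto
  also have "\<dots> < \<infinity>" by (subst suminf_ennreal2) (auto simp: summable_geometric)
  finally have "AE w in M. (\<Sum>k. ennreal (2 ^ k * (norm (d k w))\<^sup>2)) \<noteq> \<infinity>"
    by (intro nn_integral_PInf_AE) auto
  then have conv: "AE w in M. convergent (\<lambda>k. f (r k) w)"
  proof eventually_elim
    fix w assume "(\<Sum>k. ennreal (2 ^ k * (norm (d k w))\<^sup>2)) \<noteq> \<infinity>"
    then have "summable (\<lambda>k. 2 ^ k * (norm (d k w))\<^sup>2)"
      by (intro summable_suminf_not_top) auto
    then have "summable (\<lambda>k. 2 ^ k * (norm (d k w))\<^sup>2 + (1/2) ^ k)"
      by (intro summable_add) (auto simp: summable_geometric)
    then have "summable (\<lambda>k. norm (d k w))"
    proof (rule summable_comparison_test'[where N = 0])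
      fix k
      have "x \<le> t * x\<^sup>2 + 1 / t" if "t > 0" for x t :: real
      proof -
        have "0 \<le> (t * x - 1/2)\<^sup>2" by simp
        then have "t * x \<le> (t * x)\<^sup>2 + 1" by (simp add: power2_diff power_divide)
        then have "x * t \<le> (t * x\<^sup>2) * t + 1" by (simp add: power2_eq_square mult_ac)
        also have "\<dots> = (t * x\<^sup>2 + 1 / t) * t" using that by (simp add: field_simps)
        finally show ?thesis using that by (rule mult_right_le_imp_le)
      qed
      from this[of "2 ^ k" "norm (d k w)"]
      show "norm (norm (d k w)) \<le> 2 ^ k * (norm (d k w))\<^sup>2 + (1/2) ^ k" by (simp add: power_one_over)
    qed
    then have "summable (\<lambda>k. d k w)" by (rule summable_norm_cancel)
    then have "convergent (\<lambda>n. \<Sum>k<n. d k w)" by (simp add: summable_iff_convergent)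
    then have "convergent (\<lambda>n. (\<Sum>k<n. d k w) + f (r 0) w)" by (intro convergent_add convergent_const)
    moreover have "(\<Sum>k<n. d k w) = f (r n) w - f (r 0) w" for n
      unfolding d_def by (rule sum_lessThan_telescope)
    ultimately show "convergent (\<lambda>k. f (r k) w)" by simp
  qed
  define g where "g w = lim (\<lambda>k. f (r k) w)" for w
  have [measurable]: "g \<in> borel_measurable M" unfolding g_def by (rule borel_measurable_lim_metric) simp
  have fatou: "(\<integral>\<^sup>+w. ennreal ((norm (f n w - g w))\<^sup>2) \<partial>M) \<le> ennreal e"
    if "\<And>m. m \<ge> n \<Longrightarrow> (\<integral>w. (norm (f n w - f m w))\<^sup>2 \<partial>M) \<le> e" for n e
  proof -
    have "AE w in M. ennreal ((norm (f n w - g w))\<^sup>2) = liminf (\<lambda>k. ennreal ((norm (f n w - f (r k) w))\<^sup>2))"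
      using conv
    proof eventually_elim
      fix w assume "convergent (\<lambda>k. f (r k) w)"
      then have "(\<lambda>k. f (r k) w) \<longlonglongrightarrow> g w" unfolding g_def by (simp add: convergent_LIMSEQ_iff)
      then have "(\<lambda>k. ennreal ((norm (f n w - f (r k) w))\<^sup>2)) \<longlonglongrightarrow> ennreal ((norm (f n w - g w))\<^sup>2)"
        by (intro tendsto_intros)
      then show "ennreal ((norm (f n w - g w))\<^sup>2) = liminf (\<lambda>k. ennreal ((norm (f n w - f (r k) w))\<^sup>2))"
        by (intro lim_imp_Liminf[symmetric]) auto
    qed
    then have "(\<integral>\<^sup>+w. ennreal ((norm (f n w - g w))\<^sup>2) \<partial>M) = (\<integral>\<^sup>+w. liminf (\<lambda>k. ennreal ((norm (f n w - f (r k) w))\<^sup>2)) \<partial>M)"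
      by (rule nn_integral_cong_AE)
    also have "\<dots> \<le> liminf (\<lambda>k. \<integral>\<^sup>+w. ennreal ((norm (f n w - f (r k) w))\<^sup>2) \<partial>M)"
      by (rule nn_integral_liminf) simp
    also have "\<dots> \<le> limsup (\<lambda>k. \<integral>\<^sup>+w. ennreal ((norm (f n w - f (r k) w))\<^sup>2) \<partial>M)"
      by (rule Liminf_le_Limsup) simp
    also have "\<dots> \<le> ennreal e"
    proof (rule Limsup_bounded)
      have "\<forall>\<^sub>F k in sequentially. n \<le> r k"
        using filterlim_subseq[OF r] by (simp add: filterlim_at_top)
      then show "\<forall>\<^sub>F k in sequentially. (\<integral>\<^sup>+w. ennreal ((norm (f n w - f (r k) w))\<^sup>2) \<partial>M) \<le> ennreal e"
      proof eventually_elim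
        fix k assume "n \<le> r k"
        then show "(\<integral>\<^sup>+w. ennreal ((norm (f n w - f (r k) w))\<^sup>2) \<partial>M) \<le> ennreal e"
          using int[of n "r k"] that by (subst nn_integral_eq_integral) (auto intro: ennreal_leI)
      qed
    qed
    finally show ?thesis .
  qed
  have diff: "(\<lambda>w. f n w - g w) \<in> square_integrable M \<and> (\<integral>w. (norm (f n w - g w))\<^sup>2 \<partial>M) \<le> e"
    if "\<And>m. m \<ge> n \<Longrightarrow> (\<integral>w. (norm (f n w - f m w))\<^sup>2 \<partial>M) \<le> e" "0 \<le> e" for n e
  proof -
    have nn: "(\<integral>\<^sup>+w. ennreal ((norm (f n w - g w))\<^sup>2) \<partial>M) \<le> ennreal e" by (rule fatou[OF that(1)])
    then have i: "integrable M (\<lambda>w. (norm (f n w - g w))\<^sup>2)"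
      by (intro integrableI_bounded) (auto simp: le_less_trans)
    then have "ennreal (\<integral>w. (norm (f n w - g w))\<^sup>2 \<partial>M) \<le> ennreal e"
      using nn by (subst (asm) nn_integral_eq_integral) auto
    then show ?thesis using i that(2) by (simp add: square_integrable_def)
  qed
  obtain N0 where N0: "\<And>m n. m \<ge> N0 \<Longrightarrow> n \<ge> N0 \<Longrightarrow> (\<integral>w. (norm (f m w - f n w))\<^sup>2 \<partial>M) < 1"
    using cauchy[of 1] by auto
  have "(\<lambda>w. f N0 w - g w) \<in> square_integrable M"
    using diff[of N0 1] N0 by (simp add: less_imp_le)
  from square_integrable_diff[OF f this, of N0] have g: "g \<in> square_integrable M" by simp
  moreover have "(\<lambda>n. \<integral>w. (norm (f n w - g w))\<^sup>2 \<partial>M) \<longlonglongrightarrow> 0"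
  proof (rule LIMSEQ_I)
    fix e :: real assume e: "0 < e"
    then obtain N where N: "\<And>m n. m \<ge> N \<Longrightarrow> n \<ge> N \<Longrightarrow> (\<integral>w. (norm (f m w - f n w))\<^sup>2 \<partial>M) < e / 2"
      using cauchy[of "e / 2"] by auto
    have "(\<integral>w. (norm (f n w - g w))\<^sup>2 \<partial>M) \<le> e / 2" if "n \<ge> N" for n
      using diff[of n "e / 2"] N that e by (simp add: less_imp_le)
    then have "norm ((\<integral>w. (norm (f n w - g w))\<^sup>2 \<partial>M) - 0) < e" if "n \<ge> N" for n
      using e that by (simp add: le_less_trans[of _ "e / 2"])
    then show "\<exists>N. \<forall>n\<ge>N. norm ((\<integral>w. (norm (f n w - g w))\<^sup>2 \<partial>M) - 0) < e" by blast
  qed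
  ultimately show ?thesis by blast
qed

section \<open>Extending a densely defined isometry\<close>

text \<open>A relation in place of a map: one vector may come with functions that differ on a null
  set, and single-valuedness is only a consequence of \<open>W_inner\<close>. Density on both sides
  makes the closure total and onto.\<close>

locale isometric_relation = hilbert_space smul ip
  for smul :: "'k::real_or_complex \<Rightarrow> 'h::banach \<Rightarrow> 'h" and ip :: "'h \<Rightarrow> 'h \<Rightarrow> 'k" +
  fixes M :: "'w measure" and W :: "('w \<Rightarrow> 'k) \<Rightarrow> 'h \<Rightarrow> bool"
  assumes W_square_integrable: "W f h \<Longrightarrow> f \<in> square_integrable M"
    and W_diff: "W f h \<Longrightarrow> W g k \<Longrightarrow> W (\<lambda>w. f w - g w) (h - k)"
    and W_inner: "W f h \<Longrightarrow> W g k \<Longrightarrow> ip h k = (\<integral>w. f w * kconj (g w) \<partial>M)"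
    and W_dense_dom: "f \<in> square_integrable M \<Longrightarrow> 0 < e \<Longrightarrow> \<exists>g h. W g h \<and> (\<integral>w. (norm (f w - g w))\<^sup>2 \<partial>M) < e"
    and W_dense_ran: "0 < e \<Longrightarrow> \<exists>g k. W g k \<and> norm (h - k) < e"
begin

text \<open>The closure of \<open>W\<close>, described by duality: \<open>f\<close> is the image of \<open>h\<close>.\<close>
definition represents :: "('w \<Rightarrow> 'k) \<Rightarrow> 'h \<Rightarrow> bool" where
  "represents f h \<longleftrightarrow> f \<in> square_integrable M \<and> (\<forall>g k. W g k \<longrightarrow> ip h k = (\<integral>w. f w * kconj (g w) \<partial>M))"

lemma represents_add: "represents f h \<Longrightarrow> represents g k \<Longrightarrow> represents (\<lambda>w. f w + g w) (h + k)"
  by (auto simp: represents_def square_integrable_add ip_add_left distrib_right W_square_integrable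
      integrable_square_integrable_mult)

lemma represents_smul: "represents f h \<Longrightarrow> represents (\<lambda>w. c * f w) (smul c h)"
  by (auto simp: represents_def square_integrable_mult ip_smul_left mult.assoc)

lemma represents_AE:
  assumes "represents f h" "g \<in> square_integrable M" "AE w in M. g w = f w"
  shows "represents g h"
proof -
  have f: "f \<in> square_integrable M" using assms(1) by (simp add: represents_def)
  note [measurable] = square_integrable_measurable[OF f] square_integrable_measurable[OF assms(2)]
  have "(\<integral>w. f w * kconj (u w) \<partial>M) = (\<integral>w. g w * kconj (u w) \<partial>M)" if "W u k" for u k
  proof -
    note [measurable] = square_integrable_measurable[OF W_square_integrable[OF that]]
    show ?thesis using assms(3) by (intro integral_cong_AE) auto
  qed
  then show ?thesis using assms by (simp add: represents_def)
qed

lemma W_dist: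
  assumes "W f h" "W g k"
  shows "(norm (h - k))\<^sup>2 = (\<integral>w. (norm (f w - g w))\<^sup>2 \<partial>M)"
proof -
  note d = W_diff[OF assms]
  have "(of_real ((norm (h - k))\<^sup>2) :: 'k) = (\<integral>w. of_real ((norm (f w - g w))\<^sup>2) \<partial>M)"
    unfolding ip_self[symmetric] W_inner[OF d d] mult_kconj ..
  also have "\<dots> = of_real (\<integral>w. (norm (f w - g w))\<^sup>2 \<partial>M)"
    by (intro integral_of_real square_integrable_integrable W_square_integrable[OF d])
  finally show ?thesis by (simp only: of_real_eq_iff)
qed

lemma W_sequence_ran: "\<exists>f k. (\<forall>n. W (f n) (k n)) \<and> k \<longlonglongrightarrow> h"
proof -
  have "\<exists>g k. W g k \<and> norm (h - k) < inverse (real (Suc n))" for n by (rule W_dense_ran) simp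
  then obtain f k where *: "\<And>n. W (f n) (k n)" "\<And>n. norm (h - k n) < inverse (real (Suc n))" by metis
  have "(\<lambda>n. k n - h) \<longlonglongrightarrow> 0"
    by (rule Lim_null_comparison[OF always_eventually LIMSEQ_inverse_real_of_nat])
       (use *(2) in \<open>simp add: norm_minus_commute less_imp_le del: of_nat_Suc\<close>)
  then have "k \<longlonglongrightarrow> h" by (rule LIM_zero_cancel)
  with *(1) show ?thesis by blast
qed

lemma W_sequence_dom:
  assumes "f \<in> square_integrable M"
  shows "\<exists>g k. (\<forall>n. W (g n) (k n)) \<and> (\<lambda>n. \<integral>w. (norm (g n w - f w))\<^sup>2 \<partial>M) \<longlonglongrightarrow> 0"
proof -
  have "\<exists>g k. W g k \<and> (\<integral>w. (norm (f w - g w))\<^sup>2 \<partial>M) < inverse (real (Suc n))" for n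
    by (rule W_dense_dom[OF assms]) simp
  then obtain g k where *: "\<And>n. W (g n) (k n)" "\<And>n. (\<integral>w. (norm (f w - g n w))\<^sup>2 \<partial>M) < inverse (real (Suc n))" by metis
  have "(\<lambda>n. \<integral>w. (norm (g n w - f w))\<^sup>2 \<partial>M) \<longlonglongrightarrow> 0"
    by (rule Lim_null_comparison[OF always_eventually LIMSEQ_inverse_real_of_nat])
       (use *(2) in \<open>simp add: norm_minus_commute less_imp_le del: of_nat_Suc\<close>)
  with *(1) show ?thesis by blast
qed

lemma represents_limit:
  assumes W: "\<And>n. W (f n) (k n)" and k: "k \<longlonglongrightarrow> h" and g: "g \<in> square_integrable M"
    and lim: "(\<lambda>n. \<integral>w. (norm (f n w - g w))\<^sup>2 \<partial>M) \<longlonglongrightarrow> 0"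
  shows "represents g h"
  unfolding represents_def
proof (intro conjI g allI impI)
  fix u l assume u: "W u l"
  have "(\<lambda>n. ip (k n) l) \<longlonglongrightarrow> ip h l" by (rule tendsto_ip_left[OF k])
  moreover have "(\<lambda>n. ip (k n) l) \<longlonglongrightarrow> (\<integral>w. g w * kconj (u w) \<partial>M)"
    unfolding W_inner[OF W u] by (intro tendsto_integral_mult_kconj W_square_integrable[OF W] g W_square_integrable[OF u] lim)
  ultimately show "ip h l = (\<integral>w. g w * kconj (u w) \<partial>M)" by (rule LIMSEQ_unique)
qed

text \<open>An approximating sequence in \<open>H\<close> is Cauchy, \<open>W_dist\<close> carries
  this over to the functions, and \<open>riesz_fischer\<close> supplies their limit.\<close>

lemma represents_total: "\<exists>f. represents f h"
proof -
  obtain f k where W: "\<And>n. W (f n) (k n)" and k: "k \<longlonglongrightarrow> h"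
    using W_sequence_ran[of h] by blast
  have "\<exists>N. \<forall>m\<ge>N. \<forall>n\<ge>N. (\<integral>w. (norm (f m w - f n w))\<^sup>2 \<partial>M) < e" if "e > 0" for e
  proof -
    have "0 < sqrt e" using that by simp
    then obtain N where N: "\<forall>m\<ge>N. \<forall>n\<ge>N. norm (k m - k n) < sqrt e"
      using LIMSEQ_imp_Cauchy[OF k] CauchyD by blast
    have "(\<integral>w. (norm (f m w - f n w))\<^sup>2 \<partial>M) < e" if "m \<ge> N" "n \<ge> N" for m n
    proof -
      have "(norm (k m - k n))\<^sup>2 < (sqrt e)\<^sup>2" using N that by (intro power_strict_mono) auto
      then show ?thesis using \<open>e > 0\<close> by (simp add: W_dist[OF W W])
    qed
    then show ?thesis by blast
  qed
  with W_square_integrable[OF W] obtain g where "g \<in> square_integrable M" "(\<lambda>n. \<integral>w. (norm (f n w - g w))\<^sup>2 \<partial>M) \<longlonglongrightarrow> 0"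
    using riesz_fischer[of f M] by blast
  with represents_limit[OF W k] show ?thesis by blast
qed

text \<open>The mirror image of \<open>represents_total\<close>, by completeness of
  \<open>H\<close>. The approximating pairs are part of the conclusion because
  \<open>represents_inner\<close> passes to the limit along them.\<close>

lemma represents_surj:
  assumes f: "f \<in> square_integrable M"
  shows "\<exists>g k h. represents f h \<and> (\<forall>n. W (g n) (k n)) \<and> k \<longlonglongrightarrow> h \<and> (\<lambda>n. \<integral>w. (norm (g n w - f w))\<^sup>2 \<partial>M) \<longlonglongrightarrow> 0"
proof -
  obtain g k where W: "\<And>n. W (g n) (k n)" and lim: "(\<lambda>n. \<integral>w. (norm (g n w - f w))\<^sup>2 \<partial>M) \<longlonglongrightarrow> 0"
    using W_sequence_dom[OF f] by blast
  have "Cauchy k"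
  proof (rule CauchyI)
    fix e :: real assume e: "0 < e"
    then obtain N where N: "\<And>n. n \<ge> N \<Longrightarrow> (\<integral>w. (norm (g n w - f w))\<^sup>2 \<partial>M) < e\<^sup>2 / 4"
      using lim[THEN LIMSEQ_D, of "e\<^sup>2 / 4"] by auto
    have "norm (k m - k n) < e" if "m \<ge> N" "n \<ge> N" for m n
    proof -
      have d: "(\<lambda>w. g n w - f w) \<in> square_integrable M" for n
        by (intro square_integrable_diff W_square_integrable[OF W] f)
      have "(norm (k m - k n))\<^sup>2 = (\<integral>w. (norm (g m w - g n w))\<^sup>2 \<partial>M)" by (rule W_dist[OF W W])
      also have "\<dots> \<le> 2 * (\<integral>w. (norm (g m w - f w))\<^sup>2 \<partial>M) + 2 * (\<integral>w. (norm (g n w - f w))\<^sup>2 \<partial>M)"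
        using square_integrable_add(2)[OF d[of m] square_integrable_uminus[OF d[of n]]]
        by (simp add: norm_minus_commute)
      also have "\<dots> < e\<^sup>2" using N[OF that(1)] N[OF that(2)] by linarith
      finally show ?thesis using e by (simp add: power2_less_imp_less)
    qed
    then show "\<exists>N. \<forall>m\<ge>N. \<forall>n\<ge>N. norm (k m - k n) < e" by blast
  qed
  then obtain h where "k \<longlonglongrightarrow> h" using Cauchy_convergent convergent_def by blast
  with represents_limit[OF W this f lim] W lim show ?thesis by blast
qed

lemma represents_unique_right:
  assumes "represents f h" "represents f h'"
  shows "h = h'"
proof -
  obtain g k where W: "\<And>n. W (g n) (k n)" and k: "k \<longlonglongrightarrow> h - h'" using W_sequence_ran[of "h - h'"] by blast
  have "ip (h - h') (k n) = 0" for n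
  proof -
    have "ip h (k n) = ip h' (k n)" using assms W[of n] unfolding represents_def by metis
    then show ?thesis by (simp add: ip_diff_left)
  qed
  then have "ip (h - h') (h - h') = 0"
    using tendsto_ip_right[OF k, of "h - h'"] by (simp add: LIMSEQ_const_iff)
  then show ?thesis by (simp add: ip_eq_zero_iff)
qed

text \<open>By definition \<open>represents\<close> controls pairings with elements of
  \<open>W\<close> only; \<open>g\<close> is approximated by such elements, and the limit of their
  vectors is \<open>k\<close> by \<open>represents_unique_right\<close>.\<close>

lemma represents_inner:
  assumes f: "represents f h" and g: "represents g k"
  shows "ip h k = (\<integral>w. f w * kconj (g w) \<partial>M)"
proof -
  have gs: "g \<in> square_integrable M" and fs: "f \<in> square_integrable M"
    using f g by (simp_all add: represents_def)
  obtain u l k' where k': "represents g k'" and W: "\<And>n. W (u n) (l n)" and l: "l \<longlonglongrightarrow> k'"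
    and lim: "(\<lambda>n. \<integral>w. (norm (u n w - g w))\<^sup>2 \<partial>M) \<longlonglongrightarrow> 0"
    using represents_surj[OF gs] by blast
  have "k' = k" by (rule represents_unique_right[OF k' g])
  with l have "(\<lambda>n. ip h (l n)) \<longlonglongrightarrow> ip h k" by (simp add: tendsto_ip_right)
  moreover have "ip h (l n) = (\<integral>w. f w * kconj (u n w) \<partial>M)" for n
    using f W by (simp add: represents_def)
  moreover have "(\<lambda>n. \<integral>w. f w * kconj (u n w) \<partial>M) \<longlonglongrightarrow> (\<integral>w. f w * kconj (g w) \<partial>M)"
    by (intro tendsto_integral_mult_kconj W_square_integrable[OF W] gs fs lim)
  ultimately show ?thesis using LIMSEQ_unique by simp
qed

lemma represents_unique_left:
  assumes "represents f h" "represents g h"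
  shows "AE w in M. f w = g w"
proof -
  have "represents (\<lambda>w. f w - g w) 0"
    using represents_add[OF assms(1) represents_smul[OF assms(2), of "- 1"]] by (simp add: smul_minus_one)
  note d = this
  have ds: "(\<lambda>w. f w - g w) \<in> square_integrable M" using d by (simp add: represents_def)
  have "(\<integral>w. of_real ((norm (f w - g w))\<^sup>2) \<partial>M) = (0 :: 'k)"
    using represents_inner[OF d d] unfolding mult_kconj by simp
  then have "of_real (\<integral>w. (norm (f w - g w))\<^sup>2 \<partial>M) = (0 :: 'k)"
    by (subst integral_of_real[OF square_integrable_integrable[OF ds], symmetric])
  then have "AE w in M. (norm (f w - g w))\<^sup>2 = 0"
    using square_integrable_integrable[OF ds] by (subst integral_nonneg_eq_0_iff_AE[symmetric]) auto
  then show ?thesis by eventually_elim simp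
qed

theorem unitary_extension:
  "\<exists>U. unitary_to_L2 smul ip M U \<and> (\<forall>f\<in>square_integrable M. \<forall>h. U h = L2_class M f \<longleftrightarrow> represents f h)"
proof -
  obtain \<phi> where \<phi>: "\<And>h. represents (\<phi> h) h" using represents_total by metis
  then have \<phi>s: "\<phi> h \<in> square_integrable M" for h by (simp add: represents_def)
  define U where "U h = L2_class M (\<phi> h)" for h
  have eq: "U h = L2_class M f \<longleftrightarrow> represents f h" if f: "f \<in> square_integrable M" for f :: "'w \<Rightarrow> 'k" and h
  proof
    assume "U h = L2_class M f"
    moreover have "f \<in> L2_class M f" using f by (simp add: L2_class_def)
    ultimately have "f \<in> L2_class M (\<phi> h)" by (simp add: U_def)
    then have "AE w in M. f w = \<phi> h w" by (simp add: L2_class_def)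
    then show "represents f h" by (rule represents_AE[OF \<phi> f])
  next
    assume "represents f h"
    then show "U h = L2_class M f" unfolding U_def by (intro L2_class_cong represents_unique_left[OF \<phi>])
  qed
  have "unitary_to_L2 smul ip M U"
    unfolding unitary_to_L2_def
  proof (intro conjI allI)
    show "bij_betw U UNIV (L2 M)"
      unfolding bij_betw_def
    proof
      show "inj U"
      proof (rule injI)
        fix h k assume "U h = U k"
        then have "represents (\<phi> k) h" using eq[OF \<phi>s, of h k] by (simp add: U_def)
        then show "h = k" using \<phi>[of k] by (rule represents_unique_right)
      qed
      show "range U = L2 M"
      proof
        show "range U \<subseteq> L2 M" using \<phi>s by (auto simp: U_def L2_def)
        show "L2 M \<subseteq> range U"
        proof
          fix x :: "('w \<Rightarrow> 'k) set" assume "x \<in> L2 M"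
          then obtain f where f: "f \<in> square_integrable M" "x = L2_class M f" by (auto simp: L2_def)
          then obtain h where "represents f h" using represents_surj by metis
          then show "x \<in> range U" using eq f by (metis rangeI)
        qed
      qed
    qed
    fix x y c
    show "U (x + y) = L2_add M (U x) (U y)"
      unfolding U_def[of x] U_def[of y] L2_add_class[OF \<phi>s \<phi>s]
      by (simp add: eq square_integrable_add \<phi>s represents_add \<phi>)
    show "U (smul c x) = L2_scale M c (U x)"
      unfolding U_def[of x] L2_scale_class[OF \<phi>s]
      by (simp add: eq square_integrable_mult \<phi>s represents_smul \<phi>)
    show "L2_inner M (U x) (U y) = ip x y"
      unfolding U_def L2_inner_class[OF \<phi>s \<phi>s] by (rule represents_inner[OF \<phi> \<phi>, symmetric])
  qed
  with eq show ?thesis by blast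
qed

end

section \<open>Cyclic decomposition\<close>

context resolvent_pair begin

definition invariant :: "'h set \<Rightarrow> bool" where
  "invariant V \<longleftrightarrow> subspace V \<and> closed V \<and> B ` V \<subseteq> V \<and> C ` V \<subseteq> V"

lemma invariant_calc: "calc b c f F \<Longrightarrow> invariant V \<Longrightarrow> x \<in> V \<Longrightarrow> F x \<in> V"
  by (induction rule: calc.induct) (auto simp: invariant_def subspace_add subspace_scale)

text \<open>For invariant \<open>V\<close>, the smallest closed invariant subspace containing
  \<open>V\<close> and \<open>y\<close>.\<close>

definition adjoin :: "'h set \<Rightarrow> 'h \<Rightarrow> 'h set" where
  "adjoin V y = closure {s + F y | s F. s \<in> V \<and> (\<exists>f. calc res_b res_c f F)}"

lemma invariant_adjoin:
  assumes V: "invariant V"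
  shows "invariant (adjoin V y)" "V \<subseteq> adjoin V y" "calc res_b res_c f F \<Longrightarrow> F y \<in> adjoin V y"
proof -
  define X where "X = {s + F y | s F. s \<in> V \<and> (\<exists>f. calc res_b res_c f F)}"
  have adj: "adjoin V y = closure X" by (simp add: adjoin_def X_def)
  have XI: "s + F y \<in> X" if "s \<in> V" "calc res_b res_c f F" for s f F using that by (auto simp: X_def)
  have XE: "\<exists>s f F. s \<in> V \<and> calc res_b res_c f F \<and> v = s + F y" if "v \<in> X" for v using that by (auto simp: X_def)
  have BS: "B s \<in> V" "C s \<in> V" if "s \<in> V" for s using V that by (auto simp: invariant_def)
  have sub: "subspace V" using V by (simp add: invariant_def)
  have 0: "0 \<in> V" by (rule subspace_0[OF sub])
  have SX: "V \<subseteq> X"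
    using XI[OF _ calc.smul[OF calc.id, where k = 0]] by auto
  have subX: "subspace X"
  proof (rule subspaceI)
    show "0 \<in> X" using 0 SX by blast
  next
    fix u v assume "u \<in> X" "v \<in> X"
    then obtain s f F t g G where *: "s \<in> V" "calc res_b res_c f F" "u = s + F y" "t \<in> V" "calc res_b res_c g G" "v = t + G y"
      using XE by meson
    show "u + v \<in> X"
      using XI[OF subspace_add[OF sub *(1,4)] calc.add[OF *(2,5)]] *(3,6) by (simp add: algebra_simps)
  next
    fix k u assume "u \<in> X"
    then obtain s f F where *: "s \<in> V" "calc res_b res_c f F" "u = s + F y" using XE by meson
    show "smul k u \<in> X"
      using XI[OF subspace_scale[OF sub *(1)] calc.smul[OF *(2)]] *(3) by (simp add: scale_right_distrib)
  qed
  have "B ` X \<subseteq> X" "C ` X \<subseteq> X"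
  proof (safe)
    fix u assume "u \<in> X"
    then obtain s f F where *: "s \<in> V" "calc res_b res_c f F" "u = s + F y" using XE by meson
    show "B u \<in> X" "C u \<in> X"
      using XI[OF BS(1)[OF *(1)] calc.mult_B[OF *(2)]] XI[OF BS(2)[OF *(1)] calc.mult_C[OF *(2)]] *(3)
      by (simp_all add: B_add C_add)
  qed
  then have "B ` X \<subseteq> closure X" "C ` X \<subseteq> closure X" using closure_subset by blast+
  from image_closure_subset[OF linear_continuous_on[OF bounded_linear_B] closed_closure this(1)]
    image_closure_subset[OF linear_continuous_on[OF bounded_linear_C] closed_closure this(2)]
  have "B ` closure X \<subseteq> closure X" "C ` closure X \<subseteq> closure X" .
  then show "invariant (adjoin V y)"
    unfolding invariant_def adj by (simp add: subspace_closure[OF subX])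
  show "V \<subseteq> adjoin V y" unfolding adj using SX closure_subset by blast
  show "F y \<in> adjoin V y" if "calc res_b res_c f F"
    unfolding adj using XI[OF 0 that] closure_subset by auto
qed

text \<open>The component of \<open>z\<close> orthogonal to \<open>V\<close>; the choice is
  justified by \<open>projection_exists\<close> when \<open>V\<close> is a closed subspace.\<close>

definition remainder :: "'h set \<Rightarrow> 'h \<Rightarrow> 'h" where
  "remainder V z = (SOME r. z - r \<in> V \<and> (\<forall>s\<in>V. ip r s = 0))"

lemma remainder:
  assumes "invariant V"
  shows "z - remainder V z \<in> V" "s \<in> V \<Longrightarrow> ip (remainder V z) s = 0"
proof -
  obtain y where "y \<in> V" "\<forall>s\<in>V. ip (z - y) s = 0"
    using projection_exists[of V z] assms by (auto simp: invariant_def)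
  then have "z - (z - y) \<in> V \<and> (\<forall>s\<in>V. ip (z - y) s = 0)" by simp
  from someI[of "\<lambda>r. z - r \<in> V \<and> (\<forall>s\<in>V. ip r s = 0)", OF this]
  show "z - remainder V z \<in> V" "s \<in> V \<Longrightarrow> ip (remainder V z) s = 0"
    unfolding remainder_def by auto
qed

text \<open>Gram-Schmidt with cyclic subspaces in place of lines; \<open>d\<close> is going to be a
  dense sequence.\<close>

primrec cyclic_sum :: "(nat \<Rightarrow> 'h) \<Rightarrow> nat \<Rightarrow> 'h set" where
  "cyclic_sum d 0 = {0}"
| "cyclic_sum d (Suc n) = adjoin (cyclic_sum d n) (remainder (cyclic_sum d n) (d n))"

lemma invariant_cyclic_sum: "invariant (cyclic_sum d n)"
proof (induction n)
  case 0
  have "B 0 = 0" "C 0 = 0" using BC_diff[of 0 0] by simp_all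
  then show ?case by (simp add: invariant_def subspace_0 subspace_single_0)
qed (simp add: invariant_adjoin)

lemma cyclic_decomposition:
  assumes sep: "separable_space (euclidean :: 'h topology)"
  shows "\<exists>x :: nat \<Rightarrow> 'h.
    (\<forall>j k f F g G. j \<noteq> k \<longrightarrow> calc res_b res_c f F \<longrightarrow> calc res_b res_c g G \<longrightarrow> ip (F (x j)) (G (x k)) = 0) \<and>
    (\<forall>V. subspace V \<longrightarrow> closed V \<longrightarrow> (\<forall>k f F. calc res_b res_c f F \<longrightarrow> F (x k) \<in> V) \<longrightarrow> V = UNIV)"
proof -
  obtain X :: "'h set" where X: "countable X" "closure X = UNIV"
    using sep by (auto simp: separable_space_def)
  then have "X \<noteq> {}" by auto
  define d where "d = from_nat_into X"
  have d: "range d = X" unfolding d_def using X(1) \<open>X \<noteq> {}\<close> by (rule range_from_nat_into[rotated])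
  define V where "V = cyclic_sum d"
  \<comment> \<open>If \<open>d n\<close> already lies in \<open>V n\<close>, then
    \<open>x n = 0\<close> and the fibre over \<open>n\<close> carries no mass.\<close>
  define x where "x n = remainder (V n) (d n)" for n
  have inv: "invariant (V n)" for n unfolding V_def by (rule invariant_cyclic_sum)
  have S_Suc: "V (Suc n) = adjoin (V n) (x n)" for n by (simp add: V_def x_def)
  have mono: "V m \<subseteq> V n" if "m \<le> n" for m n
    using that by (rule lift_Suc_mono_le[rotated]) (simp add: S_Suc invariant_adjoin inv)
  have FS: "F (x n) \<in> V (Suc n)" if "calc res_b res_c f F" for f F n
    unfolding S_Suc using that by (rule invariant_adjoin(3)[OF inv])
  have orth: "ip (F (x k)) (G (x j)) = 0"
    if "j < k" and F: "calc res_b res_c f F" and G: "calc res_b res_c g G" for j k f F g G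
  proof -
    obtain f' F' where F': "calc res_b res_c f' F'" "\<And>x y. ip (F x) y = ip x (F' y)"
      using calc_adjoint[OF F] by blast
    \<comment> \<open>The generator \<open>x k\<close> is orthogonal to \<open>V k\<close>, which
      contains \<open>G (x j)\<close> and is invariant under the adjoint of
      \<open>F\<close>.\<close>
    have "G (x j) \<in> V k" using FS[OF G, of j] mono[of "Suc j" k] \<open>j < k\<close> by auto
    then have "F' (G (x j)) \<in> V k" by (rule invariant_calc[OF F'(1) inv])
    then show ?thesis unfolding F'(2) x_def by (rule remainder(2)[OF inv])
  qed
  show ?thesis
  proof (intro exI[of _ x] conjI allI impI)
    fix j k :: nat and f F g G assume "j \<noteq> k" and F: "calc res_b res_c f F" and G: "calc res_b res_c g G"
    then consider "j < k" | "k < j" by linarith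
    then show "ip (F (x j)) (G (x k)) = 0"
    proof cases
      case 1
      then show ?thesis using orth[OF _ G F] ip_commute[of "F (x j)"] by simp
    next
      case 2
      then show ?thesis using orth[OF _ F G] by simp
    qed
  next
    fix Z assume Z: "subspace Z" "closed Z" and FZ: "\<forall>k f F. calc res_b res_c f F \<longrightarrow> F (x k) \<in> Z"
    have SZ: "V n \<subseteq> Z" for n
    proof (induction n)
      case 0
      then show ?case using subspace_0[OF Z(1)] by (simp add: V_def)
    next
      case (Suc n)
      show ?case unfolding S_Suc adjoin_def
        by (rule closure_minimal[OF _ Z(2)]) (use Suc FZ subspace_add[OF Z(1)] in blast)
    qed
    have "d n \<in> Z" for n
    proof -
      have "d n - x n \<in> Z" using remainder(1)[OF inv[of n], of "d n"] SZ by (auto simp: x_def)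
      moreover have "x n \<in> Z" using FZ calc.id by blast
      ultimately show ?thesis using subspace_add[OF Z(1)] by fastforce
    qed
    then have "closure X \<subseteq> Z" using d by (intro closure_minimal Z(2)) auto
    then show "Z = UNIV" using X(2) by auto
  qed
qed

theorem normalized_cyclic_decomposition:
  assumes sep: "separable_space (euclidean :: 'h topology)" and nontrivial: "v \<noteq> (0 :: 'h)"
  shows "\<exists>x :: nat \<Rightarrow> 'h. (\<lambda>k. (norm (x k))\<^sup>2) sums 1 \<and>
    (\<forall>j k f F g G. j \<noteq> k \<longrightarrow> calc res_b res_c f F \<longrightarrow> calc res_b res_c g G \<longrightarrow> ip (F (x j)) (G (x k)) = 0) \<and>
    (\<forall>V. subspace V \<longrightarrow> closed V \<longrightarrow> (\<forall>k f F. calc res_b res_c f F \<longrightarrow> F (x k) \<in> V) \<longrightarrow> V = UNIV)"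
proof -
  obtain x :: "nat \<Rightarrow> 'h" where
    orth: "\<And>j k f F g G. j \<noteq> k \<Longrightarrow> calc res_b res_c f F \<Longrightarrow> calc res_b res_c g G \<Longrightarrow> ip (F (x j)) (G (x k)) = 0" and
    gen: "\<And>V. subspace V \<Longrightarrow> closed V \<Longrightarrow> (\<And>k f F. calc res_b res_c f F \<Longrightarrow> F (x k) \<in> V) \<Longrightarrow> V = UNIV"
    using cyclic_decomposition[OF sep] by metis
  \<comment> \<open>The damping bounds the \<open>k\<close>-th norm by \<open>(1/2) ^ k\<close>, so
    the squares are summable; the summand 1 avoids dividing by 0 for a vanishing generator.\<close>
  define t where "t k = (1/2) ^ k / (1 + norm (x k))" for k
  have t0: "0 < t k" for k by (simp add: t_def add_pos_nonneg)
  have "(norm (t k *\<^sub>R x k))\<^sup>2 \<le> (1/4) ^ k" for k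
  proof -
    have "t k * norm (x k) = (1/2) ^ k * (norm (x k) / (1 + norm (x k)))" by (simp add: t_def)
    also have "\<dots> \<le> (1/2) ^ k * 1" by (intro mult_left_mono) (simp_all add: add_pos_nonneg)
    finally have "norm (t k *\<^sub>R x k) \<le> (1/2) ^ k" using t0[of k] by simp
    then have "(norm (t k *\<^sub>R x k))\<^sup>2 \<le> ((1/2) ^ k)\<^sup>2" by (intro power_mono) auto
    also have "\<dots> = (1/4) ^ k" by (simp add: power2_eq_square flip: power_mult_distrib)
    finally show ?thesis .
  qed
  then have "norm ((norm (t k *\<^sub>R x k))\<^sup>2) \<le> (1/4) ^ k" for k
    unfolding real_norm_def abs_power2 .
  then have summable: "summable (\<lambda>k. (norm (t k *\<^sub>R x k))\<^sup>2)"
    by (rule summable_comparison_test'[OF summable_geometric, where N = 0, rotated]) simp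
  define s where "s = (\<Sum>k. (norm (t k *\<^sub>R x k))\<^sup>2)"
  have "\<exists>k. x k \<noteq> 0"
  proof (rule ccontr)
    assume "\<not> ?thesis"
    then have "F (x k) \<in> {0}" if "calc res_b res_c f F" for k f F
      using linear_0[OF bounded_linear.linear[OF calc_bounded_linear[OF that]]] by simp
    then have "{0} = (UNIV :: 'h set)" by (intro gen) (auto simp: subspace_single_0)
    with nontrivial show False by auto
  qed
  then obtain k0 where "x k0 \<noteq> 0" by blast
  then have s0: "0 < s" unfolding s_def using t0[of k0]
    by (intro suminf_pos2[OF summable, of k0]) auto
  define u where "u k = t k / sqrt s" for k
  have u0: "0 < u k" for k using t0 s0 by (simp add: u_def)
  have Fu: "F (u k *\<^sub>R x k) = u k *\<^sub>R F (x k)" if "calc res_b res_c f F" for f F k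
    using bounded_linear.linear[OF calc_bounded_linear[OF that]] by (rule linear_scale)
  show ?thesis
  proof (intro exI[of _ "\<lambda>k. u k *\<^sub>R x k"] conjI allI impI)
    have "(\<lambda>k. (norm (t k *\<^sub>R x k))\<^sup>2 / s) sums (s / s)"
      using summable unfolding s_def by (intro sums_divide summable_sums)
    moreover have "(norm (t k *\<^sub>R x k))\<^sup>2 / s = (norm (u k *\<^sub>R x k))\<^sup>2" for k
      using s0 t0[of k] by (simp add: u_def power_divide power_mult_distrib)
    ultimately show "(\<lambda>k. (norm (u k *\<^sub>R x k))\<^sup>2) sums 1" using s0 by simp
  next
    fix j k :: nat and f F g G assume "j \<noteq> k" "calc res_b res_c f F" "calc res_b res_c g G"
    then show "ip (F (u j *\<^sub>R x j)) (G (u k *\<^sub>R x k)) = 0"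
      by (simp add: Fu ip_scaleR_left ip_scaleR_right orth)
  next
    fix V assume V: "subspace V" "closed V" and FS: "\<forall>k f F. calc res_b res_c f F \<longrightarrow> F (u k *\<^sub>R x k) \<in> V"
    show "V = UNIV"
    proof (rule gen[OF V])
      fix k f F assume F: "calc res_b res_c f F"
      then have "u k *\<^sub>R F (x k) \<in> V" using FS Fu by metis
      from subspace_scaleR[OF V(1) this, of "1 / u k"] show "F (x k) \<in> V" using u0[of k] by simp
    qed
  qed
qed

end

section \<open>The multiplication model\<close>

text \<open>The disjoint union of the \<open>\<mu> k\<close>, realised on the fibres of a product.
  Countable additivity is an exchange of two series of nonnegative terms, one of them read as an
  integral over counting measure.\<close>

lemma mixture_measure:
  fixes \<mu> :: "nat \<Rightarrow> real measure"
  assumes [simp, measurable_cong]: "\<And>k. sets (\<mu> k) = sets borel"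
  shows "\<exists>M. sets M = sets (count_space UNIV \<Otimes>\<^sub>M borel) \<and>
    (\<forall>A\<in>sets M. emeasure M A = (\<Sum>k. emeasure (\<mu> k) (Pair k -` A)))"
proof -
  define N where "N = (count_space UNIV \<Otimes>\<^sub>M borel :: (nat \<times> real) measure)"
  define m where "m A = (\<Sum>k. emeasure (\<mu> k) (Pair k -` A))" for A
  define M where "M = measure_of (space N) (sets N) m"
  have sec: "Pair k -` A \<in> sets borel" if "A \<in> sets N" for k A
    using sets_Pair1[of A "count_space UNIV" borel k] that by (simp add: N_def)
  have cadd: "countably_additive (sets N) m"
  proof (rule countably_additiveI)
    fix A :: "nat \<Rightarrow> (nat \<times> real) set" assume A: "range A \<subseteq> sets N" "disjoint_family A" "(\<Union>i. A i) \<in> sets N"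
    have "(\<Sum>i. m (A i)) = (\<Sum>k. \<Sum>i. emeasure (\<mu> k) (Pair k -` A i))"
      unfolding m_def using nn_integral_suminf[of "\<lambda>i k. emeasure (\<mu> k) (Pair k -` A i)" "count_space UNIV"]
      by (simp add: nn_integral_count_space_nat)
    also have "(\<lambda>k. \<Sum>i. emeasure (\<mu> k) (Pair k -` A i)) = (\<lambda>k. emeasure (\<mu> k) (Pair k -` (\<Union>i. A i)))"
    proof
      fix k
      have "range (\<lambda>i. Pair k -` A i) \<subseteq> sets (\<mu> k)" using A(1) sec by auto
      moreover have "disjoint_family (\<lambda>i. Pair k -` A i)"
        using A(2) by (auto simp: disjoint_family_on_def)
      ultimately show "(\<Sum>i. emeasure (\<mu> k) (Pair k -` A i)) = emeasure (\<mu> k) (Pair k -` (\<Union>i. A i))"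
        by (simp add: suminf_emeasure vimage_UN)
    qed
    finally show "(\<Sum>i. m (A i)) = m (\<Union>i. A i)" by (simp add: m_def)
  qed
  have "positive (sets N) m" by (simp add: positive_def m_def)
  then have "emeasure M A = m A" if "A \<in> sets N" for A
    unfolding M_def by (rule emeasure_measure_of_sigma[OF sets.sigma_algebra_axioms _ cadd that])
  moreover have "sets M = sets N" unfolding M_def by simp
  ultimately show ?thesis by (auto simp: N_def m_def)
qed

definition lift :: "nat \<Rightarrow> (real \<Rightarrow> 'k) \<Rightarrow> nat \<times> real \<Rightarrow> 'k::real_or_complex" where
  "lift k f w = (if fst w = k then f (snd w) else 0)"

lemma lift_mult: "lift j f w * lift k g w = (if j = k then lift k (\<lambda>a. f a * g a) w else 0)"
  by (simp add: lift_def)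

lemma lift_kconj: "kconj (lift k f w) = lift k (\<lambda>a. kconj (f a)) w"
  by (simp add: lift_def)

lemma lift_measurable [measurable (raw)]:
  assumes [measurable]: "f \<in> borel_measurable borel"
  shows "lift k f \<in> borel_measurable (count_space UNIV \<Otimes>\<^sub>M borel)"
  unfolding lift_def by measurable

locale spectral_model = resolvent_pair smul ip B C
  for smul :: "'k::real_or_complex \<Rightarrow> 'h::banach \<Rightarrow> 'h" and ip :: "'h \<Rightarrow> 'h \<Rightarrow> 'k" and B C +
  fixes x :: "nat \<Rightarrow> 'h" and \<mu> :: "nat \<Rightarrow> real measure" and M :: "(nat \<times> real) measure"
  assumes x_sums: "(\<lambda>k. (norm (x k))\<^sup>2) sums 1"
    and x_orth: "j \<noteq> k \<Longrightarrow> calc res_b res_c f F \<Longrightarrow> calc res_b res_c g G \<Longrightarrow> ip (F (x j)) (G (x k)) = 0"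
    and x_gen: "subspace V \<Longrightarrow> closed V \<Longrightarrow> (\<And>k f F. calc res_b res_c f F \<Longrightarrow> F (x k) \<in> V) \<Longrightarrow> V = UNIV"
    and finite_\<mu>: "finite_measure (\<mu> k)"
    and sets_\<mu> [simp, measurable_cong]: "sets (\<mu> k) = sets borel"
    and calc_\<mu>: "calc res_b res_c f F \<Longrightarrow> ip (F (x k)) (x k) = (\<integral>a. f a \<partial>\<mu> k)"
    and sets_M [simp, measurable_cong]: "sets M = sets (count_space UNIV \<Otimes>\<^sub>M borel)"
    and emeasure_M: "A \<in> sets M \<Longrightarrow> emeasure M A = (\<Sum>k. emeasure (\<mu> k) (Pair k -` A))"
begin

lemma space_\<mu> [simp]: "space (\<mu> k) = UNIV"
  using sets_eq_imp_space_eq[OF sets_\<mu>] by simp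

lemma space_M [simp]: "space M = UNIV"
  using sets_eq_imp_space_eq[OF sets_M] by (simp add: space_pair_measure)

lemma emeasure_\<mu>_UNIV: "emeasure (\<mu> k) UNIV = ennreal ((norm (x k))\<^sup>2)"
proof -
  interpret finite_measure "\<mu> k" by (rule finite_\<mu>)
  have "(of_real ((norm (x k))\<^sup>2) :: 'k) = of_real (measure (\<mu> k) UNIV)"
    using calc_\<mu>[OF calc.id, of k] by (simp add: ip_self of_real_def del: of_real_power)
  then have "(norm (x k))\<^sup>2 = measure (\<mu> k) UNIV" by (simp only: of_real_eq_iff)
  then show ?thesis by (simp add: emeasure_eq_measure)
qed

lemma prob_space_M: "prob_space M"
proof
  have "emeasure M (space M) = (\<Sum>k. ennreal ((norm (x k))\<^sup>2))"
    using emeasure_M[OF sets.top] by (simp add: emeasure_\<mu>_UNIV)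
  also have "\<dots> = 1"
    using x_sums by (subst suminf_ennreal2) (auto simp: sums_iff)
  finally show "emeasure M (space M) = 1" .
qed

sublocale M: prob_space M by (rule prob_space_M)

lemma emeasure_M_slice:
  assumes "E \<in> sets borel"
  shows "emeasure M ({k} \<times> E) = emeasure (\<mu> k) E"
proof -
  have "{k} \<times> E \<in> sets M" using assms by auto
  then have "emeasure M ({k} \<times> E) = (\<Sum>j. emeasure (\<mu> j) (Pair j -` ({k} \<times> E)))" by (rule emeasure_M)
  also have "\<dots> = (\<Sum>j. if j = k then emeasure (\<mu> k) E else 0)"
    by (intro suminf_cong) auto
  also have "\<dots> = emeasure (\<mu> k) E"
    by (subst suminf_finite[of "{k}"]) auto
  finally show ?thesis .
qed

lemma \<mu>_eq_distr: "\<mu> k = distr (density M (\<lambda>w. ennreal (indicator ({k} \<times> UNIV) w))) borel snd"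
proof (rule measure_eqI)
  fix E assume "E \<in> sets (\<mu> k)"
  then have E [measurable]: "E \<in> sets borel" by simp
  have "emeasure (distr (density M (\<lambda>w. ennreal (indicator ({k} \<times> UNIV) w))) borel snd) E
      = emeasure (density M (\<lambda>w. ennreal (indicator ({k} \<times> UNIV) w))) (snd -` E)"
    by (subst emeasure_distr) auto
  also have "\<dots> = (\<integral>\<^sup>+w. ennreal (indicator ({k} \<times> UNIV) w) * indicator (snd -` E) w \<partial>M)"
  proof (rule emeasure_density)
    have "snd -` E \<inter> space M \<in> sets M" by measurable
    then show "snd -` E \<in> sets M" by simp
  qed measurable
  also have "\<dots> = (\<integral>\<^sup>+w. indicator ({k} \<times> E) w \<partial>M)"
    by (intro nn_integral_cong) (auto split: split_indicator)
  also have "\<dots> = emeasure (\<mu> k) E" by (simp add: emeasure_M_slice E)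
  finally show "emeasure (\<mu> k) E = emeasure (distr (density M (\<lambda>w. ennreal (indicator ({k} \<times> UNIV) w))) borel snd) E" ..
qed simp

lemma integral_lift:
  assumes [measurable]: "f \<in> borel_measurable borel"
  shows "(\<integral>w. lift k f w \<partial>M) = (\<integral>a. f a \<partial>\<mu> k :: 'k)"
proof -
  have "(\<integral>a. f a \<partial>\<mu> k) = (\<integral>w. f (snd w) \<partial>density M (\<lambda>w. ennreal (indicator ({k} \<times> UNIV) w)))"
    unfolding \<mu>_eq_distr[of k] by (subst integral_distr) auto
  also have "\<dots> = (\<integral>w. indicator ({k} \<times> UNIV) w *\<^sub>R f (snd w) \<partial>M)"
    by (subst integral_density) auto
  also have "\<dots> = (\<integral>w. lift k f w \<partial>M)"
    by (intro Bochner_Integration.integral_cong) (auto simp: lift_def)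
  finally show ?thesis ..
qed

text \<open>The inverse of the intended unitary on finite sums: the function \<open>f\<close> on
  fibre \<open>k\<close> belongs to the vector \<open>F (x k)\<close>.\<close>

inductive model :: "(nat \<times> real \<Rightarrow> 'k) \<Rightarrow> 'h \<Rightarrow> bool" where
  gen: "calc res_b res_c f F \<Longrightarrow> model (lift k f) (F (x k))"
| add: "model f h \<Longrightarrow> model g l \<Longrightarrow> model (\<lambda>w. f w + g w) (h + l)"

lemma model_smul: "model f h \<Longrightarrow> model (\<lambda>w. c * f w) (smul c h)"
proof (induction rule: model.induct)
  case (gen f F k)
  have "lift k (\<lambda>a. c * f a) = (\<lambda>w. c * lift k f w)" by (auto simp: lift_def)
  with model.gen[OF calc.smul[OF gen], of k c] show ?case by simp
next
  case (add f h g l)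
  with model.add[OF add.IH] show ?case by (simp add: distrib_left scale_right_distrib)
qed

lemma model_diff: "model f h \<Longrightarrow> model g l \<Longrightarrow> model (\<lambda>w. f w - g w) (h - l)"
  using model.add[OF _ model_smul[of g l "- 1"], of f h] by (simp add: smul_minus_one)

lemma model_square_integrable: "model f h \<Longrightarrow> f \<in> square_integrable M"
proof (induction rule: model.induct)
  case (gen f F k)
  have [measurable]: "f \<in> borel_measurable borel" by (rule calc_measurable[OF res_measurable gen])
  obtain K where K: "\<And>a. norm (f a) \<le> K" using calc_bounded[OF res_le_one gen] by blast
  then have "0 \<le> K" using norm_ge_zero order_trans by blast
  with K have "(norm (lift k f w))\<^sup>2 \<le> K\<^sup>2" for w by (auto simp: lift_def intro: power_mono)
  then show ?case by (intro square_integrable_bound[OF M.integrable_const[of "K\<^sup>2"]]) auto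
qed (rule square_integrable_add)

text \<open>On one fibre, moving \<open>G\<close> across turns the inner product into the moment of
  \<open>f * kconj g\<close>. For distinct fibres both sides vanish, by \<open>x_orth\<close> and by
  disjointness of the supports.\<close>

lemma model_inner_gen:
  assumes F: "calc res_b res_c f F"
  shows "model g l \<Longrightarrow> ip (F (x k)) l = (\<integral>w. lift k f w * kconj (g w) \<partial>M)"
proof (induction rule: model.induct)
  case (gen g G j)
  have [measurable]: "f \<in> borel_measurable borel" "g \<in> borel_measurable borel"
    by (rule calc_measurable[OF res_measurable F] calc_measurable[OF res_measurable gen])+
  show ?case
  proof (cases "k = j")
    case False
    then show ?thesis by (simp add: x_orth[OF False F gen] lift_kconj lift_mult)
  next
    case True
    obtain G' where G': "calc res_b res_c (\<lambda>a. kconj (g a)) G'" "\<And>x y. ip (G x) y = ip x (G' y)"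
      using calc_adjoint[OF gen] by blast
    have "ip (F (x k)) (G (x k)) = ip (G' (F (x k))) (x k)" by (metis G'(2) ip_commute)
    also have "\<dots> = (\<integral>a. kconj (g a) * f a \<partial>\<mu> k)" by (rule calc_\<mu>[OF calc_mult[OF G'(1) F]])
    also have "\<dots> = (\<integral>w. lift k (\<lambda>a. f a * kconj (g a)) w \<partial>M)"
      by (subst integral_lift) (auto simp: mult.commute)
    finally show ?thesis using True by (simp add: lift_kconj lift_mult)
  qed
next
  case (add g l g' l')
  note s = model_square_integrable[OF model.gen[OF F]] model_square_integrable[OF add.hyps(1)] model_square_integrable[OF add.hyps(2)]
  show ?case
    unfolding ip_add_right add.IH kconj_add distrib_left
    by (rule Bochner_Integration.integral_add[symmetric]) (intro integrable_square_integrable_mult s)+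
qed

lemma model_inner:
  assumes "model g l"
  shows "model f h \<Longrightarrow> ip h l = (\<integral>w. f w * kconj (g w) \<partial>M)"
proof (induction rule: model.induct)
  case (gen f F k)
  then show ?case by (rule model_inner_gen[OF _ assms])
next
  case (add f h f' h')
  note s = model_square_integrable[OF assms] model_square_integrable[OF add.hyps(1)] model_square_integrable[OF add.hyps(2)]
  show ?case
    unfolding ip_add_left add.IH distrib_right
    by (rule Bochner_Integration.integral_add[symmetric]) (intro integrable_square_integrable_mult s)+
qed

lemma model_BC:
  "model f h \<Longrightarrow> model (\<lambda>w. of_real (res_b (snd w)) * f w) (B h)"
  "model f h \<Longrightarrow> model (\<lambda>w. of_real (res_c (snd w)) * f w) (C h)"
proof (induction rule: model.induct)
  case (gen f F k)
  have "lift k (\<lambda>a. of_real (u a) * f a) = (\<lambda>w. of_real (u (snd w)) * lift k f w)" for u by (auto simp: lift_def)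
  with model.gen[OF calc.mult_B[OF gen]] model.gen[OF calc.mult_C[OF gen]]
  show "model (\<lambda>w. of_real (res_b (snd w)) * lift k f w) (B (F (x k)))"
    "model (\<lambda>w. of_real (res_c (snd w)) * lift k f w) (C (F (x k)))" by metis+
next
  case (add f h g l)
  then show "model (\<lambda>w. of_real (res_b (snd w)) * (f w + g w)) (B (h + l))"
    "model (\<lambda>w. of_real (res_c (snd w)) * (f w + g w)) (C (h + l))"
    by (simp_all add: distrib_left B_add C_add model.add)
qed

lemma model_dense_ran:
  assumes "0 < e"
  shows "\<exists>g l. model g l \<and> norm (h - l) < e"
proof -
  define V where "V = {l. \<exists>g. model g l}"
  have "subspace V"
  proof (rule subspaceI)
    show "0 \<in> V" using model_smul[OF model.gen[OF calc.id], of 0] by (auto simp: V_def)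
  qed (auto simp: V_def intro: model.add model_smul)
  then have "closure V = UNIV"
    by (intro x_gen subspace_closure) (auto simp: V_def intro!: closure_subset[THEN subsetD] model.gen)
  then obtain l where "l \<in> V" "dist l h < e" using assms by (metis UNIV_I closure_approachable)
  then have "norm (h - l) < e" by (simp add: dist_norm norm_minus_commute)
  with \<open>l \<in> V\<close> show ?thesis by (auto simp: V_def)
qed

section \<open>Density of the model functions among the square integrable ones\<close>

definition approx :: "(nat \<times> real \<Rightarrow> 'k) set" where
  "approx = {f \<in> square_integrable M. \<forall>e>0. \<exists>g h. model g h \<and> (\<integral>w. (norm (f w - g w))\<^sup>2 \<partial>M) < e}"

lemma approx_model: "model f h \<Longrightarrow> f \<in> approx"
  unfolding approx_def using model_square_integrable by fastforce

lemma approx_limit: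
  assumes f: "f \<in> square_integrable M" and "\<And>e. 0 < e \<Longrightarrow> \<exists>g\<in>approx. (\<integral>w. (norm (f w - g w))\<^sup>2 \<partial>M) < e"
  shows "f \<in> approx"
proof -
  have "\<exists>g h. model g h \<and> (\<integral>w. (norm (f w - g w))\<^sup>2 \<partial>M) < e" if e: "0 < e" for e
  proof -
    obtain g where g: "g \<in> approx" "(\<integral>w. (norm (f w - g w))\<^sup>2 \<partial>M) < e / 4" using assms(2)[of "e / 4"] e by auto
    obtain u h where u: "model u h" "(\<integral>w. (norm (g w - u w))\<^sup>2 \<partial>M) < e / 4"
      using g(1) e unfolding approx_def by (auto dest!: spec[of _ "e / 4"])
    have "g \<in> square_integrable M" using g(1) by (simp add: approx_def)
    then have "(\<integral>w. (norm (f w - u w))\<^sup>2 \<partial>M) \<le> 2 * (\<integral>w. (norm (f w - g w))\<^sup>2 \<partial>M) + 2 * (\<integral>w. (norm (g w - u w))\<^sup>2 \<partial>M)"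
      using square_integrable_add(2)[of "\<lambda>w. f w - g w" M "\<lambda>w. g w - u w"] f model_square_integrable[OF u(1)]
      by (simp add: square_integrable_diff)
    then show ?thesis using u g by (intro exI[of _ u] exI[of _ h]) linarith
  qed
  with f show ?thesis by (simp add: approx_def)
qed

lemma approx_add:
  assumes "f \<in> approx" "g \<in> approx"
  shows "(\<lambda>w. f w + g w) \<in> approx"
proof -
  have s: "f \<in> square_integrable M" "g \<in> square_integrable M" using assms by (simp_all add: approx_def)
  have "\<exists>u h. model u h \<and> (\<integral>w. (norm (f w + g w - u w))\<^sup>2 \<partial>M) < e" if e: "0 < e" for e
  proof -
    obtain u h v k where u: "model u h" "(\<integral>w. (norm (f w - u w))\<^sup>2 \<partial>M) < e / 4"
      and v: "model v k" "(\<integral>w. (norm (g w - v w))\<^sup>2 \<partial>M) < e / 4"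
      using assms e unfolding approx_def by (auto dest!: spec[of _ "e / 4"])
    have "(\<integral>w. (norm (f w + g w - (u w + v w)))\<^sup>2 \<partial>M) \<le> 2 * (\<integral>w. (norm (f w - u w))\<^sup>2 \<partial>M) + 2 * (\<integral>w. (norm (g w - v w))\<^sup>2 \<partial>M)"
      using square_integrable_add(2)[of "\<lambda>w. f w - u w" M "\<lambda>w. g w - v w"] s
        model_square_integrable[OF u(1)] model_square_integrable[OF v(1)]
      by (simp add: square_integrable_diff add_diff_add)
    then show ?thesis using u v model.add[OF u(1) v(1)] by (intro exI[of _ "\<lambda>w. u w + v w"] exI[of _ "h + k"]) auto
  qed
  with square_integrable_add(1)[OF s] show ?thesis by (simp add: approx_def)
qed

lemma approx_dominated:
  assumes f: "\<And>n. f n \<in> approx" and [measurable]: "f' \<in> borel_measurable M" and u: "integrable M (\<lambda>w. (u w)\<^sup>2)"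
    and bound: "\<And>n w. norm (f n w) \<le> u w" and lim: "\<And>w. (\<lambda>n. f n w) \<longlonglongrightarrow> f' w"
  shows "f' \<in> approx"
proof -
  have fs: "f n \<in> square_integrable M" for n using f by (simp add: approx_def)
  have m: "f n \<in> borel_measurable M" for n by (rule square_integrable_measurable[OF fs])
  note dc = square_integrable_dominated_convergence[OF m assms(2) u bound lim]
  show ?thesis
  proof (rule approx_limit[OF dc(1)])
    fix e :: real assume "0 < e"
    then obtain n where "(\<integral>w. (norm (f' w - f n w))\<^sup>2 \<partial>M) < e"
      using LIMSEQ_D[OF dc(2), of e] by force
    then show "\<exists>g\<in>approx. (\<integral>w. (norm (f' w - g w))\<^sup>2 \<partial>M) < e" using f by blast
  qed
qed

lemma approx_bounded:
  assumes "\<And>n. f n \<in> approx" "f' \<in> borel_measurable M"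
    and "\<And>n w. norm (f n w) \<le> K" and "\<And>w. (\<lambda>n. f n w) \<longlonglongrightarrow> f' w"
  shows "f' \<in> approx"
  by (rule approx_dominated[OF assms(1,2) _ assms(3,4)]) simp

lemma approx_smul:
  assumes "f \<in> approx"
  shows "(\<lambda>w. c * f w) \<in> approx"
proof -
  have s: "f \<in> square_integrable M" using assms by (simp add: approx_def)
  have "\<exists>u h. model u h \<and> (\<integral>w. (norm (c * f w - u w))\<^sup>2 \<partial>M) < e" if e: "0 < e" for e
  proof -
    have "0 < e / ((norm c)\<^sup>2 + 1)" using e by (simp add: add_nonneg_pos)
    then obtain u h where u: "model u h" "(\<integral>w. (norm (f w - u w))\<^sup>2 \<partial>M) < e / ((norm c)\<^sup>2 + 1)"
      using assms e unfolding approx_def by blast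
    have "(\<integral>w. (norm (c * f w - c * u w))\<^sup>2 \<partial>M) = (norm c)\<^sup>2 * (\<integral>w. (norm (f w - u w))\<^sup>2 \<partial>M)"
      by (simp add: norm_mult power_mult_distrib flip: right_diff_distrib)
    also have "\<dots> \<le> ((norm c)\<^sup>2 + 1) * (\<integral>w. (norm (f w - u w))\<^sup>2 \<partial>M)" by (intro mult_right_mono) auto
    also have "\<dots> < e" using u(2) by (simp add: pos_less_divide_eq add_nonneg_pos mult.commute)
    finally show ?thesis using model_smul[OF u(1), of c] by blast
  qed
  with square_integrable_mult[OF s] show ?thesis by (simp add: approx_def)
qed

lemma approx_zero: "(\<lambda>w. 0) \<in> approx"
  using approx_smul[OF approx_model[OF model.gen[OF calc.id]], of 0] by simp

lemma approx_sum: "(\<And>i. i \<in> I \<Longrightarrow> f i \<in> approx) \<Longrightarrow> (\<lambda>w. \<Sum>i\<in>I. f i w) \<in> approx"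
  by (induction I rule: infinite_finite_induct) (simp_all add: approx_zero approx_add)

lemma calc_polynomial:
  assumes "calc res_b res_c (\<lambda>a. of_real (u a)) U"
  shows "real_polynomial_function p \<Longrightarrow> \<exists>G. calc res_b res_c (\<lambda>a. of_real (p (u a))) G"
proof (induction rule: real_polynomial_function.induct)
  case (linear p)
  then obtain c where "\<And>y. p y = y * c" by (auto simp: real_bounded_linear)
  then show ?case using calc.smul[OF assms, of "of_real c"] by (auto simp: mult.commute)
next
  case (const c)
  show ?case using calc.smul[OF calc.id, of _ _ "of_real c"] by auto
next
  case (add p q)
  then obtain G H where "calc res_b res_c (\<lambda>a. of_real (p (u a))) G" "calc res_b res_c (\<lambda>a. of_real (q (u a))) H"
    by blast
  from calc.add[OF this] show ?case by auto
next
  case (mult p q)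
  then obtain G H where "calc res_b res_c (\<lambda>a. of_real (p (u a))) G" "calc res_b res_c (\<lambda>a. of_real (q (u a))) H"
    by blast
  from calc_mult[OF this] show ?case by auto
qed

text \<open>As \<open>u\<close> is bounded by some \<open>K\<close>, polynomials tending to
  \<open>\<phi>\<close> uniformly on \<open>{-K..K}\<close> suffice, and composed with
  \<open>u\<close> they stay in the calculus. Errors below 1 make \<open>L + 1\<close> a common
  bound.\<close>

lemma approx_continuous:
  fixes \<phi> :: "real \<Rightarrow> real"
  assumes u: "calc res_b res_c (\<lambda>a. of_real (u a)) U" and \<phi>: "continuous_on UNIV \<phi>"
    and um [measurable]: "u \<in> borel_measurable borel"
  shows "lift k (\<lambda>a. of_real (\<phi> (u a))) \<in> approx"
proof -
  have [measurable]: "\<phi> \<in> borel_measurable borel" by (rule borel_measurable_continuous_onI[OF \<phi>])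
  obtain K where "\<And>a. norm (of_real (u a) :: 'k) \<le> K" using calc_bounded[OF res_le_one u] by blast
  then have K: "\<bar>u a\<bar> \<le> K" for a by simp
  have "\<exists>p. real_polynomial_function p \<and> (\<forall>y\<in>{-K..K}. \<bar>\<phi> y - p y\<bar> < inverse (real (Suc n)))" for n
    by (rule Stone_Weierstrass_real_polynomial_function[of "{-K..K}" \<phi> "inverse (real (Suc n))"])
       (auto intro: continuous_on_subset[OF \<phi>])
  then obtain p where p: "\<And>n. real_polynomial_function (p n)"
    "\<And>n y. y \<in> {-K..K} \<Longrightarrow> \<bar>\<phi> y - p n y\<bar> < inverse (real (Suc n))" by metis
  have pu: "\<bar>\<phi> (u a) - p n (u a)\<bar> < inverse (real (Suc n))" for n a
    using p(2)[of "u a" n] K[of a] by (simp add: abs_le_iff)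
  have "compact (\<phi> ` {-K..K})" by (intro compact_continuous_image continuous_on_subset[OF \<phi>]) auto
  then obtain L where L: "\<And>y. y \<in> {-K..K} \<Longrightarrow> \<bar>\<phi> y\<bar> \<le> L"
    using compact_imp_bounded bounded_iff by (metis image_eqI real_norm_def)
  have Lu: "\<bar>p n (u a)\<bar> \<le> L + 1" for n a
  proof -
    have "inverse (real (Suc n)) \<le> 1" by (simp add: inverse_le_1_iff)
    moreover have "\<bar>\<phi> (u a)\<bar> \<le> L" using L[of "u a"] K[of a] by (simp add: abs_le_iff)
    ultimately show ?thesis using pu[of a n] by linarith
  qed
  have "0 \<le> L + 1" using Lu[of undefined undefined] by linarith
  show ?thesis
  proof (rule approx_bounded)
    show "lift k (\<lambda>a. of_real (p n (u a))) \<in> approx" for n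
      using calc_polynomial[OF u p(1)[of n]] model.gen approx_model by blast
    show "lift k (\<lambda>a. of_real (\<phi> (u a))) \<in> borel_measurable M" by measurable
    show "norm (lift k (\<lambda>a. of_real (p n (u a))) w :: 'k) \<le> L + 1" for n w
      using Lu \<open>0 \<le> L + 1\<close> by (simp add: lift_def)
    show "(\<lambda>n. lift k (\<lambda>a. of_real (p n (u a))) w) \<longlonglongrightarrow> (lift k (\<lambda>a. of_real (\<phi> (u a))) w :: 'k)" for w
    proof -
      have "(\<lambda>n. p n (u (snd w)) - \<phi> (u (snd w))) \<longlonglongrightarrow> 0"
        by (rule Lim_null_comparison[OF always_eventually LIMSEQ_inverse_real_of_nat])
           (use pu in \<open>simp add: abs_minus_commute less_imp_le del: of_nat_Suc\<close>)
      then have "(\<lambda>n. p n (u (snd w))) \<longlonglongrightarrow> \<phi> (u (snd w))" by (rule LIM_zero_cancel)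
      then show ?thesis by (auto simp: lift_def intro: tendsto_of_real)
    qed
  qed
qed

lemma approx_positive:
  assumes u: "calc res_b res_c (\<lambda>a. of_real (u a)) U" and um [measurable]: "u \<in> borel_measurable borel"
  shows "lift k (indicator {a. 0 < u a}) \<in> approx"
proof (rule approx_bounded)
  \<comment> \<open>Continuous ramps that are 0 for \<open>y \<le> 0\<close> and, for
    \<open>n > 0\<close>, equal to 1 from \<open>1/n\<close> on; they tend pointwise to the
    indicator of the positive reals.\<close>
  define \<phi> where "\<phi> n y = min 1 (max 0 (real n * y))" for n y
  show "lift k (\<lambda>a. of_real (\<phi> n (u a))) \<in> approx" for n
    unfolding \<phi>_def by (intro approx_continuous[OF u _ um] continuous_intros)
  show "lift k (indicator {a. 0 < u a} :: real \<Rightarrow> 'k) \<in> borel_measurable M" by measurable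
  show "norm (lift k (\<lambda>a. of_real (\<phi> n (u a))) w :: 'k) \<le> 1" for n w
    by (auto simp: lift_def \<phi>_def)
  show "(\<lambda>n. lift k (\<lambda>a. of_real (\<phi> n (u a))) w) \<longlonglongrightarrow> (lift k (indicator {a. 0 < u a}) w :: 'k)" for w
  proof -
    have "(\<lambda>n. \<phi> n y) \<longlonglongrightarrow> indicator {y. 0 < y} y" for y :: real
    proof (cases "0 < y")
      case True
      obtain N :: nat where N: "1 / y < real N" using reals_Archimedean2 by blast
      have "\<phi> n y = 1" if "N \<le> n" for n
      proof -
        have "1 < real N * y" using N True by (simp add: field_simps)
        also have "\<dots> \<le> real n * y" using that True by (intro mult_right_mono) auto
        finally show ?thesis by (simp add: \<phi>_def)
      qed
      then have "\<forall>\<^sub>F n in sequentially. \<phi> n y = 1" unfolding eventually_sequentially by blast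
      then show ?thesis using True by (simp add: tendsto_eventually)
    next
      case False
      then have "real n * y \<le> 0" for n by (simp add: mult_nonneg_nonpos)
      then have "\<phi> n y = 0" for n by (simp add: \<phi>_def max_absorb1)
      then show ?thesis using False by simp
    qed
    from tendsto_of_real[OF this[of "u (snd w)"], where ?'a = 'k]
    have "(\<lambda>n. of_real (\<phi> n (u (snd w)))) \<longlonglongrightarrow> (indicator {a. 0 < u a} (snd w) :: 'k)"
      by (simp add: indicator_def of_bool_def split: if_splits)
    then show ?thesis by (simp add: lift_def)
  qed
qed

text \<open>Complements and disjoint countable unions pass through limits of sums, so the calculus
  has to produce indicators of closed intervals only.\<close>

lemma approx_slice:
  assumes "E \<in> sets borel"
  shows "lift k (indicator E) \<in> approx"
  using assms
proof (induction rule: borel_set_induct)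
  case empty
  then show ?case using approx_zero by (simp add: lift_def[abs_def] if_distrib cong: if_cong)
next
  case (interval s t)
  \<comment> \<open>The quadratic is positive exactly outside \<open>{s..t}\<close>; the positive
    factor \<open>res_b\<close> keeps the sign and makes it a combination of 1, \<open>res_b\<close>
    and \<open>res_c\<close>.\<close>
  define u where "u a = (a - s) * (a - t) * res_b a" for a
  have u_eq: "u a = 1 + (s * t - 1) * res_b a - (s + t) * res_c a" for a
  proof -
    define d where "d = 1 + a\<^sup>2"
    have "d \<noteq> 0" unfolding d_def by (metis add_pos_nonneg less_irrefl zero_le_power2 zero_less_one)
    have "(a - s) * (a - t) = d + (s * t - 1) - (s + t) * a"
      by (simp add: d_def power2_eq_square algebra_simps)
    then have "u a = (d + (s * t - 1) - (s + t) * a) / d" by (simp add: u_def res_b_def d_def)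
    also have "\<dots> = 1 + (s * t - 1) * (1 / d) - (s + t) * (a / d)"
      using \<open>d \<noteq> 0\<close> by (simp add: add_divide_distrib diff_divide_distrib)
    finally show ?thesis by (simp add: res_b_def res_c_def d_def)
  qed
  have u: "(\<lambda>a. of_real (u a) :: 'k) = (\<lambda>a. 1 + of_real (s * t - 1) * (of_real (res_b a) * 1) + of_real (- (s + t)) * (of_real (res_c a) * 1))"
    by (simp add: fun_eq_iff u_eq algebra_simps)
  have "\<exists>U. calc res_b res_c (\<lambda>a. of_real (u a)) U"
    unfolding u
    by (rule exI, rule calc.add[OF calc.add[OF calc.id calc.smul[OF calc.mult_B[OF calc.id]]] calc.smul[OF calc.mult_C[OF calc.id]]])
  then have pos: "lift k (indicator {a. 0 < u a}) \<in> approx"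
    by (auto intro: approx_positive simp: u_def)
  have eq: "lift k (indicator {s..t}) = (\<lambda>w. lift k (\<lambda>_. 1) w + (- 1) * lift k (indicator {a. 0 < u a}) w)"
  proof
    fix w
    have "0 < u a \<longleftrightarrow> a \<notin> {s..t}" for a
      using interval res_pos[of a] by (auto simp: u_def zero_less_mult_iff)
    then show "lift k (indicator {s..t}) w = lift k (\<lambda>_. 1) w + (- 1) * lift k (indicator {a. 0 < u a}) w"
      by (simp add: lift_def indicator_def)
  qed
  show ?case unfolding eq by (rule approx_add[OF approx_model[OF model.gen[OF calc.id]] approx_smul[OF pos]])
next
  case (compl E)
  have eq: "lift k (indicator (- E)) = (\<lambda>w. lift k (\<lambda>_. 1) w + (- 1) * lift k (indicator E) w)"
    by (auto simp: lift_def indicator_def)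
  show ?case unfolding eq by (rule approx_add[OF approx_model[OF model.gen[OF calc.id]] approx_smul[OF compl(2)]])
next
  case (union E)
  have d: "disjoint_family E" by (rule union(1))
  show ?case
  proof (rule approx_bounded)
    show "(\<lambda>w. \<Sum>i<n. lift k (indicator (E i)) w) \<in> approx" for n by (intro approx_sum union)
    have [measurable]: "E i \<in> sets borel" for i using union(2) by auto
    show "lift k (indicator (\<Union>i. E i)) \<in> borel_measurable M" by measurable
    have sum: "(\<Sum>i<n. lift k (indicator (E i)) w) = (lift k (indicator (\<Union>i<n. E i)) w :: 'k)" for n w
    proof -
      have "(indicator (\<Union>i<n. E i) (snd w) :: 'k) = (\<Sum>i<n. indicator (E i) (snd w))"
        using d by (intro indicator_UN_disjoint) (auto intro: disjoint_family_on_mono)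
      then show ?thesis by (simp add: lift_def)
    qed
    show "norm (\<Sum>i<n. lift k (indicator (E i)) w :: 'k) \<le> 1" for n w
      unfolding sum by (simp add: lift_def indicator_def)
    show "(\<lambda>n. \<Sum>i<n. lift k (indicator (E i)) w) \<longlonglongrightarrow> (lift k (indicator (\<Union>i. E i)) w :: 'k)" for w
      unfolding sum by (cases "fst w = k") (simp_all add: lift_def LIMSEQ_indicator_UN)
  qed
qed

text \<open>Adding the slices of \<open>A\<close> on the first \<open>n\<close> fibres gives
  functions bounded by 1 that agree with the indicator at each point from some \<open>n\<close>
  on.\<close>

lemma approx_indicator:
  assumes A: "A \<in> sets M"
  shows "indicator A \<in> approx"
proof (rule approx_bounded)
  have "Pair k -` A \<in> sets borel" for k
    using sets_Pair1[of A "count_space UNIV" borel k] A by simp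
  then show "(\<lambda>w. \<Sum>k<n. lift k (indicator (Pair k -` A)) w) \<in> approx" for n by (intro approx_sum approx_slice)
  show "indicator A \<in> borel_measurable M" using A by measurable
  have sum: "(\<Sum>k<n. lift k (indicator (Pair k -` A)) w) = (if fst w < n then indicator A w else 0 :: 'k)" for n w
    by (simp add: lift_def indicator_def)
  show "norm (\<Sum>k<n. lift k (indicator (Pair k -` A)) w :: 'k) \<le> 1" for n w
    unfolding sum by (simp add: indicator_def)
  have "\<forall>\<^sub>F n in sequentially. (if fst w < n then indicator A w else 0) = (indicator A w :: 'k)" for w
    using eventually_gt_at_top[of "fst w"] by eventually_elim simp
  then show "(\<lambda>n. \<Sum>k<n. lift k (indicator (Pair k -` A)) w) \<longlonglongrightarrow> (indicator A w :: 'k)" for w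
    unfolding sum by (rule tendsto_eventually)
qed

lemma approx_simple:
  assumes "simple_function M f"
  shows "f \<in> approx"
proof -
  have "f = (\<lambda>w. \<Sum>y\<in>range f. y * indicator (f -` {y}) w)"
    using simple_functionD(1)[OF assms] by (auto simp: fun_eq_iff indicator_def sum.delta' if_distrib cong: if_cong)
  moreover have "(\<lambda>w. \<Sum>y\<in>range f. y * indicator (f -` {y}) w) \<in> approx"
    using simple_functionD(2)[OF assms] by (intro approx_sum approx_smul approx_indicator) auto
  ultimately show ?thesis by simp
qed

lemma approx_all:
  assumes f: "f \<in> square_integrable M"
  shows "f \<in> approx"
proof -
  obtain s where s: "\<And>i. simple_function M (s i)" "\<And>w. (\<lambda>i. s i w) \<longlonglongrightarrow> f w" "\<And>i w. dist (s i w) 0 \<le> 2 * dist (f w) 0"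
    using borel_measurable_implies_sequence_metric[OF square_integrable_measurable[OF f], of 0] by auto
  show ?thesis
  proof (rule approx_dominated[of s f "\<lambda>w. 2 * norm (f w)"])
    show "integrable M (\<lambda>w. (2 * norm (f w))\<^sup>2)"
      using square_integrable_integrable[OF f] by (simp add: power_mult_distrib)
  qed (use s approx_simple square_integrable_measurable[OF f] in auto)
qed

sublocale isometric_relation smul ip M model
  by standard
     (use model_square_integrable model_diff model_inner model_dense_ran approx_all in \<open>auto simp: approx_def\<close>)

section \<open>The operators \<open>B\<close>, \<open>C\<close> and finally \<open>A\<close> in the
  model\<close>

lemma represents_BC:
  assumes "represents f h"
  shows "represents (\<lambda>w. of_real (res_b (snd w)) * f w) (B h)" "represents (\<lambda>w. of_real (res_c (snd w)) * f w) (C h)"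
proof -
  have f: "f \<in> square_integrable M" using assms by (simp add: represents_def)
  show "represents (\<lambda>w. of_real (res_b (snd w)) * f w) (B h)"
    unfolding represents_def
  proof (intro conjI allI impI)
    show "(\<lambda>w. of_real (res_b (snd w)) * f w) \<in> square_integrable M"
      by (rule square_integrable_mult_bounded[OF f]) (auto simp: res_le_one)
    fix g k assume "model g k"
    \<comment> \<open>Symmetry moves \<open>B\<close> to the second argument, where
      \<open>model_BC\<close> applies; \<open>res_b\<close> is real and hence fixed by
      conjugation.\<close>
    from model_BC(1)[OF this] show "ip (B h) k = (\<integral>w. of_real (res_b (snd w)) * f w * kconj (g w) \<partial>M)"
      using assms by (simp add: represents_def B_sym kconj_mult mult_ac)
  qed
  show "represents (\<lambda>w. of_real (res_c (snd w)) * f w) (C h)"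
    unfolding represents_def
  proof (intro conjI allI impI)
    show "(\<lambda>w. of_real (res_c (snd w)) * f w) \<in> square_integrable M"
      by (rule square_integrable_mult_bounded[OF f]) (auto simp: res_le_one)
    fix g k assume "model g k"
    from model_BC(2)[OF this] show "ip (C h) k = (\<integral>w. of_real (res_c (snd w)) * f w * kconj (g w) \<partial>M)"
      using assms by (simp add: represents_def C_sym kconj_mult mult_ac)
  qed
qed

text \<open>Since \<open>res_c a = a * res_b a\<close> with \<open>res_b a > 0\<close>, the identity
  \<open>B k = C h\<close> can be divided pointwise. The unbounded factor appears only in a
  pointwise equation, without presupposing that the product is square integrable.\<close>

lemma BC_eq_iff:
  assumes f: "represents f h" and g: "represents g k"
  shows "B k = C h \<longleftrightarrow> (AE w in M. g w = of_real (snd w) * f w)"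
proof -
  note Bg = represents_BC(1)[OF g] and Cf = represents_BC(2)[OF f]
  have res: "res_c a = a * res_b a" for a by (simp add: res_b_def res_c_def)
  have "of_real (res_b a) * z = of_real (res_c a) * y \<longleftrightarrow> z = of_real a * y" for a and y z :: 'k
    unfolding res using res_pos[of a] by (auto simp: mult_ac)
  then have "(AE w in M. g w = of_real (snd w) * f w) \<longleftrightarrow>
      (AE w in M. of_real (res_b (snd w)) * g w = of_real (res_c (snd w)) * f w)" by simp
  also have "\<dots> \<longleftrightarrow> B k = C h"
  proof
    assume "B k = C h"
    then show "AE w in M. of_real (res_b (snd w)) * g w = of_real (res_c (snd w)) * f w"
      using represents_unique_left[OF Bg, of "\<lambda>w. of_real (res_c (snd w)) * f w"] Cf by simp
  next
    assume "AE w in M. of_real (res_b (snd w)) * g w = of_real (res_c (snd w)) * f w"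
    moreover have "(\<lambda>w. of_real (res_b (snd w)) * g w) \<in> square_integrable M" using Bg by (simp add: represents_def)
    ultimately have "represents (\<lambda>w. of_real (res_b (snd w)) * g w) (C h)" by (intro represents_AE[OF Cf])
    with Bg show "B k = C h" by (rule represents_unique_right)
  qed
  finally show ?thesis ..
qed

end

theorem theorem5p3:
  fixes smul :: "'k::real_or_complex \<Rightarrow> 'h::banach \<Rightarrow> 'h"
    and ip :: "'h \<Rightarrow> 'h \<Rightarrow> 'k"
    and D :: "'h set"
    and A :: "'h \<Rightarrow> 'h"
  assumes "hilbert_space smul ip"
    and "separable_space (euclidean :: 'h topology)"
    and "infinite_dimensional smul"
    and "linear_operator smul D A"
    and "densely_defined D"
    and "self_adjoint ip D A"
  shows "\<exists>(M :: (nat \<times> real) measure) (U :: 'h \<Rightarrow> (nat \<times> real \<Rightarrow> 'k) set)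
            (DT :: (nat \<times> real \<Rightarrow> 'k) set set) T.
           prob_space M \<and> unitary_to_L2 smul ip M U \<and> real_multiplication_operator M DT T \<and>
           (\<forall>x. x \<in> D \<longleftrightarrow> U x \<in> DT) \<and> (\<forall>x\<in>D. U (A x) = T (U x))"
proof -
  obtain B C where BC: "resolvent_pair smul ip B C" and DA: "\<And>x y. x \<in> D \<and> A x = y \<longleftrightarrow> B y = C x"
    using self_adjoint_resolvent_pair[OF assms(1,4,5,6)] by blast
  interpret resolvent_pair smul ip B C by (rule BC)
  \<comment> \<open>A nonzero vector is what allows the total mass to be scaled to 1; the zero space
    would be spanned by the empty set.\<close>
  have "\<exists>v. v \<noteq> (0 :: 'h)"
  proof (rule ccontr)
    assume "\<not> ?thesis"
    then have "span {} = (UNIV :: 'h set)" by auto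
    then show False using assms(3) unfolding infinite_dimensional_def by blast
  qed
  then obtain x :: "nat \<Rightarrow> 'h" where x: "(\<lambda>k. (norm (x k))\<^sup>2) sums 1"
    "\<forall>j k f F g G. j \<noteq> k \<longrightarrow> calc res_b res_c f F \<longrightarrow> calc res_b res_c g G \<longrightarrow> ip (F (x j)) (G (x k)) = 0"
    "\<forall>V. subspace V \<longrightarrow> closed V \<longrightarrow> (\<forall>k f F. calc res_b res_c f F \<longrightarrow> F (x k) \<in> V) \<longrightarrow> V = UNIV"
    using normalized_cyclic_decomposition[OF assms(2)] by blast
  have "\<forall>k. \<exists>\<mu>. finite_measure \<mu> \<and> sets \<mu> = sets borel \<and>
    (\<forall>f F. calc res_b res_c f F \<longrightarrow> ip (F (x k)) (x k) = (\<integral>a. f a \<partial>\<mu>))"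
    using spectral_measure by blast
  then obtain \<mu> where \<mu>: "\<And>k. finite_measure (\<mu> k)" "\<And>k. sets (\<mu> k) = sets borel"
    "\<And>k f F. calc res_b res_c f F \<Longrightarrow> ip (F (x k)) (x k) = (\<integral>a. f a \<partial>\<mu> k)"
    by metis
  obtain M where M: "sets M = sets (count_space UNIV \<Otimes>\<^sub>M borel)"
    "\<And>A. A \<in> sets M \<Longrightarrow> emeasure M A = (\<Sum>k. emeasure (\<mu> k) (Pair k -` A))"
    using mixture_measure[of \<mu>, OF \<mu>(2)] by blast
  interpret spectral_model smul ip B C x \<mu> M
  proof (intro spectral_model.intro BC spectral_model_axioms.intro)
    show "(\<lambda>k. (norm (x k))\<^sup>2) sums 1" by (rule x(1))
    show "ip (F (x j)) (G (x k)) = 0" if "j \<noteq> k" "calc res_b res_c f F" "calc res_b res_c g G" for j k f F g G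
      using x(2) that by blast
    show "V = UNIV" if "subspace V" "closed V" "\<And>k f F. calc res_b res_c f F \<Longrightarrow> F (x k) \<in> V" for V
      using x(3) that by simp
  qed (fact \<mu> M)+
  obtain U where U: "unitary_to_L2 smul ip M U"
    "\<And>f h. f \<in> square_integrable M \<Longrightarrow> U h = L2_class M f \<longleftrightarrow> represents f h"
    using unitary_extension by blast
  have snd_meas: "snd \<in> borel_measurable M" by measurable
  have key: "x \<in> D \<longleftrightarrow> U x \<in> mult_dom M snd" "x \<in> D \<Longrightarrow> U (A x) = mult_op M snd (U x)" for x
  proof -
    obtain f where f: "represents f x" using represents_total by blast
    then have fs: "f \<in> square_integrable M" by (simp add: represents_def)
    have Ux: "U x = L2_class M f" using U(2)[OF fs] f by simp
    note dom = mult_dom_class[OF fs snd_meas, folded Ux]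
    \<comment> \<open>Square integrability of the product is part of the claim; it holds because the
      product agrees almost everywhere with the function \<open>g\<close> of
      \<open>A x\<close>.\<close>
    have fwd: "represents (\<lambda>w. of_real (snd w) * f w) (A x)" if "x \<in> D"
    proof -
      obtain g where g: "represents g (A x)" using represents_total by blast
      have "B (A x) = C x" using that DA by blast
      then have eq: "AE w in M. g w = of_real (snd w) * f w" using BC_eq_iff[OF f g] by simp
      have gs: "g \<in> square_integrable M" using g by (simp add: represents_def)
      note [measurable] = square_integrable_measurable[OF fs]
      have "AE w in M. (norm (of_real (snd w) * f w))\<^sup>2 \<le> (norm (g w))\<^sup>2"
        using eq by eventually_elim simp
      then have "(\<lambda>w. of_real (snd w) * f w) \<in> square_integrable M"
        by (intro square_integrable_bound[OF square_integrable_integrable[OF gs]]) auto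
      then show ?thesis using eq by (intro represents_AE[OF g]) auto
    qed
    show "x \<in> D \<longleftrightarrow> U x \<in> mult_dom M snd"
      unfolding dom
    proof
      assume "x \<in> D"
      then show "(\<lambda>w. of_real (snd w) * f w) \<in> square_integrable M" using fwd by (simp add: represents_def)
    next
      \<comment> \<open>Surjectivity provides a vector \<open>y\<close> for the product, and the
        resulting \<open>B y = C x\<close> puts \<open>x\<close> into \<open>D\<close>.\<close>
      assume s: "(\<lambda>w. of_real (snd w) * f w) \<in> square_integrable M"
      then obtain y where "represents (\<lambda>w. of_real (snd w) * f w) y" using represents_surj by blast
      then have "B y = C x" using BC_eq_iff[OF f] by simp
      then show "x \<in> D" using DA by blast
    qed
    show "U (A x) = mult_op M snd (U x)" if "x \<in> D"
      unfolding Ux mult_op_class[OF fs] using U(2) fwd[OF that] by (simp add: represents_def)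
  qed
  have "real_multiplication_operator M (mult_dom M snd) (mult_op M snd :: (nat \<times> real \<Rightarrow> 'k) set \<Rightarrow> _)"
    unfolding real_multiplication_operator_def using snd_meas by blast
  with prob_space_M U(1) key show ?thesis by blast
qed

end
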